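(* Let $n\in\mathbb{N}$, and let $\alpha(n)$ and $\beta(n)$ be the numbers of orbits in the pattern set $\mathcal{X}(n)$ under the action of $C_n\times C_n\times C_n$ and under the joint action of $C_n\times C_n\times C_n$ and $R$, respectively (as defined in the context). Then: (i) The number of linear isotopy types of standard linear graph knots of $n$-grids is $\alpha(n)$. (ii) The number of rotational (linear) isotopy types of standard linear graph knots of $n$-grids is $\beta(n)$. (iii) The number of periodic isotopy classes of $n$-grids is $\beta(n)$.
   Context: Nets. A (proper) linear 3-periodic net in $\mathbb{R}^3$ is a pair $\mathcal{N}=(N,S)$ where (i) $S$, the set of edges, is a countable set of line segments $[p,q]$, $p\ne q$, which are essentially disjoint (two distinct segments meet at most in a common endpoint); (ii) $N$, the set of nodes, is the set of endpoints of members of $S$; (iii) there is a basis $\underline{a}=\{a_1,a_2,a_3\}$ of $\mathbb{R}^3$ such that $N$ and $S$ are invariant under the group $\mathcal{T}$ of translations by integer combinations of $a_1,a_2,a_3$; (iv) $N$ and $S$ partition into finitely many $\mathcal{T}$-orbits. Such a basis is a periodicity basis for $\mathcal{N}$. The body $|\mathcal{N}|$ is the union of the segments in $S$. $n$-grids. $\mathcal{M}_{\rm pcu}$ is the primitive cubic net with node set $\mathbb{Z}^3$ and edges $[v,v+b_i]$, $v\in\mathbb{Z}^3$, $i=1,2,3$, where $\underline{b}=\{b_1,b_2,b_3\}$ is the standard right-handed orthonormal basis. An $n$-grid is a proper linear 3-periodic net with $n$ connected components each of which is a translate of $\mathcal{M}_{\rm pcu}$. Its standard periodicity basis is $\underline{b}$.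 Graph knots. The flat 3-torus is identified with $[0,1)^3$ via the quotient map $q:\mathbb{R}^3\to\mathbb{R}^3/\mathbb{Z}^3=[0,1)^3$; a line segment in the flat torus is the image under $q$ of a nondegenerate segment in $\mathbb{R}^3$. A linear graph knot $K=(N,S)$ in the flat torus consists of a finite set $N$ of distinct points of $[0,1)^3$ (nodes) and a finite set $S$ of flat torus line segments with endpoints in $N$ that are essentially disjoint (no self-intersections or mutual intersections except at endpoints); $|K|$ is the union of its segments. The standard linear graph knot of an $n$-grid $\mathcal{N}$ is $(q(N),q(S))$, the union of $n$ disjoint translates of the graph knot of $\mathcal{M}_{\rm pcu}$. Linear graph knots $K_0=(N_0,S_0)$, $K_1=(N_1,S_1)$ are linearly isotopic if there are linear graph knots $K_t=(N_t,S_t)$, $0<t<1$, and bijective continuous functions $f_t:|K_0|\to|K_t|$, $0\le t\le1$, with $f_0$ the identity, $f_t(N_0)=N_t$, $f_t(S_0)=S_t$, and $t\mapsto f_t(p)$ continuous for each $p\in|K_0|$. For $X\in GL^+(3,\mathbb{Z})$ (integer matrices of determinant 1) let $X_\pi$ be the induced homeomorphism of the flat torus. $K_0$ and $K_1$ are rotationally linearly isotopic if for some rotation $X\in GL^+(3,\mathbb{Z})$ the graph knots $K_1$ and $X_\pi K_0$ are linearly isotopic. Periodic isotopy. Proper linear 3-periodic nets $\mathcal{N}_0,\mathcal{N}_1$ are periodically isotopic if there is a family of proper linear 3-periodic nets $\mathcal{N}_t$, $0<t<1$, such that (a) there is a continuous path of bases $t\mapsto\underline{a}^t$ of $\mathbb{R}^3$,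 $0\le t\le1$, with $\underline{a}^t$ a right-handed periodicity basis for $\mathcal{N}_t$; (b) there are bijections $f_t:|\mathcal{N}_0|\to|\mathcal{N}_t|$, $0\le t\le1$, mapping nodes to nodes, such that $f_0$ is the identity, $t\mapsto f_t(p)$ is continuous for each node $p$ of $\mathcal{N}_0$, and $f_t$ restricted to each edge $[a,b]$ is the affine map onto the edge $[f_t(a),f_t(b)]$ of $\mathcal{N}_t$. Patterns. Let $T=\{1,\dots,n\}^3$, a discrete 3-torus. $\mathcal{X}(n)$ is the set of patterns, i.e. $n$-element subsets $\{p_1,\dots,p_n\}$ of $T$ with distinct coordinates: for $i\ne j$ all three coordinates of $p_i-p_j$ are nonzero (so $|\mathcal{X}(n)|=(n!)^2$). The cyclic group $C_n$ of order $n$ acts on one coordinate of $T$ by cyclic permutation of $\{1,\dots,n\}$, giving an action of $C_n\times C_n\times C_n$ on $T$ and on $\mathcal{X}(n)$. $R$ is the rotation symmetry group (order 24) of the unit cube $[0,1]^3$, acting naturally on $T$ (as rotations of the cubical array $\{1,\dots,n\}^3$ about its centre) and on $\mathcal{X}(n)$. $\alpha(n)$ is the number of orbits in $\mathcal{X}(n)$ under $C_n\times C_n\times C_n$; $\beta(n)$ is the number of orbits under the group of transformations generated by $C_n\times C_n\times C_n$ and $R$. *)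

theory Defs
  imports "HOL-Analysis.Analysis" "HOL-Algebra.Group_Action" "HOL-Algebra.Generated_Groups"
begin

definition num_classes :: "'a set \<Rightarrow> ('a \<Rightarrow> 'a \<Rightarrow> bool) \<Rightarrow> nat" where
  "num_classes A R = card (A // {(x, y). x \<in> A \<and> y \<in> A \<and> R x y})"

section \<open>Linear periodic nets\<close>

text \<open>A net is a pair of a node set and a set of edges; an edge is a closed segment, as a point
  set.\<close>

type_synonym net = "(real^3) set \<times> (real^3) set set"

definition nodes :: "net \<Rightarrow> (real^3) set" where "nodes G = fst G"
definition edges :: "net \<Rightarrow> (real^3) set set" where "edges G = snd G"
definition body :: "net \<Rightarrow> (real^3) set" where "body G = \<Union>(edges G)"

definition is_segment :: "(real^3) set \<Rightarrow> bool" where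
  "is_segment s \<longleftrightarrow> (\<exists>p q. p \<noteq> q \<and> s = closed_segment p q)"

definition endpoints :: "(real^3) set \<Rightarrow> (real^3) set" where
  "endpoints s = {p. \<exists>q. s = closed_segment p q}"

text \<open>An ordered basis is a matrix whose rows are the basis vectors, so that it is right-handed
  iff its determinant is positive.\<close>

definition is_basis :: "real^3^3 \<Rightarrow> bool" where
  "is_basis a \<longleftrightarrow> inj (\<lambda>i. a $ i) \<and> independent (range (\<lambda>i. a $ i))
     \<and> span (range (\<lambda>i. a $ i)) = UNIV"

definition right_handed :: "real^3^3 \<Rightarrow> bool" where
  "right_handed a \<longleftrightarrow> det a > 0"

definition lattice_of :: "real^3^3 \<Rightarrow> (real^3) set" where
  "lattice_of a = range (\<lambda>k :: 3 \<Rightarrow> int. \<Sum>i\<in>UNIV. real_of_int (k i) *\<^sub>R (a $ i))"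

definition periodicity_basis :: "real^3^3 \<Rightarrow> net \<Rightarrow> bool" where
  "periodicity_basis a G \<longleftrightarrow> is_basis a
     \<and> (\<forall>v\<in>lattice_of a. (\<lambda>p. v + p) ` nodes G = nodes G
                         \<and> (\<lambda>s. (\<lambda>p. v + p) ` s) ` edges G = edges G)
     \<and> finite ((\<lambda>p. {v + p | v. v \<in> lattice_of a}) ` nodes G)
     \<and> finite ((\<lambda>s. {(\<lambda>p. v + p) ` s | v. v \<in> lattice_of a}) ` edges G)"

definition linear_3periodic_net :: "net \<Rightarrow> bool" where
  "linear_3periodic_net G \<longleftrightarrow>
     countable (edges G) \<and> (\<forall>s\<in>edges G. is_segment s)
     \<and> (\<forall>s\<in>edges G. \<forall>s'\<in>edges G. s \<noteq> s' \<longrightarrow> s \<inter> s' \<subseteq> endpoints s \<inter> endpoints s')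
     \<and> nodes G = \<Union>(endpoints ` edges G)
     \<and> (\<exists>a. periodicity_basis a G)"

definition translate :: "real^3 \<Rightarrow> net \<Rightarrow> net" where
  "translate v G = ((\<lambda>p. v + p) ` nodes G, (\<lambda>s. (\<lambda>p. v + p) ` s) ` edges G)"

definition integer_points :: "(real^3) set" where
  "integer_points = {v. \<forall>i. v $ i \<in> \<int>}"

definition pcu :: net where
  "pcu = (integer_points,
          {closed_segment v (v + axis i 1) | v i. v \<in> integer_points})"

text \<open>The connected components of a net are the subnets carried by the connected components of
  its body.\<close>

definition net_components :: "net \<Rightarrow> net set" where
  "net_components G = (\<lambda>C. (nodes G \<inter> C, {s \<in> edges G. s \<subseteq> C})) ` components (body G)"

definition n_grid :: "nat \<Rightarrow> net \<Rightarrow> bool" where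
  "n_grid n G \<longleftrightarrow> linear_3periodic_net G
     \<and> finite (net_components G) \<and> card (net_components G) = n
     \<and> (\<forall>H\<in>net_components G. \<exists>v. H = translate v pcu)"

definition periodically_isotopic :: "net \<Rightarrow> net \<Rightarrow> bool" where
  "periodically_isotopic G\<^sub>0 G\<^sub>1 \<longleftrightarrow>
     (\<exists>(G :: real \<Rightarrow> net) (a :: real \<Rightarrow> real^3^3) (f :: real \<Rightarrow> real^3 \<Rightarrow> real^3).
        G 0 = G\<^sub>0 \<and> G 1 = G\<^sub>1
        \<and> (\<forall>t\<in>{0..1}. linear_3periodic_net (G t))
        \<and> continuous_on {0..1} a
        \<and> (\<forall>t\<in>{0..1}. periodicity_basis (a t) (G t) \<and> right_handed (a t))
        \<and> (\<forall>t\<in>{0..1}. bij_betw (f t) (body G\<^sub>0) (body (G t))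
                        \<and> f t ` nodes G\<^sub>0 \<subseteq> nodes (G t))
        \<and> (\<forall>p\<in>body G\<^sub>0. f 0 p = p)
        \<and> (\<forall>p\<in>nodes G\<^sub>0. continuous_on {0..1} (\<lambda>t. f t p))
        \<and> (\<forall>t\<in>{0..1}. \<forall>p q. closed_segment p q \<in> edges G\<^sub>0 \<longrightarrow>
               closed_segment (f t p) (f t q) \<in> edges (G t)
               \<and> (\<forall>u\<in>{0..1}. f t ((1 - u) *\<^sub>R p + u *\<^sub>R q)
                                 = (1 - u) *\<^sub>R f t p + u *\<^sub>R f t q)))"


section \<open>Linear graph knots in the flat torus\<close>

text \<open>The points of the flat torus are the points of $[0,1)^3$; its topology is the quotient
  topology of the coordinatewise fractional part, not the subspace topology.\<close>

definition torus_proj :: "real^3 \<Rightarrow> real^3" where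
  "torus_proj p = (\<chi> i. frac (p $ i))"

definition flat_torus :: "(real^3) topology" where
  "flat_torus = topology (\<lambda>U. U \<subseteq> range torus_proj \<and> open (torus_proj -` U))"

lemma openin_flat_torus:
  "openin flat_torus U \<longleftrightarrow> U \<subseteq> range torus_proj \<and> open (torus_proj -` U)"
proof -
  have "istopology (\<lambda>U. U \<subseteq> range torus_proj \<and> open (torus_proj -` U))"
    by (auto simp: istopology_def vimage_Union)
  then show ?thesis
    by (simp add: flat_torus_def)
qed

lemma range_torus_proj: "range torus_proj = {p. \<forall>i. 0 \<le> p $ i \<and> p $ i < 1}"
proof -
  have "p \<in> range torus_proj" if "\<forall>i. 0 \<le> p $ i \<and> p $ i < 1" for p :: "real^3"
    using that by (intro range_eqI[of _ _ p]) (simp add: torus_proj_def vec_eq_iff frac_eq)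
  then show ?thesis
    by (auto simp: torus_proj_def frac_lt_1)
qed

lemma topspace_flat_torus: "topspace flat_torus = range torus_proj"
proof
  show "topspace flat_torus \<subseteq> range torus_proj"
    using openin_topspace openin_flat_torus by blast
  have "torus_proj -` range torus_proj = UNIV"
    by auto
  then have "openin flat_torus (range torus_proj)"
    by (simp add: openin_flat_torus)
  then show "range torus_proj \<subseteq> topspace flat_torus"
    by (rule openin_subset)
qed

lemma quotient_map_torus_proj: "quotient_map euclidean flat_torus torus_proj"
  by (auto simp: quotient_map_def topspace_flat_torus openin_flat_torus vimage_def)

text \<open>A graph knot also consists of nodes and edges, the edges being point sets in the torus. A
  closed segment whose two endpoints coincide in the torus is a circle, and as a point set it does
  not determine its endpoints; so the endpoints are supplied by the representing segments
  \<open>[a s, b s]\<close> in space.\<close>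

type_synonym graph_knot = "(real^3) set \<times> (real^3) set set"

definition linear_graph_knot :: "graph_knot \<Rightarrow> bool" where
  "linear_graph_knot K \<longleftrightarrow>
     finite (nodes K) \<and> nodes K \<subseteq> range torus_proj \<and> finite (edges K)
     \<and> (\<exists>a b :: (real^3) set \<Rightarrow> real^3.
          (\<forall>s\<in>edges K. a s \<noteq> b s \<and> s = torus_proj ` closed_segment (a s) (b s)
             \<and> torus_proj (a s) \<in> nodes K \<and> torus_proj (b s) \<in> nodes K
             \<and> (\<forall>x\<in>closed_segment (a s) (b s). \<forall>y\<in>closed_segment (a s) (b s).
                   x \<noteq> y \<and> torus_proj x = torus_proj y \<longrightarrow> {x, y} = {a s, b s}))
          \<and> (\<forall>s\<in>edges K. \<forall>s'\<in>edges K. s \<noteq> s' \<longrightarrow>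
               s \<inter> s' \<subseteq> {torus_proj (a s), torus_proj (b s)}
                         \<inter> {torus_proj (a s'), torus_proj (b s')}))"

definition standard_knot :: "net \<Rightarrow> graph_knot" where
  "standard_knot G = (torus_proj ` nodes G, (\<lambda>s. torus_proj ` s) ` edges G)"

definition grid_knots :: "nat \<Rightarrow> graph_knot set" where
  "grid_knots n = standard_knot ` {G. n_grid n G}"

definition linearly_isotopic :: "graph_knot \<Rightarrow> graph_knot \<Rightarrow> bool" where
  "linearly_isotopic K\<^sub>0 K\<^sub>1 \<longleftrightarrow>
     (\<exists>(K :: real \<Rightarrow> graph_knot) (f :: real \<Rightarrow> real^3 \<Rightarrow> real^3).
        K 0 = K\<^sub>0 \<and> K 1 = K\<^sub>1
        \<and> (\<forall>t\<in>{0..1}. linear_graph_knot (K t)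
              \<and> bij_betw (f t) (body K\<^sub>0) (body (K t))
              \<and> continuous_map (subtopology flat_torus (body K\<^sub>0))
                               (subtopology flat_torus (body (K t))) (f t)
              \<and> f t ` nodes K\<^sub>0 = nodes (K t)
              \<and> (\<lambda>s. f t ` s) ` edges K\<^sub>0 = edges (K t))
        \<and> (\<forall>p\<in>body K\<^sub>0. f 0 p = p)
        \<and> (\<forall>p\<in>body K\<^sub>0. continuous_map (top_of_set {0..1}) flat_torus (\<lambda>t. f t p)))"

definition GL3Z_plus :: "(real^3^3) set" where
  "GL3Z_plus = {X. (\<forall>i j. X $ i $ j \<in> \<int>) \<and> det X = 1}"

definition torus_map :: "real^3^3 \<Rightarrow> real^3 \<Rightarrow> real^3" where
  "torus_map X p = torus_proj (X *v p)"

definition rotationally_linearly_isotopic :: "graph_knot \<Rightarrow> graph_knot \<Rightarrow> bool" where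
  "rotationally_linearly_isotopic K\<^sub>0 K\<^sub>1 \<longleftrightarrow>
     (\<exists>X\<in>GL3Z_plus. rotation_matrix X \<and>
        linearly_isotopic K\<^sub>1
          (torus_map X ` nodes K\<^sub>0, (\<lambda>s. torus_map X ` s) ` edges K\<^sub>0))"


section \<open>Patterns\<close>

text \<open>The points of the discrete torus are vectors of reals with coordinates in
  $\{1,\dots,n\}$, so that rotation matrices act on them.\<close>

definition discrete_torus :: "nat \<Rightarrow> (real^3) set" where
  "discrete_torus n = {p. \<forall>i. p $ i \<in> real ` {1..n}}"

definition patterns :: "nat \<Rightarrow> (real^3) set set" where
  "patterns n = {P. P \<subseteq> discrete_torus n \<and> card P = n
                    \<and> (\<forall>p\<in>P. \<forall>q\<in>P. p \<noteq> q \<longrightarrow> (\<forall>i. (p - q) $ i \<noteq> 0))}"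

definition cyclic_succ :: "nat \<Rightarrow> real \<Rightarrow> real" where
  "cyclic_succ n x = (if x = real n then 1 else x + 1)"

definition cyclic_shifts :: "nat \<Rightarrow> (real^3 \<Rightarrow> real^3) set" where
  "cyclic_shifts n =
     range (\<lambda>k :: 3 \<Rightarrow> nat. restrict (\<lambda>p. \<chi> i. (cyclic_succ n ^^ k i) (p $ i)) (discrete_torus n))"

definition rotate_about :: "real^3 \<Rightarrow> real^3^3 \<Rightarrow> real^3 \<Rightarrow> real^3" where
  "rotate_about c X p = c + X *v (p - c)"

definition cube_rotations :: "(real^3^3) set" where
  "cube_rotations = {X. rotation_matrix X
                        \<and> rotate_about (\<chi> i. 1/2) X ` cbox 0 (\<chi> i. 1) = cbox 0 (\<chi> i. 1)}"

definition array_rotations :: "nat \<Rightarrow> (real^3 \<Rightarrow> real^3) set" where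
  "array_rotations n =
     (\<lambda>X. restrict (rotate_about (\<chi> i. (real n + 1) / 2) X) (discrete_torus n)) ` cube_rotations"

definition num_pattern_orbits :: "nat \<Rightarrow> (real^3 \<Rightarrow> real^3) set \<Rightarrow> nat" where
  "num_pattern_orbits n H =
     card (orbits ((BijGroup (discrete_torus n))\<lparr>carrier := H\<rparr>) (patterns n) (\<lambda>g P. g ` P))"

definition alpha :: "nat \<Rightarrow> nat" where
  "alpha n = num_pattern_orbits n (cyclic_shifts n)"

definition beta :: "nat \<Rightarrow> nat" where
  "beta n = num_pattern_orbits n
     (generate (BijGroup (discrete_torus n)) (cyclic_shifts n \<union> array_rotations n))"

end

theory Submission
  imports Defs
begin

text \<open>
  An \<open>n\<close>-grid is \<open>grid P\<close> for a set \<open>P\<close> of \<open>n\<close> points of space, one node for each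
  component. Two components \<open>p\<close> and \<open>q\<close> are disjoint exactly when no coordinate of \<open>p - q\<close> is an
  integer, so a grid is a configuration of \<open>n\<close> points of the torus whose first, second and third
  coordinates are separately distinct on the circle (\<open>n_grid_iff\<close>). As long as the coordinates stay
  distinct, the points of a coordinate circle keep their cyclic order. With lifts of the points to
  space the three cyclic orders are recorded by the integers \<open>\<lfloor>(p - q) $ i\<rfloor>\<close>, and \<open>order_equiv\<close> is
  the resulting combinatorial relation. The theorem says that isotopy is \<open>order_equiv\<close>, or its
  version \<open>rot_equiv\<close> up to a rotation of the cubic lattice, and that patterns are representatives
  of configurations: a pattern \<open>T\<close> stands for \<open>T\<close> scaled by \<open>1/n\<close>, every configuration is equivalent
  to one obtained by ranking its coordinates, and two patterns with the same cyclic orders differ by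
  cyclic shifts, because \<open>n\<close> increasing integers in a window of length \<open>n\<close> are consecutive.

  Equivalent configurations are joined by a straight line motion of their points, which preserves all
  the floors, hence is an isotopy; for a rotation, the motion is combined with a path of matrices of
  positive determinant. The converse directions need invariants.

  For linear isotopies the danger is that an edge circle changes its direction. At each time its
  image is a closed geodesic with an integer direction. The integer characters that vanish on a fixed
  direction are continuous along the isotopy, so the times at which the direction has a given value
  form a closed set; there are countably many directions, and by Sierpinski's theorem the unit
  interval is not a countable disjoint union of more than one nonempty closed set
  (\<open>geodesic_direction_constant\<close>). So the knot consists of axis-parallel circles at all times, the
  coordinates of its nodes remain distinct, and their lifts keep all floors
  (\<open>order_equiv_if_linearly_isotopic\<close>).

  In a periodic isotopy the intermediate nets may be arbitrarily bent. Sierpinski's theorem shows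
  again that the node maps are equivariant for the moving periodicity lattice (\<open>equivariant\<close>). At the
  end the isotopy is an isomorphism between cubic lattice graphs, hence affine on each component
  (\<open>phi_affine\<close>), and by equivariance all components have the same linear part, a rotation. Finally
  a line of one component that passes over a transverse line of another one cannot get under it: the
  difference of the two moving polygonal lines, in coordinates adapted to the moving lattice, is a
  bounded perturbation of a linear map of the plane to space that omits the origin, and a change of
  sides would contradict Brouwer's fixed point theorem (\<open>linking_sign_invariant\<close>). Applied to all
  translates of the lines, this says that the floors are preserved (\<open>preserves_order_end\<close>).
\<close>

section \<open>The flat torus\<close>

lemma frac_eq_iff_diff_Ints: "frac (x::real) = frac y \<longleftrightarrow> x - y \<in> \<int>"
proof
  assume "frac x = frac y"
  then have "x - y = of_int (\<lfloor>x\<rfloor> - \<lfloor>y\<rfloor>)" by (simp add: frac_def)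
  then show "x - y \<in> \<int>" by (metis Ints_of_int)
next
  assume "x - y \<in> \<int>"
  then obtain k where "x - y = of_int k" by (auto elim: Ints_cases)
  then have "x = y + of_int k" by simp
  then show "frac x = frac y" by (simp add: frac_def)
qed

lemma torus_proj_eq_iff: "torus_proj x = torus_proj y \<longleftrightarrow> (\<forall>i. (x - y) $ i \<in> \<int>)"
  by (simp add: torus_proj_def vec_eq_iff frac_eq_iff_diff_Ints)

lemma torus_proj_eq_iff_integer: "torus_proj x = torus_proj y \<longleftrightarrow> x - y \<in> integer_points"
  by (simp add: torus_proj_eq_iff integer_points_def)

lemma torus_proj_component: "(torus_proj x - x) $ i \<in> \<int>"
  by (simp add: torus_proj_def frac_def)

lemma torus_proj_range_id: "x \<in> range torus_proj \<Longrightarrow> torus_proj x = x"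
  by (auto simp: torus_proj_def vec_eq_iff)

lemma torus_proj_idem [simp]: "torus_proj (torus_proj x) = torus_proj x"
  by (rule torus_proj_range_id) simp

lemma integer_points_add [intro]: "v \<in> integer_points \<Longrightarrow> w \<in> integer_points \<Longrightarrow> v + w \<in> integer_points"
  and integer_points_minus [intro]: "v \<in> integer_points \<Longrightarrow> - v \<in> integer_points"
  and integer_points_diff [intro]: "v \<in> integer_points \<Longrightarrow> w \<in> integer_points \<Longrightarrow> v - w \<in> integer_points"
  and integer_points_0 [simp, intro]: "0 \<in> integer_points"
  and integer_points_axis [simp, intro]: "axis i 1 \<in> integer_points"
  by (auto simp: integer_points_def axis_def)

lemma torus_proj_add_integer [simp]: "v \<in> integer_points \<Longrightarrow> torus_proj (x + v) = torus_proj x"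
  by (simp add: torus_proj_eq_iff_integer)

lemma torus_proj_diff_integer: "torus_proj x - x \<in> integer_points"
  using torus_proj_component by (auto simp: integer_points_def)

lemma torus_proj_add_proj: "torus_proj (torus_proj x + y) = torus_proj (x + y)"
  using torus_proj_diff_integer[of x] by (simp add: torus_proj_eq_iff_integer)

lemma other_two_indices:
  obtains j k :: 3 where "j \<noteq> i" "k \<noteq> i" "j \<noteq> k" "UNIV = {i, j, k}"
proof -
  have "card (UNIV - {i}) = 2" by (simp add: card_Diff_singleton)
  then obtain j k where jk: "UNIV - {i} = {j, k}" "j \<noteq> k" by (meson card_2_iff)
  show thesis by (rule that[of j k]) (use jk in auto)
qed

lemma index_cases:
  assumes "j \<noteq> (i::3)" "k \<noteq> i" "j \<noteq> k"
  shows "l = i \<or> l = j \<or> l = k"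
proof -
  have "card {i,j,k} = card (UNIV :: 3 set)" using assms by simp
  then have "UNIV = {i,j,k}" by (metis card_subset_eq finite_class.finite_UNIV subset_UNIV)
  then show ?thesis by blast
qed

text \<open>The characters of the torus with integral \<open>m\<close> turn questions about paths in the torus
  into questions about continuous functions to the circle.\<close>

definition character :: "real^3 \<Rightarrow> real^3 \<Rightarrow> complex" where
  "character m z = cis (2 * pi * (m \<bullet> z))"

lemma character_add: "character m (x + y) = character m x * character m y"
  by (simp add: character_def inner_add_right distrib_left cis_mult)

lemma character_diff: "character m (x - y) = character m x / character m y"
  by (simp add: character_def inner_diff_right right_diff_distrib cis_divide)

lemma cis_eq_1_iff: "cis (2 * pi * x) = 1 \<longleftrightarrow> x \<in> \<int>"
proof -
  have "cis (2 * pi * x) = 1 \<longleftrightarrow> cos (2 * pi * x) = 1"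
    by (auto simp: complex_eq_iff cos_one_sin_zero)
  also have "\<dots> \<longleftrightarrow> (\<exists>n::int. 2 * pi * x = of_int n * 2 * pi)"
    by (rule cos_one_2pi_int)
  also have "\<dots> \<longleftrightarrow> x \<in> \<int>" by (auto simp: Ints_def)
  finally show ?thesis .
qed

lemma character_eq_1_iff: "character m z = 1 \<longleftrightarrow> m \<bullet> z \<in> \<int>"
  by (simp add: character_def cis_eq_1_iff)

lemma inner_integer_points:
  "m \<in> integer_points \<Longrightarrow> v \<in> integer_points \<Longrightarrow> m \<bullet> v \<in> \<int>"
  by (auto simp: inner_vec_def integer_points_def intro!: Ints_sum Ints_mult)

lemma character_torus_proj:
  assumes "m \<in> integer_points" shows "character m (torus_proj z) = character m z"
proof -
  have "character m (torus_proj z - z) = 1"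
    using assms by (simp add: character_eq_1_iff inner_integer_points torus_proj_diff_integer)
  moreover have "character m z \<noteq> 0" by (simp add: character_def)
  ultimately show ?thesis by (simp add: character_diff)
qed

lemma continuous_map_character:
  assumes "m \<in> integer_points" shows "continuous_map flat_torus euclidean (character m)"
proof (rule continuous_compose_quotient_map[OF quotient_map_torus_proj])
  have "continuous_map euclidean euclidean (character m)"
    unfolding continuous_map_iff_continuous2 character_def by (intro continuous_intros)
  moreover have "character m \<circ> torus_proj = character m"
    using character_torus_proj[OF assms] by (simp add: fun_eq_iff)
  ultimately show "continuous_map euclidean euclidean (character m \<circ> torus_proj)" by simp
qed

lemma continuous_map_torus_proj: "continuous_map euclidean flat_torus torus_proj"
  by (rule quotient_imp_continuous_map[OF quotient_map_torus_proj])

text \<open>The three coordinate characters separate points.\<close>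

lemma Hausdorff_flat_torus: "Hausdorff_space flat_torus"
proof -
  let ?F = "\<lambda>z. \<chi> i. character (axis i 1) z"
  have "continuous_map flat_torus euclidean ?F"
  proof (rule continuous_compose_quotient_map[OF quotient_map_torus_proj])
    have "continuous_map euclidean euclidean ?F"
      unfolding continuous_map_iff_continuous2 character_def by (intro continuous_intros)
    moreover have "?F \<circ> torus_proj = ?F"
      by (simp add: fun_eq_iff character_torus_proj)
    ultimately show "continuous_map euclidean euclidean (?F \<circ> torus_proj)" by simp
  qed
  moreover have "inj_on ?F (topspace flat_torus)"
  proof (rule inj_onI)
    fix x y assume x: "x \<in> topspace flat_torus" and y: "y \<in> topspace flat_torus" and e: "?F x = ?F y"
    have "character (axis i 1) (x - y) = 1" for i
      using e by (simp add: vec_eq_iff character_diff) (simp add: character_def)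
    then have "axis i 1 \<bullet> (x - y) \<in> \<int>" for i
      unfolding character_eq_1_iff .
    then have "torus_proj x = torus_proj y"
      unfolding torus_proj_eq_iff by (intro allI) (simp only: inner_axis' inner_real_def mult_1)
    then show "x = y" using x y by (metis topspace_flat_torus torus_proj_range_id)
  qed
  ultimately show ?thesis
    using Hausdorff_space_injective_preimage Hausdorff_space_euclidean by blast
qed

lemma continuous_on_character_path:
  assumes "continuous_map (top_of_set S) flat_torus \<gamma>" "m \<in> integer_points"
  shows "continuous_on S (\<lambda>t. character m (\<gamma> t))"
  using continuous_map_compose[OF assms(1) continuous_map_character[OF assms(2)]]
  by (simp add: o_def)

lemma continuous_map_torus_translation:
  "continuous_map flat_torus flat_torus (\<lambda>x. torus_proj (x + \<delta>))"
proof (rule continuous_compose_quotient_map[OF quotient_map_torus_proj])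
  have "continuous_map euclidean flat_torus (torus_proj \<circ> (\<lambda>x. x + \<delta>))"
    by (rule continuous_map_compose[OF _ continuous_map_torus_proj])
       (auto intro!: continuous_intros)
  then show "continuous_map euclidean flat_torus ((\<lambda>x. torus_proj (x + \<delta>)) \<circ> torus_proj)"
    by (simp add: o_def torus_proj_add_proj)
qed

text \<open>A continuous function that changes its floor passes through an integer. This is what makes the
  cyclic order of moving points an invariant.\<close>

lemma floor_diff_constant:
  fixes h :: "real \<Rightarrow> real"
  assumes "continuous_on {0..1} h" "\<And>t. t \<in> {0..1} \<Longrightarrow> h t \<notin> \<int>"
  shows "\<lfloor>h 0\<rfloor> = \<lfloor>h 1\<rfloor>"
proof (rule ccontr)
  assume ne: "\<lfloor>h 0\<rfloor> \<noteq> \<lfloor>h 1\<rfloor>"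
  have "\<exists>t\<in>{0..1}. h t \<in> \<int>"
  proof (cases "\<lfloor>h 0\<rfloor> < \<lfloor>h 1\<rfloor>")
    case True
    then have "h 0 \<le> of_int \<lfloor>h 1\<rfloor>" "of_int \<lfloor>h 1\<rfloor> \<le> h 1" by linarith+
    then have "\<exists>t. 0 \<le> t \<and> t \<le> 1 \<and> h t = of_int \<lfloor>h 1\<rfloor>"
      by (intro IVT') (use assms(1) in auto)
    then show ?thesis by (metis Ints_of_int atLeastAtMost_iff)
  next
    case False
    then have "h 1 \<le> of_int \<lfloor>h 0\<rfloor>" "of_int \<lfloor>h 0\<rfloor> \<le> h 0" using ne by linarith+
    then have "\<exists>t. 0 \<le> t \<and> t \<le> 1 \<and> h t = of_int \<lfloor>h 0\<rfloor>"
      by (intro IVT2') (use assms(1) in auto)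
    then show ?thesis by (metis Ints_of_int atLeastAtMost_iff)
  qed
  then show False using assms(2) by blast
qed

text \<open>Each coordinate is lifted separately, as a continuous logarithm of its character; the lift is then
  corrected by an integer constant so that it starts at \<open>p\<close>.\<close>

lemma lift_torus_path:
  fixes \<gamma> :: "real \<Rightarrow> real^3"
  assumes "continuous_map (top_of_set {0..1}) flat_torus \<gamma>" and "torus_proj p = \<gamma> 0"
  obtains \<xi> where "\<xi> 0 = p" "\<And>t. t \<in> {0..1} \<Longrightarrow> torus_proj (\<xi> t) = \<gamma> t"
    "\<And>i. continuous_on {0..1} (\<lambda>t. \<xi> t $ i)"
proof -
  have "\<exists>h. continuous_on {0..1} h \<and> h 0 = p $ i \<and> (\<forall>t\<in>{0..1}. h t - \<gamma> t $ i \<in> \<int>)" for i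
  proof -
    have cont: "continuous_on {0..1} (\<lambda>t. character (axis i 1) (\<gamma> t))"
      by (rule continuous_on_character_path[OF assms(1)]) simp
    obtain g where g: "continuous_on {0..1} g" "\<And>t. t \<in> {0..1} \<Longrightarrow> character (axis i 1) (\<gamma> t) = exp (g t)"
    proof (rule continuous_logarithm_on_contractible[OF cont])
      show "contractible {0..1::real}" by (simp add: convex_imp_contractible)
    qed (auto simp: character_def)
    have eq: "Im (g t) / (2 * pi) - \<gamma> t $ i \<in> \<int>" if "t \<in> {0..1}" for t
    proof -
      have 1: "cis (2 * pi * \<gamma> t $ i) = exp (g t)"
        using g(2)[OF that] by (simp add: character_def inner_axis')
      then have "norm (exp (g t)) = 1" by (metis norm_cis)
      then have "Re (g t) = 0" by (simp add: norm_exp_eq_Re)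
      then have "exp (g t) = cis (Im (g t))" by (simp add: exp_eq_polar)
      then have "cis (Im (g t) - 2 * pi * \<gamma> t $ i) = 1"
        using 1 cis_divide[of "Im (g t)" "2 * pi * \<gamma> t $ i"] by (metis cis_neq_zero divide_self)
      moreover have "Im (g t) - 2 * pi * \<gamma> t $ i = 2 * pi * (Im (g t) / (2 * pi) - \<gamma> t $ i)"
        by (simp add: field_simps)
      ultimately show ?thesis using cis_eq_1_iff by metis
    qed
    let ?h = "\<lambda>t. Im (g t) / (2 * pi) + (p $ i - Im (g 0) / (2 * pi))"
    have "\<gamma> 0 $ i - p $ i \<in> \<int>" using torus_proj_component[of p i] assms(2) by simp
    from Ints_add[OF this eq[of 0]] have 0: "Im (g 0) / (2 * pi) - p $ i \<in> \<int>" by simp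
    have "?h t - \<gamma> t $ i \<in> \<int>" if "t \<in> {0..1}" for t
      using Ints_diff[OF eq[OF that] 0] by (simp add: algebra_simps)
    moreover have "continuous_on {0..1} ?h" by (auto intro!: continuous_intros g(1))
    moreover have "?h 0 = p $ i" by simp
    ultimately show ?thesis by blast
  qed
  then obtain h where h: "\<And>i. continuous_on {0..1} (h i)" "\<And>i. h i 0 = p $ i"
    "\<And>i t. t \<in> {0..1} \<Longrightarrow> h i t - \<gamma> t $ i \<in> \<int>" by metis
  have r: "\<gamma> t \<in> range torus_proj" if "t \<in> {0..1}" for t
    using continuous_map_image_subset_topspace[OF assms(1)] that by (auto simp: topspace_flat_torus)
  then have "torus_proj (\<chi> i. h i t) = \<gamma> t" if "t \<in> {0..1}" for t
  proof -
    have "torus_proj (\<chi> i. h i t) = torus_proj (\<gamma> t)"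
      using h(3)[OF that] by (simp add: torus_proj_eq_iff)
    then show ?thesis by (simp only: torus_proj_range_id[OF r[OF that]])
  qed
  then show thesis by (intro that[of "\<lambda>t. \<chi> i. h i t"]) (auto simp: h vec_eq_iff)
qed

section \<open>Grids as configurations of points\<close>

definition unit_edge :: "real^3 \<Rightarrow> 3 \<Rightarrow> (real^3) set" where
  "unit_edge v i = closed_segment v (v + axis i 1)"

text \<open>The lattice translates of the points of \<open>P\<close>, in a form that depends only on the image
  of \<open>P\<close> in the torus.\<close>

definition grid_nodes :: "(real^3) set \<Rightarrow> (real^3) set" where
  "grid_nodes P = {x. torus_proj x \<in> torus_proj ` P}"

definition grid :: "(real^3) set \<Rightarrow> net" where
  "grid P = (grid_nodes P, {unit_edge v i | v i. v \<in> grid_nodes P})"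

text \<open>The body of the cubic net translated by \<open>p\<close>: at least two coordinates agree with
  those of \<open>p\<close> modulo 1.\<close>

definition frame :: "real^3 \<Rightarrow> (real^3) set" where
  "frame p = {x. \<exists>i. \<forall>j. j \<noteq> i \<longrightarrow> (x - p) $ j \<in> \<int>}"

definition generic :: "(real^3) set \<Rightarrow> bool" where
  "generic P \<longleftrightarrow> (\<forall>p\<in>P. \<forall>q\<in>P. p \<noteq> q \<longrightarrow> (\<forall>i. (p - q) $ i \<notin> \<int>))"

definition configs :: "nat \<Rightarrow> (real^3) set set" where
  "configs n = {P. finite P \<and> card P = n \<and> generic P}"

lemma nodes_grid [simp]: "nodes (grid P) = grid_nodes P"
  and edges_grid: "edges (grid P) = {unit_edge v i | v i. v \<in> grid_nodes P}"
  by (simp_all add: grid_def nodes_def edges_def)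

lemma grid_cong: "torus_proj ` P = torus_proj ` Q \<Longrightarrow> grid P = grid Q"
  by (simp add: grid_def grid_nodes_def)

lemma grid_nodes_iff: "x \<in> grid_nodes P \<longleftrightarrow> (\<exists>p\<in>P. x - p \<in> integer_points)"
  by (auto simp: grid_nodes_def image_iff torus_proj_eq_iff_integer)

lemma self_in_grid_nodes: "p \<in> P \<Longrightarrow> p \<in> grid_nodes P"
  by (auto simp: grid_nodes_def)

lemma grid_nodes_add: "v \<in> integer_points \<Longrightarrow> x + v \<in> grid_nodes P \<longleftrightarrow> x \<in> grid_nodes P"
  by (simp add: grid_nodes_def)

lemma mem_unit_edge:
  "x \<in> unit_edge v i \<longleftrightarrow> (\<forall>j. j \<noteq> i \<longrightarrow> x $ j = v $ j) \<and> v $ i \<le> x $ i \<and> x $ i \<le> v $ i + 1"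
proof
  assume "x \<in> unit_edge v i"
  then obtain u where "0 \<le> u" "u \<le> 1" "x = v + u *\<^sub>R axis i 1"
    by (auto simp: unit_edge_def in_segment algebra_simps)
  then show "(\<forall>j. j \<noteq> i \<longrightarrow> x $ j = v $ j) \<and> v $ i \<le> x $ i \<and> x $ i \<le> v $ i + 1"
    by (simp add: axis_def)
next
  assume *: "(\<forall>j. j \<noteq> i \<longrightarrow> x $ j = v $ j) \<and> v $ i \<le> x $ i \<and> x $ i \<le> v $ i + 1"
  then have "x = (1 - (x $ i - v $ i)) *\<^sub>R v + (x $ i - v $ i) *\<^sub>R (v + axis i 1)"
    by (auto simp: vec_eq_iff axis_def algebra_simps)
  then show "x \<in> unit_edge v i"
    unfolding unit_edge_def in_segment using *
    by (intro exI[of _ "x $ i - v $ i"]) auto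
qed

lemma endpoints_closed_segment: "endpoints (closed_segment p q) = {p, q}"
  by (auto simp: endpoints_def closed_segment_eq doubleton_eq_iff)

lemma endpoints_unit_edge: "endpoints (unit_edge v i) = {v, v + axis i 1}"
  by (simp add: unit_edge_def endpoints_closed_segment)

lemma unit_edge_endpointI:
  assumes "x \<in> unit_edge v i" "x $ i - v $ i \<in> \<int>"
  shows "x \<in> endpoints (unit_edge v i)"
proof -
  have *: "\<forall>j. j \<noteq> i \<longrightarrow> x $ j = v $ j" "v $ i \<le> x $ i" "x $ i \<le> v $ i + 1"
    using assms(1) by (auto simp: mem_unit_edge)
  obtain k where k: "x $ i - v $ i = of_int k" using assms(2) by (auto elim: Ints_cases)
  with * have "0 \<le> k" "k \<le> 1" by linarith+
  then have "k = 0 \<or> k = 1" by linarith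
  then show ?thesis
  proof
    assume "k = 0"
    then have "x = v" using * k by (metis eq_iff_diff_eq_0 of_int_0 vec_eq_iff)
    then show ?thesis by (simp add: endpoints_unit_edge)
  next
    assume "k = 1"
    then have "x = v + axis i 1" using * k by (auto simp: vec_eq_iff axis_def)
    then show ?thesis by (simp add: endpoints_unit_edge)
  qed
qed

lemma frame_cong: assumes "torus_proj p = torus_proj q" shows "frame p = frame q"
proof -
  have "(x - p) $ j \<in> \<int> \<longleftrightarrow> (x - q) $ j \<in> \<int>" for x j
  proof -
    have "(p - q) $ j \<in> \<int>" using assms by (simp add: torus_proj_eq_iff)
    then show ?thesis using Ints_add[of "(x - p) $ j" "(p - q) $ j"] Ints_diff[of "(x - q) $ j" "(p - q) $ j"]
      by auto
  qed
  then show ?thesis by (simp add: frame_def)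
qed

lemma mem_frame_proj: "torus_proj x \<in> frame p \<longleftrightarrow> x \<in> frame p"
proof -
  have "(torus_proj x - p) $ j \<in> \<int> \<longleftrightarrow> (x - p) $ j \<in> \<int>" for j
    using torus_proj_component[of x j] Ints_add[of "(torus_proj x - x) $ j" "(x - p) $ j"]
      Ints_diff[of "(torus_proj x - p) $ j" "(torus_proj x - x) $ j"] by auto
  then show ?thesis by (simp add: frame_def)
qed

lemma self_in_frame: "p \<in> frame p" by (simp add: frame_def)

lemma unit_edge_subset_frame: assumes "torus_proj v = torus_proj p" shows "unit_edge v i \<subseteq> frame p"
proof -
  have "unit_edge v i \<subseteq> frame v"
    by (auto simp: frame_def mem_unit_edge intro!: exI[of _ i])
  then show ?thesis using frame_cong[OF assms] by simp
qed

lemma in_frame_imp_unit_edge: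
  assumes "x \<in> frame p"
  obtains v i where "torus_proj v = torus_proj p" "x \<in> unit_edge v i"
proof -
  obtain i where i: "\<And>j. j \<noteq> i \<Longrightarrow> (x - p) $ j \<in> \<int>" using assms by (auto simp: frame_def)
  (* The base point of the edge through x: the last lattice point below x in direction i. *)
  define v :: "real^3" where "v = (\<chi> j. if j = i then p $ i + of_int \<lfloor>x $ i - p $ i\<rfloor> else x $ j)"
  have "torus_proj v = torus_proj p" using i by (auto simp: torus_proj_eq_iff v_def)
  moreover have "x \<in> unit_edge v i" unfolding mem_unit_edge v_def by simp linarith
  ultimately show thesis by (rule that)
qed

lemma frame_eq_Union: "frame p = \<Union>{unit_edge v i | v i. torus_proj v = torus_proj p}"
proof (intro equalityI subsetI)
  fix x assume "x \<in> frame p"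
  then obtain v i where "torus_proj v = torus_proj p" "x \<in> unit_edge v i" by (rule in_frame_imp_unit_edge)
  then show "x \<in> \<Union>{unit_edge v i | v i. torus_proj v = torus_proj p}" by blast
next
  fix x assume "x \<in> \<Union>{unit_edge v i | v i. torus_proj v = torus_proj p}"
  then obtain v i where "torus_proj v = torus_proj p" "x \<in> unit_edge v i" by blast
  then show "x \<in> frame p" using unit_edge_subset_frame by blast
qed

lemma body_grid: "body (grid P) = \<Union>(frame ` P)"
proof -
  have "body (grid P) = (\<Union>p\<in>P. \<Union>{unit_edge v i | v i. torus_proj v = torus_proj p})"
    unfolding body_def edges_grid grid_nodes_def by blast
  then show ?thesis by (simp add: frame_eq_Union)
qed

text \<open>If one coordinate agrees modulo 1, lines of the two frames in the other two directions lie in a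
  common plane and meet. Conversely a common point excludes one coordinate for each frame, and the
  remaining coordinate agrees.\<close>

lemma frame_disjoint_iff: "frame p \<inter> frame q = {} \<longleftrightarrow> (\<forall>i. (p - q) $ i \<notin> \<int>)"
proof
  assume *: "frame p \<inter> frame q = {}"
  show "\<forall>i. (p - q) $ i \<notin> \<int>"
  proof (intro allI notI)
    fix i assume i: "(p - q) $ i \<in> \<int>"
    obtain j k :: 3 where jk: "j \<noteq> i" "k \<noteq> i" "j \<noteq> k" "UNIV = {i, j, k}" by (rule other_two_indices)
    (* The intersection of the line through p in direction j with the line through q in direction k. *)
    define x :: "real^3" where "x = (\<chi> l. if l = j then q $ j else p $ l)"
    have "x \<in> frame p" unfolding frame_def x_def by (auto intro!: exI[of _ j])
    moreover have "x \<in> frame q" unfolding frame_def x_def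
      using i index_cases[OF jk(1-3)] by (auto intro!: exI[of _ k]) metis
    ultimately show False using * by blast
  qed
next
  assume *: "\<forall>i. (p - q) $ i \<notin> \<int>"
  show "frame p \<inter> frame q = {}"
  proof (rule ccontr)
    assume "frame p \<inter> frame q \<noteq> {}"
    then obtain x i i' where i: "\<And>j. j \<noteq> i \<Longrightarrow> (x - p) $ j \<in> \<int>" "\<And>j. j \<noteq> i' \<Longrightarrow> (x - q) $ j \<in> \<int>"
      by (auto simp: frame_def)
    obtain j k :: 3 where jk: "j \<noteq> i" "k \<noteq> i" "j \<noteq> k" by (rule other_two_indices[of i]) auto
    then obtain l where "l \<noteq> i" "l \<noteq> i'" by metis
    then have "(x - q) $ l - (x - p) $ l \<in> \<int>" using i Ints_diff by blast
    then show False using * by simp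
  qed
qed

lemma frame_disjoint: "generic P \<Longrightarrow> p \<in> P \<Longrightarrow> q \<in> P \<Longrightarrow> p \<noteq> q \<Longrightarrow> frame p \<inter> frame q = {}"
  by (simp add: generic_def frame_disjoint_iff)

lemma generic_proj_inj: assumes "generic P" shows "inj_on torus_proj P"
  using assms by (auto simp: inj_on_def generic_def torus_proj_eq_iff)

lemma closed_Ints_component: "closed {x :: real^3. (x - p) $ j \<in> \<int>}"
proof -
  have "closed ((\<lambda>x :: real^3. (x - p) $ j) -` \<int>)"
    by (rule closed_vimage[OF closed_Ints]) (intro continuous_intros)
  then show ?thesis by (simp add: vimage_def)
qed

lemma closed_frame: "closed (frame p)"
proof -
  have "frame p = (\<Union>i\<in>UNIV. \<Inter>j\<in>-{i}. {x. (x - p) $ j \<in> \<int>})"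
    by (auto simp: frame_def)
  then show ?thesis using closed_Ints_component by (auto intro!: closed_UN)
qed

text \<open>Every point is reached from \<open>p\<close> along three axis-parallel segments, the last of which
  is the only one whose length need not be an integer.\<close>

lemma connected_frame: "connected (frame p)"
proof -
  have seg: "connected_component (frame p) x (x + s *\<^sub>R axis i 1)"
    if "\<And>j. j \<noteq> i \<Longrightarrow> (x - p) $ j \<in> \<int>" for x s i
  proof -
    have "closed_segment x (x + s *\<^sub>R axis i 1) \<subseteq> frame p"
    proof
      fix y assume "y \<in> closed_segment x (x + s *\<^sub>R axis i 1)"
      then obtain u where "y = x + (u * s) *\<^sub>R axis i 1"
        by (auto simp: in_segment algebra_simps)
      then show "y \<in> frame p" using that by (auto simp: frame_def axis_def intro!: exI[of _ i])
    qed
    then show ?thesis unfolding connected_component_def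
      by (intro exI[of _ "closed_segment x (x + s *\<^sub>R axis i 1)"]) auto
  qed
  have "connected_component (frame p) p x" if x: "x \<in> frame p" for x
  proof -
    obtain i where i: "\<And>j. j \<noteq> i \<Longrightarrow> (x - p) $ j \<in> \<int>" using x by (auto simp: frame_def)
    obtain j k :: 3 where jk: "j \<noteq> i" "k \<noteq> i" "j \<noteq> k" "UNIV = {i, j, k}" by (rule other_two_indices)
    define y where "y = p + ((x - p) $ j) *\<^sub>R axis j 1"
    define z where "z = y + ((x - p) $ k) *\<^sub>R axis k 1"
    have "connected_component (frame p) p y" unfolding y_def by (rule seg) simp
    moreover have "connected_component (frame p) y z" unfolding z_def
      by (rule seg) (use i jk in \<open>auto simp: y_def axis_def\<close>)
    moreover have "connected_component (frame p) z (z + ((x - p) $ i) *\<^sub>R axis i 1)"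
      by (rule seg) (use i jk in \<open>auto simp: y_def z_def axis_def\<close>)
    moreover have "z + ((x - p) $ i) *\<^sub>R axis i 1 = x"
    proof (rule vec_eq_iff[THEN iffD2], rule allI)
      fix l show "(z + ((x - p) $ i) *\<^sub>R axis i 1) $ l = x $ l"
        using index_cases[OF jk(1-3), of l] jk by (auto simp: y_def z_def axis_def)
    qed
    ultimately show ?thesis by (metis connected_component_trans)
  qed
  then have "\<forall>x\<in>frame p. \<forall>y\<in>frame p. connected_component (frame p) x y"
    by (blast intro: connected_component_trans connected_component_sym)
  then show ?thesis by (simp add: connected_iff_connected_component)
qed

text \<open>Each member is closed, and so is the union of the others, so a connected set meets only one
  member.\<close>

lemma components_finite_disjoint_closed:
  fixes \<F> :: "'a::topological_space set set"
  assumes "finite \<F>" "\<And>A. A \<in> \<F> \<Longrightarrow> closed A \<and> connected A \<and> A \<noteq> {}"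
    and disj: "\<And>A B. A \<in> \<F> \<Longrightarrow> B \<in> \<F> \<Longrightarrow> A \<noteq> B \<Longrightarrow> A \<inter> B = {}"
  shows "components (\<Union>\<F>) = \<F>"
proof -
  have eq: "connected_component_set (\<Union>\<F>) x = A" if A: "A \<in> \<F>" "x \<in> A" for A x
  proof
    show "A \<subseteq> connected_component_set (\<Union>\<F>) x"
      using A assms(2) by (intro connected_component_maximal) auto
    let ?C = "connected_component_set (\<Union>\<F>) x"
    have sub: "?C \<subseteq> \<Union>\<F>" by (rule connected_component_subset)
    have "closed A" "closed (\<Union>(\<F> - {A}))" using assms A by (auto intro!: closed_Union)
    moreover have "?C \<subseteq> A \<union> \<Union>(\<F> - {A})" using sub by auto
    moreover have "A \<inter> \<Union>(\<F> - {A}) \<inter> ?C = {}" using disj A by blast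
    moreover have "connected ?C" by simp
    ultimately have "A \<inter> ?C = {} \<or> \<Union>(\<F> - {A}) \<inter> ?C = {}"
      unfolding connected_closed by meson
    moreover have "x \<in> A \<inter> ?C" using A by (auto simp: connected_component_refl)
    ultimately show "?C \<subseteq> A" using sub by blast
  qed
  show ?thesis
  proof (intro equalityI subsetI)
    fix C assume "C \<in> components (\<Union>\<F>)"
    then obtain x where "x \<in> \<Union>\<F>" "C = connected_component_set (\<Union>\<F>) x" by (auto simp: components_def)
    then show "C \<in> \<F>" using eq by auto
  next
    fix A assume A: "A \<in> \<F>"
    then obtain x where "x \<in> A" using assms(2) by blast
    with A eq show "A \<in> components (\<Union>\<F>)" by (auto simp: components_def)
  qed
qed

lemma components_body_grid:
  assumes "finite P" "generic P" shows "components (body (grid P)) = frame ` P"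
  unfolding body_grid
  by (rule components_finite_disjoint_closed)
     (use assms frame_disjoint closed_frame connected_frame self_in_frame in \<open>fastforce+\<close>)

lemma grid_nodes_Int_frame:
  assumes "generic P" "p \<in> P" shows "grid_nodes P \<inter> frame p = grid_nodes {p}"
proof
  show "grid_nodes {p} \<subseteq> grid_nodes P \<inter> frame p"
    using assms self_in_frame[of p] by (auto simp: grid_nodes_def) (metis mem_frame_proj)
  show "grid_nodes P \<inter> frame p \<subseteq> grid_nodes {p}"
  proof
    fix x assume x: "x \<in> grid_nodes P \<inter> frame p"
    then obtain q where q: "q \<in> P" "torus_proj x = torus_proj q" by (auto simp: grid_nodes_def)
    then have "q \<in> frame p" using x by (metis IntD2 mem_frame_proj)
    then have "q = p" using frame_disjoint[OF assms(1) q(1) assms(2)] self_in_frame by blast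
    then show "x \<in> grid_nodes {p}" using q by (simp add: grid_nodes_def)
  qed
qed

lemma unit_edge_self: "v \<in> unit_edge v i" by (simp add: unit_edge_def)

lemma grid_edges_in_frame:
  assumes "generic P" "p \<in> P" shows "{s \<in> edges (grid P). s \<subseteq> frame p} = edges (grid {p})"
proof -
  have "grid_nodes {p} \<subseteq> grid_nodes P" using assms by (auto simp: grid_nodes_def)
  moreover have "unit_edge v i \<subseteq> frame p" if "v \<in> grid_nodes {p}" for v i
    using that by (intro unit_edge_subset_frame) (simp add: grid_nodes_def)
  moreover have "v \<in> grid_nodes {p}" if "v \<in> grid_nodes P" "unit_edge v i \<subseteq> frame p" for v i
    using grid_nodes_Int_frame[OF assms] that unit_edge_self[of v i] by blast
  ultimately show ?thesis unfolding edges_grid by blast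
qed

lemma net_components_grid:
  assumes "finite P" "generic P" shows "net_components (grid P) = (\<lambda>p. grid {p}) ` P"
proof -
  have "(nodes (grid P) \<inter> frame p, {s \<in> edges (grid P). s \<subseteq> frame p}) = grid {p}" if "p \<in> P" for p
    using that assms by (simp add: grid_nodes_Int_frame grid_edges_in_frame) (simp add: grid_def edges_def)
  then show ?thesis unfolding net_components_def components_body_grid[OF assms] by (auto simp: image_image)
qed

lemma translate_unit_edge: "(\<lambda>p. v + p) ` unit_edge w i = unit_edge (v + w) i"
  by (simp add: unit_edge_def add.assoc flip: closed_segment_translation)

lemma translate_pcu: "translate v pcu = grid {v}"
proof -
  have 1: "(\<lambda>p. v + p) ` integer_points = grid_nodes {v}"
    by (auto simp: grid_nodes_iff image_iff) (metis add.commute diff_add_cancel)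
  have "(\<lambda>s. (\<lambda>p. v + p) ` s) ` {unit_edge w i | w i. w \<in> integer_points}
      = {(\<lambda>p. v + p) ` unit_edge w i | w i. w \<in> integer_points}" by blast
  also have "\<dots> = {unit_edge (v + w) i | w i. w \<in> integer_points}" by (simp only: translate_unit_edge)
  also have "\<dots> = {unit_edge w i | w i. w \<in> grid_nodes {v}}" unfolding 1[symmetric] by blast
  finally show ?thesis unfolding translate_def grid_def pcu_def nodes_def edges_def unit_edge_def using 1 by simp
qed


text \<open>Edges that meet belong to the same frame, so their base points differ by an integer vector. Hence
  the common point has integral coordinates relative to both base points, unless the edges are
  equal.\<close>

lemma unit_edges_meet_in_endpoints:
  assumes "generic P" "v \<in> grid_nodes P" "w \<in> grid_nodes P" "unit_edge v i \<noteq> unit_edge w j"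
  shows "unit_edge v i \<inter> unit_edge w j \<subseteq> endpoints (unit_edge v i) \<inter> endpoints (unit_edge w j)"
proof
  fix x assume x: "x \<in> unit_edge v i \<inter> unit_edge w j"
  obtain p q where pq: "p \<in> P" "q \<in> P" "torus_proj v = torus_proj p" "torus_proj w = torus_proj q"
    using assms by (auto simp: grid_nodes_def)
  have "x \<in> frame p" "x \<in> frame q" using x unit_edge_subset_frame pq by blast+
  then have "p = q" using frame_disjoint assms(1) pq by blast
  then have vw: "(v - w) $ l \<in> \<int>" for l using pq by (metis torus_proj_eq_iff)
  have xv: "\<And>l. l \<noteq> i \<Longrightarrow> x $ l = v $ l" "v $ i \<le> x $ i" "x $ i \<le> v $ i + 1"
    and xw: "\<And>l. l \<noteq> j \<Longrightarrow> x $ l = w $ l" "w $ j \<le> x $ j" "x $ j \<le> w $ j + 1"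
    using x by (auto simp: mem_unit_edge)
  have "x $ i - v $ i \<in> \<int> \<and> x $ j - w $ j \<in> \<int>"
  proof (cases "i = j")
    case False
    then have "x $ i - v $ i = - (v - w) $ i" "x $ j - w $ j = (v - w) $ j" using xv xw by auto
    then show ?thesis using vw Ints_minus by metis
  next
    case True
    have eq: "x $ i - w $ i = (x $ i - v $ i) + (v - w) $ i" "x $ i - v $ i = (x $ i - w $ i) - (v - w) $ i"
      by auto
    show ?thesis
    proof (cases "x $ i - v $ i \<in> \<int>")
      case True
      then show ?thesis using eq(1) vw[of i] Ints_add \<open>i = j\<close> by metis
    next
      case F: False
      have F2: "x $ i - w $ i \<notin> \<int>" using F eq(2) vw[of i] Ints_diff by metis
      obtain k where k: "(v - w) $ i = of_int k" using vw by (metis Ints_cases)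
      have "x $ i \<noteq> v $ i" "x $ i \<noteq> v $ i + 1" "x $ i \<noteq> w $ i" "x $ i \<noteq> w $ i + 1"
        using F F2 by auto
      then have "\<bar>(v - w) $ i\<bar> < 1" using xv xw True by auto
      then have "k = 0" using k by linarith
      then have "v $ i = w $ i" using k by simp
      moreover have "v $ l = w $ l" if "l \<noteq> i" for l using xv(1) xw(1) that True by simp
      ultimately have "v = w" by (metis vec_eq_iff)
      then show ?thesis using assms(4) True by simp
    qed
  qed
  then show "x \<in> endpoints (unit_edge v i) \<inter> endpoints (unit_edge w j)"
    using x by (auto intro: unit_edge_endpointI)
qed

lemma is_basis_det: assumes "det a \<noteq> 0" shows "is_basis a"
proof -
  have inj: "inj (\<lambda>i. a $ i)"
    using assms det_identical_rows[of _ _ a] by (auto simp: inj_def row_def)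
  have rows: "rows a = range (\<lambda>i. a $ i)" by (auto simp: rows_def row_def)
  have ind: "independent (range (\<lambda>i. a $ i))"
    using assms det_dependent_rows[of a] rows by (auto simp: dependent_vec_eq)
  have "card (range (\<lambda>i. a $ i)) = DIM(real^3)" using inj by (simp add: card_image)
  then have "span (range (\<lambda>i. a $ i)) = UNIV"
    using ind card_ge_dim_independent[of "range (\<lambda>i. a $ i)" UNIV] by (auto simp: dim_UNIV)
  then show ?thesis using inj ind by (simp add: is_basis_def)
qed

lemma lattice_of_mat_1: "lattice_of (mat 1) = integer_points"
proof -
  have eq: "(\<Sum>i\<in>UNIV. real_of_int (k i) *\<^sub>R (mat 1 :: real^3^3) $ i) = (\<chi> i. of_int (k i))" for k :: "3 \<Rightarrow> int"
    by (simp add: vec_eq_iff mat_def if_distrib cong: if_cong)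
  have "v \<in> range (\<lambda>k :: 3 \<Rightarrow> int. \<chi> i. real_of_int (k i))" if "v \<in> integer_points" for v
  proof -
    have "v $ i = of_int \<lfloor>v $ i\<rfloor>" for i
    proof -
      have "v $ i \<in> \<int>" using that by (simp add: integer_points_def)
      then obtain k where "v $ i = of_int k" by (rule Ints_cases)
      then show ?thesis by simp
    qed
    then have "v = (\<chi> i. of_int \<lfloor>v $ i\<rfloor>)" by (simp only: vec_eq_iff vec_lambda_beta) simp
    then show ?thesis by (rule range_eqI[of _ _ "\<lambda>i. \<lfloor>v $ i\<rfloor>"])
  qed
  then show ?thesis unfolding lattice_of_def eq by (auto simp: integer_points_def)
qed

lemma grid_nodes_eq_Union: "grid_nodes P = (\<Union>p\<in>P. (\<lambda>v. v + p) ` integer_points)"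
proof -
  have "x \<in> (\<lambda>v. v + p) ` integer_points \<longleftrightarrow> x - p \<in> integer_points" for x p
    by (auto simp: image_iff intro!: bexI[of _ "x - p"])
  then show ?thesis unfolding grid_nodes_iff[abs_def] set_eq_iff grid_nodes_iff by blast
qed

lemma countable_integer_points: "countable integer_points"
  by (simp flip: lattice_of_mat_1 add: lattice_of_def)

lemma translate_grid_nodes: "v \<in> integer_points \<Longrightarrow> (\<lambda>p. v + p) ` grid_nodes P = grid_nodes P"
proof -
  assume v: "v \<in> integer_points"
  have "x \<in> (\<lambda>p. v + p) ` grid_nodes P \<longleftrightarrow> x \<in> grid_nodes P" for x
  proof -
    have "x \<in> (\<lambda>p. v + p) ` grid_nodes P \<longleftrightarrow> x + - v \<in> grid_nodes P"
      by (auto simp: image_iff intro!: bexI[of _ "x - v"])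
    then show ?thesis using grid_nodes_add v by blast
  qed
  then show ?thesis by blast
qed

lemma translate_grid_edges:
  assumes "v \<in> integer_points" shows "(\<lambda>s. (\<lambda>p. v + p) ` s) ` edges (grid P) = edges (grid P)"
proof -
  have "(\<lambda>s. (\<lambda>p. v + p) ` s) ` edges (grid P) = {(\<lambda>p. v + p) ` unit_edge w i | w i. w \<in> grid_nodes P}"
    unfolding edges_grid by blast
  also have "\<dots> = {unit_edge (v + w) i | w i. w \<in> grid_nodes P}" by (simp only: translate_unit_edge)
  also have "\<dots> = {unit_edge w i | w i. w \<in> (\<lambda>p. v + p) ` grid_nodes P}" by blast
  finally show ?thesis unfolding translate_grid_nodes[OF assms] by (simp add: edges_grid)
qed

lemma periodicity_basis_grid:
  assumes "finite P" shows "periodicity_basis (mat 1) (grid P)"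
proof -
  let ?o = "\<lambda>p. {v + p | v. v \<in> integer_points}" and ?e = "\<lambda>s. {(\<lambda>p. v + p) ` s | v. v \<in> integer_points}"
  have shift: "F ` integer_points = (\<lambda>v. F (v + w)) ` integer_points" if "w \<in> integer_points"
    for F :: "real^3 \<Rightarrow> 'x" and w
  proof -
    have "v \<in> (\<lambda>v. v + w) ` integer_points" if "v \<in> integer_points" for v
      using that \<open>w \<in> integer_points\<close> by (intro image_eqI[of _ _ "v - w"]) auto
    then have "(\<lambda>v. v + w) ` integer_points = integer_points" using that by auto
    then show ?thesis by (metis image_image)
  qed
  have "?o ` grid_nodes P \<subseteq> ?o ` P"
  proof
    fix s assume "s \<in> ?o ` grid_nodes P"
    then obtain x where s: "s = ?o x" and x: "x \<in> grid_nodes P" by blast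
    obtain p where p: "p \<in> P" "x - p \<in> integer_points" using x unfolding grid_nodes_iff by blast
    obtain w where w: "w \<in> integer_points" "s = ?o (w + p)"
      by (rule that[of "x - p"]) (simp_all only: p s diff_add_cancel)
    note p = p(1) w
    have "?o (w + p) = ?o p"
      using shift[OF p(2), of "\<lambda>v. v + p"] by (simp add: setcompr_eq_image add.assoc)
    then show "s \<in> ?o ` P" using p by blast
  qed
  then have 1: "finite (?o ` grid_nodes P)" by (rule finite_subset) (simp add: assms)
  have "?e ` edges (grid P) \<subseteq> (\<lambda>(p, i). ?e (unit_edge p i)) ` (P \<times> UNIV)"
  proof
    fix s assume "s \<in> ?e ` edges (grid P)"
    then obtain x i where s: "s = ?e (unit_edge x i)" and x: "x \<in> grid_nodes P"
      unfolding edges_grid by blast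
    obtain p where p: "p \<in> P" "x - p \<in> integer_points" using x unfolding grid_nodes_iff by blast
    obtain w where w: "w \<in> integer_points" "s = ?e (unit_edge (w + p) i)"
      by (rule that[of "x - p"]) (simp_all only: p s diff_add_cancel)
    note p = p(1) w
    have "?e (unit_edge (w + p) i) = ?e (unit_edge p i)"
      using shift[OF p(2), of "\<lambda>v. unit_edge (v + p) i"] by (simp add: setcompr_eq_image add.assoc translate_unit_edge)
    then show "s \<in> (\<lambda>(p, i). ?e (unit_edge p i)) ` (P \<times> UNIV)" using p by auto
  qed
  then have 2: "finite (?e ` edges (grid P))" by (rule finite_subset) (simp add: assms)
  show ?thesis unfolding periodicity_basis_def lattice_of_mat_1
    using 1 2 unfolding nodes_grid
    by (intro conjI ballI) (simp_all only: is_basis_det translate_grid_nodes translate_grid_edges is_basis_det[of "mat 1", simplified])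
qed

lemma nodes_grid_eq_endpoints: "nodes (grid P) = \<Union>(endpoints ` edges (grid P))"
proof
  have "x \<in> endpoints (unit_edge x 1)" for x by (simp add: endpoints_unit_edge)
  then show "nodes (grid P) \<subseteq> \<Union>(endpoints ` edges (grid P))" unfolding edges_grid nodes_grid by blast
  show "\<Union>(endpoints ` edges (grid P)) \<subseteq> nodes (grid P)"
    by (auto simp: edges_grid endpoints_unit_edge grid_nodes_add)
qed

lemma linear_3periodic_net_grid:
  assumes "finite P" "generic P" shows "linear_3periodic_net (grid P)"
proof -
  have "grid_nodes P = (\<Union>p\<in>P. (\<lambda>v. v + p) ` integer_points)"
    by (rule grid_nodes_eq_Union)
  then have "countable (grid_nodes P)"
    using assms countable_integer_points by (simp add: countable_finite)
  moreover have "edges (grid P) = (\<lambda>(v, i). unit_edge v i) ` (grid_nodes P \<times> UNIV)"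
    by (auto simp: edges_grid)
  ultimately have "countable (edges (grid P))" by (simp add: countable_finite)
  moreover have "is_segment s" if "s \<in> edges (grid P)" for s
    using that by (auto simp: edges_grid is_segment_def unit_edge_def axis_eq_0_iff) (metis add_cancel_left_right axis_eq_0_iff one_neq_zero)
  moreover have "\<forall>s\<in>edges (grid P). \<forall>s'\<in>edges (grid P). s \<noteq> s' \<longrightarrow> s \<inter> s' \<subseteq> endpoints s \<inter> endpoints s'"
    using unit_edges_meet_in_endpoints[OF assms(2)] unfolding edges_grid by blast
  moreover have "nodes (grid P) = \<Union>(endpoints ` edges (grid P))" by (rule nodes_grid_eq_endpoints)
  ultimately show ?thesis unfolding linear_3periodic_net_def
    using periodicity_basis_grid[OF assms(1)] by blast
qed

lemma grid_singleton_inj: assumes "generic P" shows "inj_on (\<lambda>p. grid {p}) P"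
proof (rule inj_onI)
  fix p q assume pq: "p \<in> P" "q \<in> P" "grid {p} = grid {q}"
  have "grid_nodes {p} = grid_nodes {q}" using pq(3) by (metis nodes_grid)
  then have "torus_proj p = torus_proj q" using self_in_grid_nodes[of p "{p}"] by (auto simp: grid_nodes_def)
  then show "p = q" using generic_proj_inj[OF assms] pq by (auto dest: inj_onD)
qed

text \<open>The configuration of a grid consists of the translation vectors of its components. The edges of
  the net are connected, so the components account for all of them.\<close>

lemma n_grid_iff: "n_grid n G \<longleftrightarrow> (\<exists>P\<in>configs n. G = grid P)"
proof
  assume "\<exists>P\<in>configs n. G = grid P"
  then obtain P where P: "finite P" "card P = n" "generic P" "G = grid P" by (auto simp: configs_def)
  then show "n_grid n G"
    by (auto simp: n_grid_def net_components_grid linear_3periodic_net_grid card_image grid_singleton_inj translate_pcu)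
next
  assume G: "n_grid n G"
  let ?N = "net_components G"
  have "\<forall>H\<in>?N. \<exists>v. H = grid {v}" using G by (simp add: n_grid_def translate_pcu)
  then obtain v where v: "\<And>H. H \<in> ?N \<Longrightarrow> H = grid {v H}" by metis
  define P where "P = v ` ?N"
  have inj: "inj_on v ?N" using v by (metis inj_onI)
  have fin: "finite P" "card P = n" using G inj by (auto simp: P_def n_grid_def card_image)
  have net: "linear_3periodic_net G" using G by (simp add: n_grid_def)
  have seg: "\<And>s. s \<in> edges G \<Longrightarrow> is_segment s" and nod: "nodes G = \<Union>(endpoints ` edges G)"
    using net by (auto simp: linear_3periodic_net_def)
  have comp: "\<exists>C\<in>components (body G). s \<subseteq> C" if s: "s \<in> edges G" for s
  proof -
    have "s \<noteq> {}" "connected s" using seg[OF s] by (auto simp: is_segment_def)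
    moreover have "s \<subseteq> body G" using s by (auto simp: body_def)
    ultimately show ?thesis using exists_component_superset by (metis bot.extremum_uniqueI)
  qed
  have sub: "endpoints s \<subseteq> s" if "s \<in> edges G" for s
    using seg[OF that] by (auto simp: is_segment_def endpoints_closed_segment)
  have "edges G = (\<Union>H\<in>?N. edges H)"
    using comp by (force simp: net_components_def edges_def)
  also have "\<dots> = edges (grid P)"
  proof -
    have "edges H = {unit_edge w i | w i. torus_proj w = torus_proj (v H)}" if "H \<in> ?N" for H
    proof -
      have "edges H = edges (grid {v H})" using v[OF that] by simp
      then show ?thesis by (simp add: edges_grid grid_nodes_def)
    qed
    then have "(\<Union>H\<in>?N. edges H) = (\<Union>H\<in>?N. {unit_edge w i | w i. torus_proj w = torus_proj (v H)})" by simp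
    also have "\<dots> = edges (grid P)" unfolding edges_grid grid_nodes_def P_def by blast
    finally show ?thesis .
  qed
  finally have E: "edges G = edges (grid P)" .
  have "nodes (grid P) = \<Union>(endpoints ` edges (grid P))" by (rule nodes_grid_eq_endpoints)
  then have "G = grid P" using E nod by (metis edges_def nodes_def prod.collapse)
  moreover have "generic P" unfolding generic_def
  proof (intro ballI impI)
    fix p q assume pq: "p \<in> P" "q \<in> P" "p \<noteq> q"
    then obtain H H' where H: "H \<in> ?N" "H' \<in> ?N" "p = v H" "q = v H'" by (auto simp: P_def)
    obtain C C' where C: "C \<in> components (body G)" "H = (nodes G \<inter> C, {s \<in> edges G. s \<subseteq> C})"
        "C' \<in> components (body G)" "H' = (nodes G \<inter> C', {s \<in> edges G. s \<subseteq> C'})"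
      using H by (auto simp: net_components_def)
    have "C \<noteq> C'" using C(2,4) pq(3) H(3,4) by metis
    then have "C \<inter> C' = {}" using C components_nonoverlap by blast
    moreover have "frame p \<subseteq> C"
    proof -
      have "frame p = body (grid {p})" by (simp add: body_grid)
      also have "\<dots> = body H" using v[OF H(1)] H(3) by simp
      also have "\<dots> \<subseteq> C" using C by (auto simp: body_def edges_def)
      finally show ?thesis .
    qed
    moreover have "frame q \<subseteq> C'"
    proof -
      have "frame q = body (grid {q})" by (simp add: body_grid)
      also have "\<dots> = body H'" using v[OF H(2)] H(4) by simp
      also have "\<dots> \<subseteq> C'" using C by (auto simp: body_def edges_def)
      finally show ?thesis .
    qed
    ultimately show "\<forall>i. (p - q) $ i \<notin> \<int>" using frame_disjoint_iff by blast
  qed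
  ultimately show "\<exists>P\<in>configs n. G = grid P" using fin by (auto simp: configs_def)
qed

section \<open>Cyclic order of configurations\<close>

text \<open>For lifts of two points of the circle, the floor of the difference tells how many full turns one
  is ahead of the other; for all pairs together these integers encode the cyclic order of the points
  and the relative choice of their lifts.\<close>

definition preserves_order :: "(real^3 \<Rightarrow> real^3) \<Rightarrow> (real^3) set \<Rightarrow> bool" where
  "preserves_order g P \<longleftrightarrow> (\<forall>p\<in>P. \<forall>q\<in>P. \<forall>i. \<lfloor>(g p - g q) $ i\<rfloor> = \<lfloor>(p - q) $ i\<rfloor>)"

text \<open>The map \<open>g\<close> chooses lifts of the points of \<open>Q\<close>. On a generic
  \<open>P\<close> the preservation of floors makes \<open>g\<close> injective modulo 1, so the
  equality of the two images matches the points of \<open>P\<close> and \<open>Q\<close> bijectively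
  modulo 1 when \<open>Q\<close> is generic too.\<close>

definition order_equiv :: "(real^3) set \<Rightarrow> (real^3) set \<Rightarrow> bool" where
  "order_equiv P Q \<longleftrightarrow> (\<exists>g. preserves_order g P \<and> torus_proj ` g ` P = torus_proj ` Q)"

lemma preserves_orderD:
  "preserves_order g P \<Longrightarrow> p \<in> P \<Longrightarrow> q \<in> P \<Longrightarrow> \<lfloor>(g p - g q) $ i\<rfloor> = \<lfloor>(p - q) $ i\<rfloor>"
  by (simp add: preserves_order_def)

lemma floor_minus_plus: "(x::real) \<notin> \<int> \<Longrightarrow> \<lfloor>- x\<rfloor> = - \<lfloor>x\<rfloor> - 1"
  by (metis Ints_of_int add_diff_cancel_right' ceiling_altdef ceiling_def minus_minus diff_conv_add_uminus minus_add_distrib)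

text \<open>Integrality is visible in the floors of a number and of its negative. Therefore a map that
  preserves the floors of all differences, for both orders of the pair, preserves genericity.\<close>

lemma Ints_iff_floor_minus: "(x::real) \<in> \<int> \<longleftrightarrow> \<lfloor>x\<rfloor> + \<lfloor>- x\<rfloor> = 0"
proof
  assume "x \<in> \<int>" then show "\<lfloor>x\<rfloor> + \<lfloor>- x\<rfloor> = 0" by (auto elim!: Ints_cases)
next
  assume "\<lfloor>x\<rfloor> + \<lfloor>- x\<rfloor> = 0" then show "x \<in> \<int>" using floor_minus_plus[of x] by fastforce
qed

lemma preserves_order_generic:
  assumes "preserves_order g P" "generic P" "p \<in> P" "q \<in> P" "p \<noteq> q"
  shows "(g p - g q) $ i \<notin> \<int>"
proof -
  have "(p - q) $ i \<notin> \<int>" using assms by (simp add: generic_def)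
  moreover have "\<lfloor>(g p - g q) $ i\<rfloor> = \<lfloor>(p - q) $ i\<rfloor>" "\<lfloor>- (g p - g q) $ i\<rfloor> = \<lfloor>- (p - q) $ i\<rfloor>"
    using preserves_orderD[OF assms(1)] assms(3,4) by (simp_all flip: vector_uminus_component)
  ultimately show ?thesis unfolding Ints_iff_floor_minus by metis
qed

lemma preserves_order_image_generic:
  assumes "preserves_order g P" "generic P" shows "generic (g ` P)"
  using preserves_order_generic[OF assms] unfolding generic_def by (metis imageE)

lemma preserves_order_proj_inj:
  assumes "preserves_order g P" "generic P" shows "inj_on (\<lambda>p. torus_proj (g p)) P"
  using preserves_order_generic[OF assms] by (auto simp: inj_on_def torus_proj_eq_iff)

text \<open>Both differences lie in the same half-open unit interval, which is convex.\<close>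

lemma preserves_order_interpolate:
  assumes "preserves_order g P" "0 \<le> t" "t \<le> 1"
  shows "preserves_order (\<lambda>p. p + t *\<^sub>R (g p - p)) P"
  unfolding preserves_order_def
proof (intro ballI allI)
  fix p q i assume pq: "p \<in> P" "q \<in> P"
  define a where "a = (p - q) $ i" define b where "b = (g p - g q) $ i"
  have "(p + t *\<^sub>R (g p - p) - (q + t *\<^sub>R (g q - q))) $ i = (1 - t) * a + t * b"
    by (simp add: a_def b_def algebra_simps)
  moreover have "\<lfloor>a\<rfloor> = \<lfloor>b\<rfloor>" using preserves_orderD[OF assms(1) pq] by (simp add: a_def b_def)
  then have "of_int \<lfloor>a\<rfloor> \<le> b" "b < of_int \<lfloor>a\<rfloor> + 1" "of_int \<lfloor>a\<rfloor> \<le> a" "a < of_int \<lfloor>a\<rfloor> + 1"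
    by linarith+
  then have "of_int \<lfloor>a\<rfloor> \<le> (1 - t) * a + t * b" "(1 - t) * a + t * b < of_int \<lfloor>a\<rfloor> + 1"
    using convex_bound_le[of "- a" "- of_int \<lfloor>a\<rfloor>" "- b" "1 - t" t]
      convex_bound_lt[of a "of_int \<lfloor>a\<rfloor> + 1" b "1 - t" t] assms(2,3) by auto
  then have "\<lfloor>(1 - t) * a + t * b\<rfloor> = \<lfloor>a\<rfloor>" by linarith
  ultimately show "\<lfloor>(p + t *\<^sub>R (g p - p) - (q + t *\<^sub>R (g q - q))) $ i\<rfloor> = \<lfloor>(p - q) $ i\<rfloor>"
    by (simp only: a_def)
qed

lemma order_equiv_refl: "order_equiv P P"
  unfolding order_equiv_def preserves_order_def by (intro exI[of _ id]) simp

lemma floor_add_integer_points: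
  assumes "v \<in> integer_points" "\<lfloor>x $ i\<rfloor> = \<lfloor>y $ i\<rfloor>"
  shows "\<lfloor>(x + v) $ i\<rfloor> = \<lfloor>(y + v) $ i\<rfloor>"
proof -
  have "v $ i \<in> \<int>" using assms(1) by (simp add: integer_points_def)
  then obtain k where "v $ i = of_int k" by (rule Ints_cases)
  then show ?thesis using assms(2) by simp
qed

text \<open>Given the lift \<open>g\<close> of \<open>Q\<close>, each \<open>q\<close> differs from the image
  \<open>g p\<close> of its partner \<open>p\<close> by an integer vector. Adding that vector to
  \<open>p\<close> gives the required lift of \<open>P\<close>.\<close>

lemma order_equiv_sym:
  assumes "generic P" "order_equiv P Q" shows "order_equiv Q P"
proof -
  obtain g where g: "preserves_order g P" "torus_proj ` g ` P = torus_proj ` Q"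
    using assms(2) by (auto simp: order_equiv_def)
  have "\<forall>q\<in>Q. \<exists>p\<in>P. torus_proj q = torus_proj (g p)" using g(2) by blast
  then obtain s where s: "\<And>q. q \<in> Q \<Longrightarrow> s q \<in> P" "\<And>q. q \<in> Q \<Longrightarrow> torus_proj q = torus_proj (g (s q))"
    by metis
  define h where "h q = s q + (q - g (s q))" for q
  have int: "q - g (s q) \<in> integer_points" if "q \<in> Q" for q
    using s(2)[OF that] by (simp add: torus_proj_eq_iff_integer)
  have "preserves_order h Q" unfolding preserves_order_def
  proof (intro ballI allI)
    fix q r i assume qr: "q \<in> Q" "r \<in> Q"
    define v where "v = (q - g (s q)) - (r - g (s r))"
    have "v \<in> integer_points" using int qr by (auto simp: v_def)
    moreover have "h q - h r = (s q - s r) + v" "q - r = (g (s q) - g (s r)) + v"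
      by (simp_all add: h_def v_def)
    ultimately show "\<lfloor>(h q - h r) $ i\<rfloor> = \<lfloor>(q - r) $ i\<rfloor>"
      using floor_add_integer_points preserves_orderD[OF g(1) s(1)[OF qr(1)] s(1)[OF qr(2)], of i] by metis
  qed
  moreover have "s ` Q = P"
  proof
    show "s ` Q \<subseteq> P" using s(1) by blast
    show "P \<subseteq> s ` Q"
    proof
      fix p assume p: "p \<in> P"
      then obtain q where q: "q \<in> Q" "torus_proj (g p) = torus_proj q" using g(2) by blast
      then have "torus_proj (g (s q)) = torus_proj (g p)" using s(2) by simp
      then have "s q = p"
        using preserves_order_proj_inj[OF g(1) assms(1)] s(1) p q(1) by (auto dest: inj_onD)
      then show "p \<in> s ` Q" using q(1) by blast
    qed
  qed
  moreover have "torus_proj (h q) = torus_proj (s q)" if "q \<in> Q" for q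
    using int[OF that] by (simp add: h_def)
  ultimately show ?thesis unfolding order_equiv_def by (intro exI[of _ h]) (auto simp: image_image)
qed

text \<open>The second lift is carried to the lifts chosen by the first one, again by adding integer vectors.\<close>

lemma order_equiv_trans:
  assumes "generic Q" "order_equiv P Q" "order_equiv Q R" shows "order_equiv P R"
proof -
  obtain g where g: "preserves_order g P" "torus_proj ` g ` P = torus_proj ` Q"
    using assms(2) by (auto simp: order_equiv_def)
  obtain h where h: "preserves_order h Q" "torus_proj ` h ` Q = torus_proj ` R"
    using assms(3) by (auto simp: order_equiv_def)
  have "\<forall>p\<in>P. \<exists>q\<in>Q. torus_proj (g p) = torus_proj q" using g(2) by blast
  then obtain s where s: "\<And>p. p \<in> P \<Longrightarrow> s p \<in> Q" "\<And>p. p \<in> P \<Longrightarrow> torus_proj (g p) = torus_proj (s p)"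
    by metis
  define k where "k p = h (s p) + (g p - s p)" for p
  have int: "g p - s p \<in> integer_points" if "p \<in> P" for p
    using s(2)[OF that] by (simp add: torus_proj_eq_iff_integer)
  have "preserves_order k P" unfolding preserves_order_def
  proof (intro ballI allI)
    fix p q i assume pq: "p \<in> P" "q \<in> P"
    define v where "v = (g p - s p) - (g q - s q)"
    have "v \<in> integer_points" using int pq by (auto simp: v_def)
    moreover have "k p - k q = (h (s p) - h (s q)) + v" "g p - g q = (s p - s q) + v"
      by (simp_all add: k_def v_def)
    ultimately show "\<lfloor>(k p - k q) $ i\<rfloor> = \<lfloor>(p - q) $ i\<rfloor>"
      using floor_add_integer_points preserves_orderD[OF h(1) s(1)[OF pq(1)] s(1)[OF pq(2)], of i]
        preserves_orderD[OF g(1) pq, of i] by metis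
  qed
  moreover have "s ` P = Q"
  proof
    show "s ` P \<subseteq> Q" using s(1) by blast
    show "Q \<subseteq> s ` P"
    proof
      fix q assume q: "q \<in> Q"
      then obtain p where p: "p \<in> P" "torus_proj (g p) = torus_proj q" using g(2) by (metis (no_types, lifting) image_iff)
      then have "s p = q"
        using generic_proj_inj[OF assms(1)] s q by (metis inj_onD)
      then show "q \<in> s ` P" using p(1) by blast
    qed
  qed
  moreover have "torus_proj (k p) = torus_proj (h (s p))" if "p \<in> P" for p
    using int[OF that] by (simp add: k_def)
  then have "torus_proj ` k ` P = torus_proj ` h ` s ` P" by (simp add: image_image)
  ultimately show ?thesis unfolding order_equiv_def using h(2) by (intro exI[of _ k]) simp
qed

text \<open>Inverses of rotations are written as transposed matrices acting from the left.\<close>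

declare transpose_matrix_vector [simp del]

definition integral_rotations :: "(real^3^3) set" where
  "integral_rotations = {X. rotation_matrix X \<and> (\<forall>i j. X $ i $ j \<in> \<int>)}"

lemma integral_rotations_mult:
  "X \<in> integral_rotations \<Longrightarrow> Y \<in> integral_rotations \<Longrightarrow> X ** Y \<in> integral_rotations"
  unfolding integral_rotations_def rotation_matrix_def
proof (intro CollectI conjI allI, elim CollectE conjE)
  fix i j assume "X \<in> {X. (orthogonal_matrix X \<and> det X = 1) \<and> (\<forall>i j. X $ i $ j \<in> \<int>)}"
    "Y \<in> {X. (orthogonal_matrix X \<and> det X = 1) \<and> (\<forall>i j. X $ i $ j \<in> \<int>)}"
  then show "(X ** Y) $ i $ j \<in> \<int>" by (auto simp: matrix_matrix_mult_def intro!: Ints_sum Ints_mult)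
qed (auto simp: orthogonal_matrix_mul det_mul)

lemma integral_rotations_transpose: "X \<in> integral_rotations \<Longrightarrow> transpose X \<in> integral_rotations"
  by (simp add: integral_rotations_def rotation_matrix_def orthogonal_matrix_transpose det_transpose)
    (simp add: transpose_def)

lemma integral_rotations_1: "mat 1 \<in> integral_rotations"
  by (simp add: integral_rotations_def rotation_matrix_def orthogonal_matrix_id) (simp add: mat_def)

lemma rotation_inverse:
  assumes "X \<in> integral_rotations"
  shows "transpose X *v (X *v x) = x" "X *v (transpose X *v x) = x"
  using assms by (auto simp: integral_rotations_def rotation_matrix_def orthogonal_matrix_def matrix_vector_mul_assoc)

lemma rotation_inj: "X \<in> integral_rotations \<Longrightarrow> inj ((*v) X)"
  using rotation_inverse(1) by (metis injI)

lemma rotation_integer_points: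
  assumes "X \<in> integral_rotations" "v \<in> integer_points" shows "X *v v \<in> integer_points"
  using assms by (auto simp: integral_rotations_def integer_points_def matrix_vector_mult_def
      intro!: Ints_sum Ints_mult)

lemma rotation_torus_proj_cong:
  assumes "X \<in> integral_rotations" "torus_proj x = torus_proj y"
  shows "torus_proj (X *v x) = torus_proj (X *v y)"
  using rotation_integer_points[OF assms(1), of "x - y"] assms(2)
  by (simp add: torus_proj_eq_iff_integer matrix_vector_mult_diff_distrib)

lemma Ints_square_cases: "(x::real) \<in> \<int> \<Longrightarrow> x\<^sup>2 \<le> 1 \<Longrightarrow> x = 0 \<or> x = 1 \<or> x = -1"
proof -
  assume "x \<in> \<int>" "x\<^sup>2 \<le> 1"
  then obtain k where k: "x = of_int k" by (auto elim: Ints_cases)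
  have "\<bar>x\<bar> \<le> 1" using \<open>x\<^sup>2 \<le> 1\<close> by (simp add: abs_square_le_1)
  then have "k = 0 \<or> k = 1 \<or> k = -1" using k by linarith
  then show ?thesis using k by auto
qed

lemma unit_integer_vector:
  fixes r :: "real^3"
  assumes "\<And>j. r $ j \<in> \<int>" "(\<Sum>j\<in>UNIV. (r $ j)\<^sup>2) = 1"
  obtains j s where "s = 1 \<or> s = -1" "r = s *\<^sub>R axis j 1"
proof -
  have le: "(r $ j)\<^sup>2 \<le> 1" for j using member_le_sum[of j UNIV "\<lambda>j. (r $ j)\<^sup>2"] assms(2) by simp
  have cases: "r $ j = 0 \<or> r $ j = 1 \<or> r $ j = -1" for j using Ints_square_cases assms(1) le by blast
  obtain j where j: "r $ j \<noteq> 0" using assms(2) by (metis (no_types, lifting) power_zero_numeral sum.neutral zero_neq_one)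
  then have rj: "(r $ j)\<^sup>2 = 1" using cases[of j] by auto
  have "(\<Sum>k\<in>UNIV - {j}. (r $ k)\<^sup>2) = 0" using assms(2) rj by (simp add: sum.remove[of UNIV j])
  then have "\<forall>k\<in>UNIV - {j}. (r $ k)\<^sup>2 = 0" by (subst (asm) sum_nonneg_eq_0_iff) auto
  then have "r = (r $ j) *\<^sub>R axis j 1" by (auto simp: vec_eq_iff axis_def)
  then show thesis using that cases[of j] j by metis
qed

text \<open>A row of an orthogonal integer matrix is an integer vector of length 1. So a rotation permutes the
  coordinates up to signs.\<close>

lemma rotation_component:
  assumes "X \<in> integral_rotations"
  obtains j s where "s = 1 \<or> s = -1" "\<And>x. (X *v x) $ i = s * x $ j"
proof -
  have "X ** transpose X = mat 1" using assms by (simp add: integral_rotations_def rotation_matrix_def orthogonal_matrix_def)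
  then have "(X ** transpose X) $ i $ i = 1" by (simp add: mat_def)
  then have "(\<Sum>j\<in>UNIV. (X $ i $ j)\<^sup>2) = 1"
    by (simp add: matrix_matrix_mult_def transpose_def power2_eq_square)
  moreover have "X $ i $ j \<in> \<int>" for j using assms by (simp add: integral_rotations_def)
  ultimately obtain j s where js: "s = 1 \<or> s = -1" "X $ i = s *\<^sub>R axis j 1" using unit_integer_vector[of "X $ i"] by blast
  have "(X *v x) $ i = s * x $ j" for x
  proof -
    have "(X *v x) $ i = X $ i \<bullet> x" by (simp add: matrix_vector_mult_def inner_vec_def)
    then show ?thesis using js(2) by (simp add: inner_axis')
  qed
  then show thesis using that js(1) by blast
qed

lemma rotation_axis:
  assumes "X \<in> integral_rotations"
  obtains j s where "s = 1 \<or> s = -1" "X *v axis i 1 = s *\<^sub>R axis j 1"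
proof -
  have "transpose X ** X = mat 1" using assms by (simp add: integral_rotations_def rotation_matrix_def orthogonal_matrix_def)
  then have "(transpose X ** X) $ i $ i = 1" by (simp add: mat_def)
  then have "(\<Sum>j\<in>UNIV. ((X *v axis i 1) $ j)\<^sup>2) = 1"
    by (simp add: matrix_matrix_mult_def transpose_def power2_eq_square matrix_vector_mult_basis column_def)
  moreover have "(X *v axis i 1) $ j \<in> \<int>" for j
    using assms by (simp add: integral_rotations_def matrix_vector_mult_basis column_def)
  ultimately show thesis using unit_integer_vector[of "X *v axis i 1"] that by blast
qed

lemma generic_rotate:
  assumes "X \<in> integral_rotations" "generic P" shows "generic ((*v) X ` P)"
  unfolding generic_def
proof (intro ballI impI allI)
  fix y z i assume "y \<in> (*v) X ` P" "z \<in> (*v) X ` P" "y \<noteq> z"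
  then obtain p q where pq: "p \<in> P" "q \<in> P" "p \<noteq> q" "y = X *v p" "z = X *v q" by blast
  obtain j s where js: "s = 1 \<or> s = -1" "\<And>x. (X *v x) $ i = s * x $ j"
    using rotation_component[OF assms(1), of i] by metis
  have "(y - z) $ i = s * (p - q) $ j" using js(2)[of "p - q"] pq by (simp add: matrix_vector_mult_diff_distrib)
  moreover have "(p - q) $ j \<notin> \<int>" using assms(2) pq by (simp add: generic_def)
  ultimately show "(y - z) $ i \<notin> \<int>" using js(1) by (metis minus_in_Ints_iff mult_1 mult_minus1)
qed

text \<open>A rotation replaces the differences of a coordinate by those of another one, possibly with the
  opposite sign; for numbers that are not integers the floor of the negative is determined by the
  floor.\<close>

lemma order_equiv_rotate:
  assumes X: "X \<in> integral_rotations" and "generic P" "order_equiv P Q"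
  shows "order_equiv ((*v) X ` P) ((*v) X ` Q)"
proof -
  obtain g where g: "preserves_order g P" "torus_proj ` g ` P = torus_proj ` Q"
    using assms(3) by (auto simp: order_equiv_def)
  define h where "h y = X *v g (transpose X *v y)" for y
  have hX: "h (X *v p) = X *v g p" for p by (simp add: h_def rotation_inverse[OF X])
  have "preserves_order h ((*v) X ` P)" unfolding preserves_order_def
  proof (intro ballI allI)
    fix y z i assume "y \<in> (*v) X ` P" "z \<in> (*v) X ` P"
    then obtain p q where pq: "p \<in> P" "q \<in> P" "y = X *v p" "z = X *v q" by blast
    show "\<lfloor>(h y - h z) $ i\<rfloor> = \<lfloor>(y - z) $ i\<rfloor>"
    proof (cases "p = q")
      case False
      obtain j s where js: "s = 1 \<or> s = -1" "\<And>x. (X *v x) $ i = s * x $ j"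
        using rotation_component[OF X, of i] by metis
      have "(y - z) $ i = s * (p - q) $ j" "(h y - h z) $ i = s * (g p - g q) $ j"
        using js(2)[of "p - q"] js(2)[of "g p - g q"] pq by (simp_all add: matrix_vector_mult_diff_distrib hX)
      moreover have "(p - q) $ j \<notin> \<int>" using assms(2) pq False by (simp add: generic_def)
      moreover have "(g p - g q) $ j \<notin> \<int>"
        by (rule preserves_order_generic[OF g(1) assms(2) pq(1,2) False])
      moreover have "\<lfloor>(g p - g q) $ j\<rfloor> = \<lfloor>(p - q) $ j\<rfloor>" by (rule preserves_orderD[OF g(1) pq(1,2)])
      ultimately show ?thesis using js(1) floor_minus_plus by (metis mult_1 mult_minus1)
    qed (simp add: pq)
  qed
  moreover have "torus_proj ` h ` (*v) X ` P = torus_proj ` (*v) X ` Q"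
  proof -
    define T where "T y = torus_proj (X *v y)" for y
    have T: "T y = T (torus_proj y)" for y
      unfolding T_def by (rule rotation_torus_proj_cong[OF X]) simp
    have "torus_proj ` h ` (*v) X ` P = T ` g ` P" by (simp add: image_image hX T_def)
    also have "\<dots> = T ` torus_proj ` g ` P" by (simp add: image_image flip: T)
    also have "\<dots> = T ` torus_proj ` Q" using g(2) by simp
    also have "\<dots> = torus_proj ` (*v) X ` Q" by (simp add: image_image flip: T) (simp add: T_def)
    finally show ?thesis .
  qed
  ultimately show ?thesis unfolding order_equiv_def by blast
qed

definition rot_equiv :: "(real^3) set \<Rightarrow> (real^3) set \<Rightarrow> bool" where
  "rot_equiv P Q \<longleftrightarrow> (\<exists>X\<in>integral_rotations. order_equiv ((*v) X ` P) Q)"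

lemma rot_equiv_refl: "rot_equiv P P"
  unfolding rot_equiv_def using order_equiv_refl[of P]
  by (intro bexI[OF _ integral_rotations_1]) simp

lemma order_imp_rot_equiv: "order_equiv P Q \<Longrightarrow> rot_equiv P Q"
  unfolding rot_equiv_def by (intro bexI[OF _ integral_rotations_1]) simp

lemma rot_equiv_sym:
  assumes "generic P" "rot_equiv P Q" shows "rot_equiv Q P"
proof -
  obtain X where X: "X \<in> integral_rotations" "order_equiv ((*v) X ` P) Q"
    using assms(2) by (auto simp: rot_equiv_def)
  have "order_equiv ((*v) (transpose X) ` (*v) X ` P) ((*v) (transpose X) ` Q)"
    using order_equiv_rotate[OF integral_rotations_transpose[OF X(1)] generic_rotate[OF X(1) assms(1)] X(2)] .
  then have "order_equiv P ((*v) (transpose X) ` Q)"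
    by (simp add: image_image rotation_inverse[OF X(1)])
  then have "order_equiv ((*v) (transpose X) ` Q) P" by (rule order_equiv_sym[OF assms(1)])
  then show ?thesis unfolding rot_equiv_def using integral_rotations_transpose[OF X(1)] by blast
qed

lemma rot_equiv_trans:
  assumes "generic P" "generic Q" "rot_equiv P Q" "rot_equiv Q R" shows "rot_equiv P R"
proof -
  obtain X where X: "X \<in> integral_rotations" "order_equiv ((*v) X ` P) Q"
    using assms(3) by (auto simp: rot_equiv_def)
  obtain Y where Y: "Y \<in> integral_rotations" "order_equiv ((*v) Y ` Q) R"
    using assms(4) by (auto simp: rot_equiv_def)
  have "order_equiv ((*v) Y ` (*v) X ` P) ((*v) Y ` Q)"
    by (rule order_equiv_rotate[OF Y(1) generic_rotate[OF X(1) assms(1)] X(2)])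
  then have "order_equiv ((*v) Y ` (*v) X ` P) R"
    using order_equiv_trans[OF generic_rotate[OF Y(1) assms(2)]] Y(2) by blast
  moreover have "(*v) Y ` (*v) X ` P = (*v) (Y ** X) ` P"
    by (simp add: image_image matrix_vector_mul_assoc)
  ultimately show ?thesis unfolding rot_equiv_def using integral_rotations_mult[OF Y(1) X(1)] by metis
qed

section \<open>Linear isotopies of grid knots\<close>

text \<open>A geodesic of the torus; it is closed if \<open>d\<close> is an integer vector.\<close>

definition geodesic :: "real^3 \<Rightarrow> real^3 \<Rightarrow> (real^3) set" where
  "geodesic a d = range (\<lambda>s. torus_proj (a + s *\<^sub>R d))"

abbreviation circle :: "real^3 \<Rightarrow> 3 \<Rightarrow> (real^3) set" where
  "circle p i \<equiv> geodesic p (axis i 1)"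

abbreviation grid_knot :: "(real^3) set \<Rightarrow> graph_knot" where
  "grid_knot P \<equiv> standard_knot (grid P)"

lemma geodesic_cong: assumes "torus_proj a = torus_proj b" shows "geodesic a d = geodesic b d"
proof -
  have "torus_proj (a + s *\<^sub>R d) = torus_proj (b + s *\<^sub>R d)" for s
    using assms by (simp add: torus_proj_eq_iff)
  then show ?thesis by (simp add: geodesic_def)
qed

lemma geodesic_rebase: assumes "x \<in> geodesic a d" shows "geodesic x d = geodesic a d"
proof -
  obtain s0 where s0: "x = torus_proj (a + s0 *\<^sub>R d)" using assms by (auto simp: geodesic_def)
  have "geodesic x d = geodesic (a + s0 *\<^sub>R d) d" by (rule geodesic_cong) (simp add: s0)
  also have "\<dots> = geodesic a d"
  proof -
    have "range F = range (\<lambda>s. F (s0 + s))" for F :: "real \<Rightarrow> real^3"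
      using image_image[of F "(+) s0" UNIV] by (simp add: surj_plus)
    from this[of "\<lambda>s. torus_proj (a + s *\<^sub>R d)"] show ?thesis
      by (simp add: geodesic_def scaleR_add_left add.assoc)
  qed
  finally show ?thesis .
qed

lemma geodesic_scale: assumes "c \<noteq> 0" shows "geodesic a (c *\<^sub>R d) = geodesic a d"
proof -
  have "surj (\<lambda>s. s * c)" using assms by (intro surjI[of _ "\<lambda>s. s / c"]) simp
  then have "range (\<lambda>s. torus_proj (a + s *\<^sub>R d)) = (\<lambda>s. torus_proj (a + s *\<^sub>R d)) ` range (\<lambda>s. s * c)" by simp
  then show ?thesis by (simp add: geodesic_def image_image)
qed

lemma proj_closed_segment_geodesic:
  assumes "d \<in> integer_points" shows "torus_proj ` closed_segment a (a + d) = geodesic a d"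
proof
  show "torus_proj ` closed_segment a (a + d) \<subseteq> geodesic a d"
  proof
    fix x assume "x \<in> torus_proj ` closed_segment a (a + d)"
    then obtain u where "x = torus_proj ((1 - u) *\<^sub>R a + u *\<^sub>R (a + d))" by (auto simp: in_segment)
    moreover have "(1 - u) *\<^sub>R a + u *\<^sub>R (a + d) = a + u *\<^sub>R d" by (simp add: algebra_simps)
    ultimately show "x \<in> geodesic a d" by (auto simp: geodesic_def)
  qed
  show "geodesic a d \<subseteq> torus_proj ` closed_segment a (a + d)"
  proof
    fix x assume "x \<in> geodesic a d"
    then obtain s where s: "x = torus_proj (a + s *\<^sub>R d)" by (auto simp: geodesic_def)
    have "of_int \<lfloor>s\<rfloor> *\<^sub>R d \<in> integer_points" using assms by (simp add: integer_points_def)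
    then have "torus_proj (a + frac s *\<^sub>R d + of_int \<lfloor>s\<rfloor> *\<^sub>R d) = torus_proj (a + frac s *\<^sub>R d)" by simp
    moreover have "a + frac s *\<^sub>R d + of_int \<lfloor>s\<rfloor> *\<^sub>R d = a + s *\<^sub>R d" by (simp add: frac_def algebra_simps)
    ultimately have "x = torus_proj (a + frac s *\<^sub>R d)" using s by simp
    moreover have "a + frac s *\<^sub>R d \<in> closed_segment a (a + d)"
      unfolding in_segment by (intro exI[of _ "frac s"]) (simp add: algebra_simps frac_ge_0 less_imp_le[OF frac_lt_1])
    ultimately show "x \<in> torus_proj ` closed_segment a (a + d)" by blast
  qed
qed

lemma proj_unit_edge: "torus_proj ` unit_edge p i = circle p i"
  unfolding unit_edge_def by (rule proj_closed_segment_geodesic) simp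

lemma mem_circle: "x \<in> circle p i \<longleftrightarrow> x \<in> range torus_proj \<and> (\<forall>j. j \<noteq> i \<longrightarrow> (x - p) $ j \<in> \<int>)"
proof
  assume "x \<in> circle p i"
  then obtain s where s: "x = torus_proj (p + s *\<^sub>R axis i 1)" by (auto simp: geodesic_def)
  have "(x - p) $ j \<in> \<int>" if "j \<noteq> i" for j
    using torus_proj_component[of "p + s *\<^sub>R axis i 1" j] that by (simp add: s axis_def)
  then show "x \<in> range torus_proj \<and> (\<forall>j. j \<noteq> i \<longrightarrow> (x - p) $ j \<in> \<int>)" using s by blast
next
  assume x: "x \<in> range torus_proj \<and> (\<forall>j. j \<noteq> i \<longrightarrow> (x - p) $ j \<in> \<int>)"
  have "torus_proj x = torus_proj (p + (x $ i - p $ i) *\<^sub>R axis i 1)"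
    using x by (auto simp: torus_proj_eq_iff axis_def)
  then have "x = torus_proj (p + (x $ i - p $ i) *\<^sub>R axis i 1)" using x torus_proj_range_id by metis
  then show "x \<in> circle p i" by (auto simp: geodesic_def)
qed

lemma nodes_grid_knot: "nodes (grid_knot P) = torus_proj ` P"
  by (auto simp: standard_knot_def nodes_def grid_def grid_nodes_def)

lemma edges_grid_knot: "edges (grid_knot P) = {circle p i | p i. p \<in> P}"
proof -
  have "edges (grid_knot P) = (\<lambda>s. torus_proj ` s) ` {unit_edge v i | v i. v \<in> grid_nodes P}"
    by (simp add: standard_knot_def edges_def grid_def)
  also have "\<dots> = {torus_proj ` unit_edge v i | v i. v \<in> grid_nodes P}" by blast
  also have "\<dots> = {circle v i | v i. v \<in> grid_nodes P}" by (simp only: proj_unit_edge)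
  also have "\<dots> = {circle p i | p i. p \<in> P}"
  proof -
    have "\<exists>p\<in>P. circle v i = circle p i" if v: "v \<in> grid_nodes P" for v i
    proof -
      obtain p where "p \<in> P" "torus_proj v = torus_proj p" using v by (auto simp: grid_nodes_def)
      then show ?thesis using geodesic_cong by metis
    qed
    moreover have "p \<in> grid_nodes P" if "p \<in> P" for p using that by (rule self_in_grid_nodes)
    ultimately show ?thesis by (intro Collect_cong iffI; elim exE conjE) metis+
  qed
  finally show ?thesis .
qed

lemma Union_circles: "(\<Union>i. circle p i) = frame p \<inter> range torus_proj"
  unfolding set_eq_iff frame_def UN_iff mem_circle by blast

lemma body_grid_knot: "body (grid_knot P) = (\<Union>p\<in>P. frame p) \<inter> range torus_proj"
proof -
  have "body (grid_knot P) = (\<Union>p\<in>P. \<Union>i. circle p i)" unfolding body_def edges_grid_knot by blast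
  then show ?thesis by (simp add: Union_circles)
qed

lemma circle_Int_frame: "circle p i \<subseteq> frame p"
  using Union_circles[of p] by blast

lemma circles_meet: assumes "i \<noteq> j" shows "circle p i \<inter> circle p j \<subseteq> {torus_proj p}"
proof
  fix x assume x: "x \<in> circle p i \<inter> circle p j"
  have "(x - p) $ l \<in> \<int>" for l using x assms by (cases "l = i") (auto simp: mem_circle)
  then have "torus_proj x = torus_proj p" by (simp add: torus_proj_eq_iff)
  moreover have "x \<in> range torus_proj" using x by (auto simp: mem_circle)
  ultimately show "x \<in> {torus_proj p}" using torus_proj_range_id by (metis singletonI)
qed

text \<open>Each edge is represented by the unit edge based at the point of \<open>P\<close> whose circle it
  is; its two endpoints coincide in the torus.\<close>

lemma linear_graph_knot_grid_knot:
  assumes "finite P" "generic P" shows "linear_graph_knot (grid_knot P)"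
proof -
  have "\<forall>s\<in>edges (grid_knot P). \<exists>p i. p \<in> P \<and> s = circle p i" by (auto simp: edges_grid_knot)
  then obtain c k where ck: "\<And>s. s \<in> edges (grid_knot P) \<Longrightarrow> c s \<in> P" "\<And>s. s \<in> edges (grid_knot P) \<Longrightarrow> s = circle (c s) (k s)"
    by metis
  define a where "a = c" define b where "b s = c s + axis (k s) 1" for s
  have ab: "closed_segment (a s) (b s) = unit_edge (c s) (k s)" for s by (simp add: a_def b_def unit_edge_def)
  have b: "torus_proj (b s) = torus_proj (c s)" for s by (simp add: b_def)
  have "edges (grid_knot P) = (\<lambda>(p, i). circle p i) ` (P \<times> UNIV)" by (auto simp: edges_grid_knot)
  then have fin: "finite (edges (grid_knot P))" using assms by simp
  have 1: "{x, y} = {a s, b s}"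
    if h: "x \<in> unit_edge (c s) (k s)" "y \<in> unit_edge (c s) (k s)" "x \<noteq> y" "torus_proj x = torus_proj y" for s x y
  proof -
    let ?i = "k s"
    have x: "\<And>j. j \<noteq> ?i \<Longrightarrow> x $ j = c s $ j" "c s $ ?i \<le> x $ ?i" "x $ ?i \<le> c s $ ?i + 1"
      and y: "\<And>j. j \<noteq> ?i \<Longrightarrow> y $ j = c s $ j" "c s $ ?i \<le> y $ ?i" "y $ ?i \<le> c s $ ?i + 1"
      using that by (auto simp: mem_unit_edge)
    have ne: "x $ ?i \<noteq> y $ ?i" using x(1) y(1) that(3) by (metis vec_eq_iff)
    obtain m where m: "x $ ?i - y $ ?i = of_int m" using h(4) by (metis Ints_cases torus_proj_eq_iff vector_minus_component)
    have "m \<noteq> 0" "\<bar>of_int m\<bar> \<le> (1::real)" using m ne x y by (auto simp: abs_le_iff)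
    then have "m = 1 \<or> m = -1" by linarith
    then show ?thesis
    proof
      assume "m = 1"
      then have "x $ ?i = c s $ ?i + 1" "y $ ?i = c s $ ?i" using m x y by auto
      then have "x $ l = b s $ l" "y $ l = a s $ l" for l
        using x(1)[of l] y(1)[of l] by (cases "l = ?i"; simp add: a_def b_def axis_def)+
      then have "x = b s" "y = a s" by (simp_all add: vec_eq_iff)
      then show ?thesis by auto
    next
      assume "m = -1"
      then have "y $ ?i = c s $ ?i + 1" "x $ ?i = c s $ ?i" using m x y by auto
      then have "y $ l = b s $ l" "x $ l = a s $ l" for l
        using x(1)[of l] y(1)[of l] by (cases "l = ?i"; simp add: a_def b_def axis_def)+
      then have "y = b s" "x = a s" by (simp_all add: vec_eq_iff)
      then show ?thesis by auto
    qed
  qed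
  have 2: "s \<inter> s' \<subseteq> {torus_proj (c s)} \<inter> {torus_proj (c s')}"
    if "s \<in> edges (grid_knot P)" "s' \<in> edges (grid_knot P)" "s \<noteq> s'" for s s'
  proof (cases "c s = c s'")
    case True
    then have "k s \<noteq> k s'" using ck(2) that by metis
    then show ?thesis using circles_meet[of "k s" "k s'" "c s"] ck(2) that True by (metis Int_absorb)
  next
    case False
    then have "frame (c s) \<inter> frame (c s') = {}" using frame_disjoint assms(2) ck(1) that by blast
    then show ?thesis using circle_Int_frame ck(2) that by blast
  qed
  have "a s \<noteq> b s" for s by (auto simp: a_def b_def)
  then show ?thesis unfolding linear_graph_knot_def
    using fin assms(1) ck 1 2 ab b
    by (intro conjI exI[of _ a] exI[of _ b] ballI impI)
       (auto simp: nodes_grid_knot a_def proj_unit_edge)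
qed

lemma closedin_torus_frame: "closedin flat_torus (frame p \<inter> range torus_proj)"
  unfolding closedin_def topspace_flat_torus openin_flat_torus
proof (intro conjI)
  have "torus_proj -` (range torus_proj - frame p \<inter> range torus_proj) = - frame p"
    by (auto simp: mem_frame_proj) (metis mem_frame_proj)
  then show "open (torus_proj -` (range torus_proj - frame p \<inter> range torus_proj))"
    using closed_frame by (simp add: open_closed)
qed auto

lemma torus_proj_translation_image:
  "(\<lambda>x. torus_proj (x + \<delta>)) ` geodesic p d = geodesic (p + \<delta>) d"
proof -
  have "torus_proj (torus_proj (p + s *\<^sub>R d) + \<delta>) = torus_proj (p + \<delta> + s *\<^sub>R d)" for s
    unfolding torus_proj_add_proj by (simp add: algebra_simps)
  then show ?thesis by (simp add: geodesic_def image_image)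
qed

text \<open>The component of \<open>p\<close> is translated with constant velocity, so that \<open>p\<close>
  reaches \<open>g p\<close> at time 1. Since the floors of all differences stay fixed, the
  components remain disjoint.\<close>

locale straight_line_motion =
  fixes P :: "(real^3) set" and g :: "real^3 \<Rightarrow> real^3"
  assumes finite_P: "finite P" and generic_P: "generic P" and order: "preserves_order g P"
begin

definition displacement :: "real \<Rightarrow> real^3 \<Rightarrow> real^3" where
  "displacement t p = t *\<^sub>R (g p - p)"

definition config_at :: "real \<Rightarrow> (real^3) set" where
  "config_at t = (\<lambda>p. p + displacement t p) ` P"

text \<open>The component containing \<open>x\<close>, named by its point of \<open>P\<close>. The value is
  unspecified off the body of the grid.\<close>

definition centre :: "real^3 \<Rightarrow> real^3" where
  "centre x = (THE p. p \<in> P \<and> x \<in> frame p)"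

definition move :: "real \<Rightarrow> real^3 \<Rightarrow> real^3" where
  "move t x = x + displacement t (centre x)"

lemma preserves_order_displaced: "t \<in> {0..1} \<Longrightarrow> preserves_order (\<lambda>p. p + displacement t p) P"
  using preserves_order_interpolate[OF order] by (simp add: displacement_def)

lemma generic_config_at: "t \<in> {0..1} \<Longrightarrow> generic (config_at t)"
  unfolding config_at_def by (rule preserves_order_image_generic[OF preserves_order_displaced generic_P])

lemma finite_config_at: "finite (config_at t)"
  by (simp add: config_at_def finite_P)

lemma config_at_0: "config_at 0 = P" and config_at_1: "config_at 1 = g ` P"
  by (simp_all add: config_at_def displacement_def)

lemma centre_eq: "p \<in> P \<Longrightarrow> x \<in> frame p \<Longrightarrow> centre x = p"
  unfolding centre_def using frame_disjoint[OF generic_P] by (intro the_equality) blast+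

lemma move_eq: "p \<in> P \<Longrightarrow> x \<in> frame p \<Longrightarrow> move t x = x + displacement t p"
  by (simp add: move_def centre_eq)

lemma move_0: "move 0 x = x"
  by (simp add: move_def displacement_def)

lemma continuous_on_move: "continuous_on {0..1} (\<lambda>t. move t x)"
  unfolding move_def displacement_def by (intro continuous_intros)

lemma move_in_frame: "p \<in> P \<Longrightarrow> x \<in> frame p \<Longrightarrow> move t x \<in> frame (p + displacement t p)"
  by (simp add: move_eq) (simp add: frame_def)

lemma move_proj_inj:
  assumes t: "t \<in> {0..1}" and p: "p \<in> P" "x \<in> frame p" and q: "q \<in> P" "y \<in> frame q"
    and eq: "torus_proj (move t x) = torus_proj (move t y)"
  shows "p = q" "torus_proj x = torus_proj y"
proof -
  have "torus_proj (move t x) \<in> frame (p + displacement t p) \<inter> frame (q + displacement t q)"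
    using move_in_frame[OF p, of t] move_in_frame[OF q, of t] eq by (metis IntI mem_frame_proj)
  then show "p = q"
    using preserves_order_generic[OF preserves_order_displaced[OF t] generic_P p(1) q(1)] frame_disjoint_iff by blast
  then show "torus_proj x = torus_proj y" using eq move_eq p q by (simp add: torus_proj_eq_iff)
qed

end

lemma linearly_isotopic_if_order_equiv:
  assumes "finite P" "generic P" "order_equiv P Q"
  shows "linearly_isotopic (grid_knot P) (grid_knot Q)"
proof -
  obtain g where g: "preserves_order g P" "torus_proj ` g ` P = torus_proj ` Q"
    using assms(3) by (auto simp: order_equiv_def)
  interpret straight_line_motion P g by unfold_locales (use assms g in auto)
  define f where "f t x = torus_proj (move t x)" for t x
  have R0: "grid_knot (config_at 0) = grid_knot P" by (simp add: config_at_0)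
  have R1: "grid_knot (config_at 1) = grid_knot Q"
    using grid_cong[of "g ` P" Q] g(2) by (simp add: config_at_1)
  have f_eq: "f t x = torus_proj (x + displacement t p)" if "p \<in> P" "x \<in> frame p" for t p x
    using move_eq[OF that] by (simp add: f_def)
  have f_circle: "f t ` circle p i = circle (p + displacement t p) i" if "p \<in> P" for t p i
  proof -
    have "f t ` circle p i = (\<lambda>x. torus_proj (x + displacement t p)) ` circle p i"
      using f_eq[OF that] circle_Int_frame[of p i] by (intro image_cong) auto
    then show ?thesis by (simp add: torus_proj_translation_image)
  qed
  have nodes: "f t ` nodes (grid_knot P) = nodes (grid_knot (config_at t))" for t
  proof -
    have "f t (torus_proj p) = torus_proj (p + displacement t p)" if "p \<in> P" for p
      using f_eq[OF that, of "torus_proj p"] self_in_frame mem_frame_proj by (simp add: torus_proj_add_proj)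
    then show ?thesis by (simp add: nodes_grid_knot config_at_def image_image)
  qed
  have edges: "(\<lambda>s. f t ` s) ` edges (grid_knot P) = edges (grid_knot (config_at t))" for t
  proof -
    have "(\<lambda>s. f t ` s) ` edges (grid_knot P) = {f t ` circle p i | p i. p \<in> P}"
      unfolding edges_grid_knot by blast
    also have "\<dots> = {circle (p + displacement t p) i | p i. p \<in> P}"
      using f_circle by (intro Collect_cong) metis
    also have "\<dots> = edges (grid_knot (config_at t))" unfolding edges_grid_knot config_at_def by blast
    finally show ?thesis .
  qed
  have img: "f t ` body (grid_knot P) = body (grid_knot (config_at t))" for t
    unfolding body_def edges[symmetric] by blast
  have inj: "inj_on (f t) (body (grid_knot P))" if t: "t \<in> {0..1}" for t
  proof (rule inj_onI)
    fix x y assume "x \<in> body (grid_knot P)" "y \<in> body (grid_knot P)" and eq: "f t x = f t y"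
    then obtain p q where pq: "p \<in> P" "x \<in> frame p" "q \<in> P" "y \<in> frame q"
      and rng: "x \<in> range torus_proj" "y \<in> range torus_proj"
      unfolding body_grid_knot by blast
    have "torus_proj x = torus_proj y" using move_proj_inj(2)[OF t pq] eq by (simp add: f_def)
    then show "x = y" using rng torus_proj_range_id by metis
  qed
  have cont: "continuous_map (subtopology flat_torus (body (grid_knot P))) flat_torus (f t)" for t
  proof (rule pasting_lemma_closed[where I = P and T = "\<lambda>p. frame p \<inter> range torus_proj"
        and f = "\<lambda>p x. torus_proj (x + displacement t p)"])
    show "closedin (subtopology flat_torus (body (grid_knot P))) (frame p \<inter> range torus_proj)" if "p \<in> P" for p
      using closedin_torus_frame that
      by (intro closedin_subset_topspace) (auto simp: body_grid_knot)
    show "continuous_map (subtopology (subtopology flat_torus (body (grid_knot P))) (frame p \<inter> range torus_proj))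
           flat_torus (\<lambda>x. torus_proj (x + displacement t p))" for p
      by (intro continuous_map_from_subtopology continuous_map_torus_translation)
    show "torus_proj (x + displacement t p) = torus_proj (x + displacement t q)"
      if "p \<in> P" "q \<in> P" "x \<in> topspace (subtopology flat_torus (body (grid_knot P))) \<inter> (frame p \<inter> range torus_proj) \<inter> (frame q \<inter> range torus_proj)" for p q x
      using that frame_disjoint[OF assms(2)] by blast
    show "\<exists>p. p \<in> P \<and> x \<in> frame p \<inter> range torus_proj \<and> f t x = torus_proj (x + displacement t p)"
      if "x \<in> topspace (subtopology flat_torus (body (grid_knot P)))" for x
    proof -
      have "x \<in> body (grid_knot P)" using that by simp
      then obtain p where "p \<in> P" "x \<in> frame p" "x \<in> range torus_proj" unfolding body_grid_knot by blast
      then show ?thesis using f_eq by blast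
    qed
  qed (rule assms(1))
  have path: "continuous_map (top_of_set {0..1}) flat_torus (\<lambda>t. f t x)" for x
  proof -
    have "continuous_map (top_of_set {0..1}) euclidean (\<lambda>t. move t x)" by (simp add: continuous_on_move)
    from continuous_map_compose[OF this continuous_map_torus_proj] show ?thesis by (simp add: f_def o_def)
  qed
  have f0: "f 0 x = x" if "x \<in> body (grid_knot P)" for x
  proof -
    have "x \<in> range torus_proj" using that by (simp only: body_grid_knot IntD2)
    then show ?thesis unfolding f_def by (simp only: move_0 torus_proj_range_id)
  qed
  have "linear_graph_knot (grid_knot (config_at t))" if "t \<in> {0..1}" for t
    by (intro linear_graph_knot_grid_knot finite_config_at generic_config_at that)
  moreover have "bij_betw (f t) (body (grid_knot P)) (body (grid_knot (config_at t)))" if "t \<in> {0..1}" for t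
    using inj[OF that] img by (simp add: bij_betw_def)
  moreover have "continuous_map (subtopology flat_torus (body (grid_knot P)))
                   (subtopology flat_torus (body (grid_knot (config_at t)))) (f t)" for t
    using cont[of t] img[of t] by (auto simp: continuous_map_in_subtopology)
  ultimately show ?thesis unfolding linearly_isotopic_def
    using R0 R1 nodes edges f0 path
    by (intro exI[of _ "\<lambda>t. grid_knot (config_at t)"] exI[of _ f]) simp
qed

text \<open>A value strictly between those at \<open>0\<close> and at \<open>1/2\<close> is attained in both
  halves of the interval.\<close>

lemma no_injective_loop_in_reals:
  fixes h :: "real \<Rightarrow> real"
  assumes "continuous_on {0..1} h" "h 0 = h 1" "inj_on h {0..<1}"
  shows False
proof -
  have impossible: False if cont: "continuous_on {0..1} k" and k: "k 0 = k 1" "k 0 < k (1/2)" and inj: "inj_on k {0..<1}"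
    for k :: "real \<Rightarrow> real"
  proof -
    define y where "y = (k 0 + k (1/2)) / 2"
    have y: "k 0 < y" "y < k (1/2)" using k by (auto simp: y_def)
    have "\<exists>u. 0 \<le> u \<and> u \<le> 1/2 \<and> k u = y"
      by (rule IVT') (use y continuous_on_subset[OF cont] in auto)
    then obtain u where u: "0 \<le> u" "u \<le> 1/2" "k u = y" by blast
    have "\<exists>v. 1/2 \<le> v \<and> v \<le> 1 \<and> k v = y"
      by (rule IVT2') (use y k continuous_on_subset[OF cont] in auto)
    then obtain v where v: "1/2 \<le> v" "v \<le> 1" "k v = y" by blast
    have "v \<noteq> 1" using v(3) y(1) k(1) by fastforce
    then have "u = v" using u v inj_onD[OF inj, of u v] by simp
    then have "u = 1/2" using u v by simp
    then show False using u(3) y(2) by (metis less_irrefl)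
  qed
  have "h 0 \<noteq> h (1/2)" using inj_onD[OF assms(3), of 0 "1/2"] by auto
  then consider "h 0 < h (1/2)" | "h (1/2) < h 0" by linarith
  then show False
  proof cases
    case 1 then show False using impossible[OF assms(1,2)] assms(3) by blast
  next
    case 2
    show False
      by (rule impossible[of "\<lambda>u. - h u"])
         (use assms 2 in \<open>auto intro!: continuous_intros simp: inj_on_def\<close>)
  qed
qed

text \<open>If the endpoints were distinct in the torus, the segment would be a homeomorphic image of the unit
  interval, and the loop would become an injective loop in the real line.\<close>

lemma loop_in_torus_segment_closes:
  fixes c :: "real \<Rightarrow> real^3"
  assumes c: "continuous_map (top_of_set {0..1}) flat_torus c" "c 0 = c 1" "inj_on c {0..<1}"
    and img: "c ` {0..1} = torus_proj ` closed_segment a b" and "a \<noteq> b"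
    and ends: "\<And>x y. x \<in> closed_segment a b \<Longrightarrow> y \<in> closed_segment a b \<Longrightarrow> x \<noteq> y
                 \<Longrightarrow> torus_proj x = torus_proj y \<Longrightarrow> {x, y} = {a, b}"
  shows "torus_proj a = torus_proj b"
proof (rule ccontr)
  assume ne: "torus_proj a \<noteq> torus_proj b"
  define \<sigma> where "\<sigma> u = torus_proj (linepath a b u)" for u :: real
  have seg: "linepath a b ` {0..1} = closed_segment a b" by (metis path_image_def path_image_linepath)
  have img\<sigma>: "\<sigma> ` {0..1} = c ` {0..1}" unfolding img \<sigma>_def seg[symmetric] by (simp add: image_image)
  have inj\<sigma>: "inj_on \<sigma> {0..1}"
  proof (rule inj_onI)
    fix u v :: real assume uv: "u \<in> {0..1}" "v \<in> {0..1}" "\<sigma> u = \<sigma> v"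
    have "linepath a b u = linepath a b v"
    proof (rule ccontr)
      assume n: "linepath a b u \<noteq> linepath a b v"
      have "{linepath a b u, linepath a b v} = {a, b}"
        by (rule ends) (use uv n seg in \<open>auto simp: \<sigma>_def\<close>)
      then have "\<sigma> u = torus_proj a \<and> \<sigma> v = torus_proj b \<or> \<sigma> u = torus_proj b \<and> \<sigma> v = torus_proj a"
        by (auto simp: \<sigma>_def doubleton_eq_iff)
      then show False using uv(3) ne by auto
    qed
    moreover have "(u - v) *\<^sub>R (b - a) = linepath a b u - linepath a b v"
      by (simp add: linepath_def algebra_simps)
    ultimately show "u = v" using \<open>a \<noteq> b\<close> by simp
  qed
  have cont\<sigma>: "continuous_map (top_of_set {0..1}) flat_torus \<sigma>"
  proof -
    have "continuous_map (top_of_set {0..1}) euclidean (linepath a b)"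
      by (simp add: continuous_on_linepath)
    from continuous_map_compose[OF this continuous_map_torus_proj] show ?thesis by (simp add: \<sigma>_def[abs_def] o_def)
  qed
  have "embedding_map (top_of_set {0..1}) flat_torus \<sigma>"
    by (rule continuous_imp_embedding_map[OF cont\<sigma> _ Hausdorff_flat_torus])
       (use inj\<sigma> in \<open>auto simp: compact_space_subtopology\<close>)
  then have "homeomorphic_map (top_of_set {0..1}) (subtopology flat_torus (c ` {0..1})) \<sigma>"
    unfolding embedding_map_def using img\<sigma> by simp
  then obtain r where r: "homeomorphic_maps (top_of_set {0..1}) (subtopology flat_torus (c ` {0..1})) \<sigma> r"
    using homeomorphic_map_maps by blast
  have c': "continuous_map (top_of_set {0..1}) (subtopology flat_torus (c ` {0..1})) c"
    using c(1) by (simp add: continuous_map_in_subtopology)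
  have "continuous_map (subtopology flat_torus (c ` {0..1})) (top_of_set {0..1}) r"
    using r by (simp only: homeomorphic_maps_def)
  from continuous_map_compose[OF c' this]
  have "continuous_map (top_of_set {0..1}) (top_of_set {0..1}) (r \<circ> c)" .
  then have cont: "continuous_on {0..1} (r \<circ> c)" by (simp add: continuous_map_in_subtopology)
  have top: "topspace (subtopology flat_torus (c ` {0..1})) = c ` {0..1}"
    using continuous_map_image_subset_topspace[OF c(1)] by auto
  have r\<sigma>: "\<sigma> (r y) = y" if "y \<in> c ` {0..1}" for y
    using r that unfolding homeomorphic_maps_def top by blast
  show False
  proof (rule no_injective_loop_in_reals[OF cont])
    show "(r \<circ> c) 0 = (r \<circ> c) 1" using c(2) by simp
    show "inj_on (r \<circ> c) {0..<1}"
    proof (rule inj_onI)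
      fix u v :: real assume uv: "u \<in> {0..<1}" "v \<in> {0..<1}" "(r \<circ> c) u = (r \<circ> c) v"
      have "c u \<in> c ` {0..1}" "c v \<in> c ` {0..1}" using uv by auto
      then have "c u = c v" using r\<sigma> uv(3) by (metis comp_apply)
      then show "u = v" using c(3) uv by (auto dest: inj_onD)
    qed
  qed
qed

lemma not_all_multiples_integer:
  assumes "\<And>s::real. s * c \<in> \<int>" shows "c = 0"
proof (rule ccontr)
  assume "c \<noteq> 0"
  then have "(1/2::real) \<in> \<int>" using assms[of "1 / (2 * c)"] by simp
  then obtain k :: int where "(1/2::real) = of_int k" by (rule Ints_cases)
  then have "of_int (2 * k) = (1::real)" by simp
  then have "2 * k = 1" by (metis of_int_eq_1_iff)
  then show False by presburger
qed

text \<open>The integer characters that are constant along the direction \<open>d\<close>. They determine the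
  direction of a closed geodesic, and being a closed condition on points of the torus, they can be
  followed along an isotopy.\<close>

definition perp :: "real^3 \<Rightarrow> (real^3) set" where
  "perp d = {m \<in> integer_points. m \<bullet> d = 0}"

lemma integer_points_cross3:
  assumes "v \<in> integer_points" "w \<in> integer_points" shows "cross3 v w \<in> integer_points"
proof -
  have v: "v $ i \<in> \<int>" and w: "w $ i \<in> \<int>" for i using assms by (auto simp: integer_points_def)
  show ?thesis unfolding integer_points_def
    by (simp add: forall_3 cross3_def v w)
qed

text \<open>The vectors \<open>cross3 d w\<close> with integral \<open>w\<close> are in \<open>perp d\<close>.
  If they are orthogonal to \<open>e\<close> then \<open>cross3 e d = 0\<close>, so \<open>d\<close>
  is a multiple of \<open>e\<close>.\<close>

lemma perp_subset_imp_eq: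
  assumes "d \<in> integer_points" "e \<noteq> 0" "perp d \<subseteq> perp e" shows "perp d = perp e"
proof -
  have "cross3 e d \<bullet> axis i 1 = 0" for i
  proof -
    have "cross3 d (axis i 1) \<in> perp d"
      using integer_points_cross3[OF assms(1)] by (simp add: perp_def dot_cross_self)
    then have "cross3 d (axis i 1) \<bullet> e = 0" using assms(3) by (auto simp: perp_def)
    then show ?thesis using cross_triple[of e d "axis i 1"] by simp
  qed
  then have "cross3 e d = 0" by (simp add: inner_axis vec_eq_iff)
  then have eq: "(e \<bullet> d) *\<^sub>R e = (e \<bullet> e) *\<^sub>R d"
    using Lagrange[of e e d] by simp
  have "m \<in> perp d" if "m \<in> perp e" for m
  proof -
    have "(e \<bullet> e) * (m \<bullet> d) = m \<bullet> ((e \<bullet> e) *\<^sub>R d)" by simp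
    also have "\<dots> = (e \<bullet> d) * (m \<bullet> e)" unfolding eq[symmetric] by simp
    also have "\<dots> = 0" using that by (simp add: perp_def)
    finally show ?thesis using assms(2) that by (simp add: perp_def)
  qed
  then show ?thesis using assms(3) by blast
qed

text \<open>The set of times with a given value of \<open>perp (d t)\<close> is cut out by the equations
  \<open>character m (\<phi> t y) = character m (x t)\<close>, which are closed conditions. There
  are only countably many integer directions, so Sierpinski's theorem applies.\<close>

lemma geodesic_direction_constant:
  fixes \<phi> :: "real \<Rightarrow> 'a \<Rightarrow> real^3"
  assumes paths: "\<And>y. y \<in> S \<Longrightarrow> continuous_map (top_of_set {0..1}) flat_torus (\<lambda>t. \<phi> t y)"
    and base: "continuous_map (top_of_set {0..1}) flat_torus x"
    and geo: "\<And>t. t \<in> {0..1} \<Longrightarrow> \<phi> t ` S = geodesic (x t) (d t)"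
    and d: "\<And>t. t \<in> {0..1} \<Longrightarrow> d t \<in> integer_points" "\<And>t. t \<in> {0..1} \<Longrightarrow> d t \<noteq> 0"
    and t: "t \<in> {0..1}"
  shows "perp (d t) = perp (d 0)"
proof -
  define C where "C N = {t \<in> {0..1}. perp (d t) = N}" for N
  have char: "perp (d t) = N \<longleftrightarrow> (\<forall>y\<in>S. \<forall>m\<in>N. character m (\<phi> t y) - character m (x t) = 0)"
    if t: "t \<in> {0..1}" and N: "N \<in> (\<lambda>t. perp (d t)) ` {0..1}" for t N
  proof
    assume eq: "perp (d t) = N"
    show "\<forall>y\<in>S. \<forall>m\<in>N. character m (\<phi> t y) - character m (x t) = 0"
    proof (intro ballI)
      fix y m assume y: "y \<in> S" and m: "m \<in> N"
      obtain s where "\<phi> t y = torus_proj (x t + s *\<^sub>R d t)" using geo[OF t] y by (auto simp: geodesic_def)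
      moreover have "m \<in> integer_points" "m \<bullet> d t = 0" using m eq by (auto simp: perp_def)
      ultimately show "character m (\<phi> t y) - character m (x t) = 0"
        by (simp add: character_torus_proj) (simp add: character_def inner_add_right)
    qed
  next
    assume *: "\<forall>y\<in>S. \<forall>m\<in>N. character m (\<phi> t y) - character m (x t) = 0"
    obtain t' where t': "t' \<in> {0..1}" "N = perp (d t')" using N by blast
    have "m \<in> perp (d t)" if m: "m \<in> N" for m
    proof -
      have mi: "m \<in> integer_points" using m t' by (simp add: perp_def)
      have int: "m \<bullet> (s *\<^sub>R d t) \<in> \<int>" for s
      proof -
        obtain y where "y \<in> S" "torus_proj (x t + s *\<^sub>R d t) = \<phi> t y"
          using geo[OF t] unfolding geodesic_def by (metis imageE rangeI)
        then have "character m (torus_proj (x t + s *\<^sub>R d t)) = character m (x t)" using * m by auto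
        then have "character m (x t) * character m (s *\<^sub>R d t) = character m (x t)"
          unfolding character_torus_proj[OF mi] character_add .
        then have "character m (s *\<^sub>R d t) = 1" by (simp add: character_def)
        then show ?thesis by (simp only: character_eq_1_iff)
      qed
      have "m \<bullet> d t = 0" by (rule not_all_multiples_integer) (use int in simp)
      then show ?thesis using mi by (simp add: perp_def)
    qed
    then have "perp (d t') \<subseteq> perp (d t)" using t'(2) by blast
    then show "perp (d t) = N" using perp_subset_imp_eq[OF d(1)[OF t'(1)] d(2)[OF t]] t'(2) by simp
  qed
  have closed: "closed (C N)" if N: "N \<in> (\<lambda>t. perp (d t)) ` {0..1}" for N
  proof -
    have Nint: "m \<in> integer_points" if "m \<in> N" for m using N that by (auto simp: perp_def)
    have "C N = {0..1} \<inter> (\<Inter>y\<in>S. \<Inter>m\<in>N. {t \<in> {0..1}. character m (\<phi> t y) - character m (x t) = 0})"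
    proof -
      have "C N = {t \<in> {0..1}. \<forall>y\<in>S. \<forall>m\<in>N. character m (\<phi> t y) - character m (x t) = 0}"
        using char[OF _ N] unfolding C_def by blast
      then show ?thesis by auto
    qed
    moreover have "closed {t \<in> {0..1}. character m (\<phi> t y) - character m (x t) = 0}" if "y \<in> S" "m \<in> N" for y m
      using continuous_on_character_path[OF paths[OF that(1)] Nint[OF that(2)]]
        continuous_on_character_path[OF base Nint[OF that(2)]]
      by (intro continuous_closed_preimage_constant continuous_on_diff) auto
    ultimately show ?thesis by (auto intro!: closed_Int closed_INT)
  qed
  define \<U> where "\<U> = C ` (\<lambda>t. perp (d t)) ` {0..1}"
  have "\<U> = {{0..1}}"
  proof (rule real_Sierpinski_lemma)
    show "countable \<U>"
    proof -
      have "(\<lambda>t. perp (d t)) ` {0..1} \<subseteq> perp ` integer_points" using d(1) by blast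
      then show ?thesis unfolding \<U>_def
        using countable_integer_points by (metis countable_image countable_subset)
    qed
    show "pairwise disjnt \<U>" by (auto simp: \<U>_def pairwise_def disjnt_def C_def)
    show "closed A \<and> A \<noteq> {}" if "A \<in> \<U>" for A using that closed by (auto simp: \<U>_def C_def)
    show "\<Union>\<U> = {0..1}" by (auto simp: \<U>_def C_def)
  qed simp
  moreover have "C (perp (d 0)) \<in> \<U>" by (auto simp: \<U>_def)
  ultimately have "t \<in> C (perp (d 0))" using t by blast
  then show ?thesis by (simp add: C_def)
qed

text \<open>An edge circle of the initial knot has as image at each time a closed geodesic, whose direction is
  constant and hence remains that of the axis. If two nodes had at some time a common coordinate,
  two transverse circles through them would meet. So the lifted coordinates of the nodes never
  differ by an integer, and their floors are constant.\<close>

lemma order_equiv_if_linearly_isotopic: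
  assumes P: "finite P" "generic P" and iso: "linearly_isotopic (grid_knot P) (grid_knot Q)"
  shows "order_equiv P Q"
  using iso unfolding linearly_isotopic_def
proof (elim exE conjE, goal_cases)
  case (1 K f)
  let ?B = "body (grid_knot P)"
  note K = 1(1,2) and f0 = 1(4)[rule_format] and path = 1(5)[rule_format]
  have knot: "linear_graph_knot (K t)" and bij: "bij_betw (f t) ?B (body (K t))"
    and cont: "continuous_map (subtopology flat_torus ?B) (subtopology flat_torus (body (K t))) (f t)"
    and nodes: "f t ` nodes (grid_knot P) = nodes (K t)"
    and edges: "(\<lambda>s. f t ` s) ` edges (grid_knot P) = edges (K t)" if "t \<in> {0..1}" for t
    using 1(3)[rule_format, OF that] by simp_all
  have circB: "circle p i \<subseteq> ?B" if "p \<in> P" for p i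
    using that unfolding body_def edges_grid_knot by blast
  have projB: "torus_proj (p + s *\<^sub>R axis i 1) \<in> ?B" if "p \<in> P" for p i s
    using circB[OF that, of i] by (auto simp: geodesic_def)
  define x where "x p t = f t (torus_proj p)" for p t
  have pB: "torus_proj p \<in> ?B" if "p \<in> P" for p using projB[OF that, of 0] by simp
  have pcirc: "torus_proj p \<in> circle p i" for p i
    unfolding geodesic_def by (rule range_eqI[of _ _ 0]) simp
  have closed_up: "\<exists>d\<in>integer_points. d \<noteq> 0 \<and> f t ` circle p i = geodesic (x p t) d"
    if p: "p \<in> P" and t: "t \<in> {0..1}" for p i t
  proof -
    let ?e = "f t ` circle p i"
    have "?e \<in> edges (K t)" using edges[OF t] p unfolding edges_grid_knot by blast
    then obtain a b where ab: "a \<noteq> b" "?e = torus_proj ` closed_segment a b"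
      and ends: "\<And>y z. y \<in> closed_segment a b \<Longrightarrow> z \<in> closed_segment a b \<Longrightarrow> y \<noteq> z
          \<Longrightarrow> torus_proj y = torus_proj z \<Longrightarrow> {y, z} = {a, b}"
      using knot[OF t] unfolding linear_graph_knot_def by meson
    define c where "c u = f t (torus_proj (p + u *\<^sub>R axis i 1))" for u
    have "torus_proj a = torus_proj b"
    proof (rule loop_in_torus_segment_closes[of c])
      have 0: "continuous_map (top_of_set {0..1}) euclidean (\<lambda>u. p + u *\<^sub>R axis i 1)"
        by (auto intro!: continuous_intros)
      from continuous_map_compose[OF 0 continuous_map_torus_proj]
      have "continuous_map (top_of_set {0..1}) flat_torus (\<lambda>u. torus_proj (p + u *\<^sub>R axis i 1))"
        by (simp add: o_def)
      then have 1: "continuous_map (top_of_set {0..1}) (subtopology flat_torus ?B) (\<lambda>u. torus_proj (p + u *\<^sub>R axis i 1))"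
        using projB[OF p] by (auto simp: continuous_map_in_subtopology)
      have 2: "continuous_map (subtopology flat_torus ?B) flat_torus (f t)"
        using cont[OF t] by (simp add: continuous_map_in_subtopology)
      show "continuous_map (top_of_set {0..1}) flat_torus c"
        using continuous_map_compose[OF 1 2] by (simp add: c_def[abs_def] o_def)
      show "c 0 = c 1" by (simp add: c_def)
      show "inj_on c {0..<1}"
      proof (rule inj_onI)
        fix u v :: real assume uv: "u \<in> {0..<1}" "v \<in> {0..<1}" "c u = c v"
        have "torus_proj (p + u *\<^sub>R axis i 1) = torus_proj (p + v *\<^sub>R axis i 1)"
          using uv(3) projB[OF p] bij[OF t] unfolding c_def bij_betw_def by (blast dest: inj_onD)
        then have "(p + u *\<^sub>R axis i 1 - (p + v *\<^sub>R axis i 1)) $ i \<in> \<int>"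
          unfolding torus_proj_eq_iff by blast
        then have "u - v \<in> \<int>" by (simp add: axis_def)
        then have "frac u = frac v" by (simp add: frac_eq_iff_diff_Ints)
        then show "u = v" using uv by (simp add: frac_eq)
      qed
      have "c ` {0..1} = f t ` torus_proj ` closed_segment p (p + axis i 1)"
      proof -
        have "closed_segment p (p + axis i 1) = (\<lambda>u. p + u *\<^sub>R axis i 1) ` {0..1}"
          by (simp add: closed_segment_image_interval algebra_simps)
        then show ?thesis by (simp add: image_image c_def)
      qed
      then show "c ` {0..1} = torus_proj ` closed_segment a b"
        using ab(2) proj_unit_edge[of p i] by (simp add: unit_edge_def)
    qed (use ab ends in auto)
    then have d: "b - a \<in> integer_points" by (metis torus_proj_eq_iff_integer)
    have "?e = geodesic a (b - a)" using proj_closed_segment_geodesic[OF d, of a] ab(2) by simp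
    moreover have "x p t \<in> ?e" unfolding x_def using pcirc by blast
    ultimately have "?e = geodesic (x p t) (b - a)" using geodesic_rebase by metis
    then show ?thesis using d ab(1) by (intro bexI[of _ "b - a"]) auto
  qed
  have circles: "f t ` circle p i = circle (x p t) i" if p: "p \<in> P" and t: "t \<in> {0..1}" for p i t
  proof -
    obtain d where d: "\<And>t. t \<in> {0..1} \<Longrightarrow> d t \<in> integer_points" "\<And>t. t \<in> {0..1} \<Longrightarrow> d t \<noteq> 0"
      and geo: "\<And>t. t \<in> {0..1} \<Longrightarrow> f t ` circle p i = geodesic (x p t) (d t)"
      using closed_up[OF p, of _ i] by metis
    have perp: "perp (d t) = perp (d 0)"
      by (rule geodesic_direction_constant[OF _ _ geo d t])
         (use path circB[OF p] pB[OF p] in \<open>auto simp: x_def\<close>)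
    have "f 0 ` circle p i = circle p i" using f0 circB[OF p, of i] by (force simp: image_iff)
    then have g0: "geodesic (torus_proj p) (d 0) = circle p i"
      using geo[of 0] f0[OF pB[OF p]] by (simp add: x_def)
    have "d 0 $ j = 0" if j: "j \<noteq> i" for j
    proof (rule not_all_multiples_integer)
      fix s
      have "torus_proj (torus_proj p + s *\<^sub>R d 0) \<in> geodesic (torus_proj p) (d 0)"
        by (auto simp: geodesic_def)
      then have "torus_proj (torus_proj p + s *\<^sub>R d 0) \<in> circle p i" by (simp only: g0)
      then have "(torus_proj (p + s *\<^sub>R d 0) - p) $ j \<in> \<int>"
        using j unfolding torus_proj_add_proj mem_circle by blast
      from Ints_diff[OF this torus_proj_component[of "p + s *\<^sub>R d 0" j]] show "s * d 0 $ j \<in> \<int>" by simp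
    qed
    then have "axis j 1 \<in> perp (d 0)" if "j \<noteq> i" for j using that by (simp add: perp_def inner_axis')
    then have "axis j 1 \<in> perp (d t)" if "j \<noteq> i" for j using that perp by simp
    then have "d t $ j = 0" if "j \<noteq> i" for j using that by (simp add: perp_def inner_axis')
    then have eq: "d t = d t $ i *\<^sub>R axis i 1" by (auto simp: vec_eq_iff axis_def)
    then have "d t $ i \<noteq> 0" using d(2)[OF t] by auto
    then show ?thesis using geo[OF t] geodesic_scale[of "d t $ i" "x p t" "axis i 1"] eq by simp
  qed
  have apart: "(x p t - x q t) $ i \<notin> \<int>" if p: "p \<in> P" and q: "q \<in> P" and pq: "p \<noteq> q" and t: "t \<in> {0..1}" for p q i t
  proof
    assume int: "(x p t - x q t) $ i \<in> \<int>"
    obtain j k :: 3 where jk: "j \<noteq> i" "k \<noteq> i" "j \<noteq> k" "UNIV = {i, j, k}" by (rule other_two_indices)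
    (* A point common to the circle through x p t in direction j and to the one through x q t in direction k. *)
    define z where "z = (\<chi> l. if l = j then x q t $ j else x p t $ l)"
    have comp: "(torus_proj z - w) $ l \<in> \<int>" if "(z - w) $ l \<in> \<int>" for w l
      using Ints_add[OF torus_proj_component[of z l] that] by simp
    have "torus_proj z \<in> circle (x p t) j"
      unfolding mem_circle by (intro conjI allI impI rangeI comp) (simp add: z_def)
    moreover have "torus_proj z \<in> circle (x q t) k"
      unfolding mem_circle
    proof (intro conjI allI impI)
      fix l assume "l \<noteq> k"
      then have "l = i \<or> l = j" using index_cases[OF jk(1-3)] by blast
      then show "(torus_proj z - x q t) $ l \<in> \<int>"
        using int jk by (intro comp) (auto simp: z_def)
    qed simp
    ultimately obtain u v where uv: "u \<in> circle p j" "v \<in> circle q k" "f t u = f t v"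
      unfolding circles[OF p t, symmetric] circles[OF q t, symmetric] by (metis imageE)
    have "u \<in> ?B" "v \<in> ?B" using circB p q uv by blast+
    then have "u = v" using uv(3) bij[OF t] unfolding bij_betw_def by (blast dest: inj_onD)
    then show False using uv circle_Int_frame frame_disjoint[OF P(2) p q pq] by blast
  qed
  have "\<exists>\<xi>. \<xi> 0 = p \<and> (\<forall>t\<in>{0..1}. torus_proj (\<xi> t) = x p t) \<and> (\<forall>i. continuous_on {0..1} (\<lambda>t. \<xi> t $ i))"
    if p: "p \<in> P" for p
  proof -
    have "continuous_map (top_of_set {0..1}) flat_torus (x p)" using path[OF pB[OF p]] by (simp add: x_def[abs_def])
    moreover have "torus_proj p = x p 0" using f0[OF pB[OF p]] by (simp add: x_def)
    ultimately show ?thesis by (rule lift_torus_path) blast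
  qed
  then obtain \<xi> where \<xi>: "\<And>p. p \<in> P \<Longrightarrow> \<xi> p 0 = p" "\<And>p t. p \<in> P \<Longrightarrow> t \<in> {0..1} \<Longrightarrow> torus_proj (\<xi> p t) = x p t"
    "\<And>p i. p \<in> P \<Longrightarrow> continuous_on {0..1} (\<lambda>t. \<xi> p t $ i)" by metis
  have "preserves_order (\<lambda>p. \<xi> p 1) P" unfolding preserves_order_def
  proof (intro ballI allI)
    fix p q i assume pq: "p \<in> P" "q \<in> P"
    show "\<lfloor>(\<xi> p 1 - \<xi> q 1) $ i\<rfloor> = \<lfloor>(p - q) $ i\<rfloor>"
    proof (cases "p = q")
      case False
      have "\<lfloor>(\<xi> p 0 - \<xi> q 0) $ i\<rfloor> = \<lfloor>(\<xi> p 1 - \<xi> q 1) $ i\<rfloor>"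
      proof (rule floor_diff_constant)
        show "continuous_on {0..1} (\<lambda>t. (\<xi> p t - \<xi> q t) $ i)"
          using \<xi>(3) pq by (auto intro!: continuous_on_diff)
        fix t :: real assume t: "t \<in> {0..1}"
        show "(\<xi> p t - \<xi> q t) $ i \<notin> \<int>"
        proof
          assume a: "(\<xi> p t - \<xi> q t) $ i \<in> \<int>"
          have "x p t = torus_proj (\<xi> p t)" "x q t = torus_proj (\<xi> q t)" using \<xi>(2) pq t by simp_all
          then have "(x p t - \<xi> p t) $ i \<in> \<int>" "(x q t - \<xi> q t) $ i \<in> \<int>" using torus_proj_component by metis+
          from Ints_add[OF Ints_diff[OF this] a] show False using apart[OF pq False t, of i] by simp
        qed
      qed
      then show ?thesis using \<xi>(1) pq by simp
    qed simp
  qed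
  moreover have "torus_proj ` (\<lambda>p. \<xi> p 1) ` P = torus_proj ` Q"
  proof -
    have "torus_proj ` (\<lambda>p. \<xi> p 1) ` P = f 1 ` torus_proj ` P"
      using \<xi>(2)[of _ 1] by (simp add: image_image x_def)
    also have "\<dots> = torus_proj ` Q" using nodes[of 1] K(2) by (simp add: nodes_grid_knot)
    finally show ?thesis .
  qed
  ultimately show ?case unfolding order_equiv_def by blast
qed

section \<open>Linear images of grids and paths of matrices\<close>

definition map_net :: "real^3^3 \<Rightarrow> net \<Rightarrow> net" where
  "map_net A G = ((*v) A ` nodes G, (\<lambda>s. (*v) A ` s) ` edges G)"

lemma nodes_map_net [simp]: "nodes (map_net A G) = (*v) A ` nodes G"
  and edges_map_net: "edges (map_net A G) = (\<lambda>s. (*v) A ` s) ` edges G"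
  by (simp_all add: map_net_def nodes_def edges_def)

lemma body_map_net: "body (map_net A G) = (*v) A ` body G"
  unfolding body_def edges_map_net by blast

lemma linear_image_closed_segment: "(*v) A ` closed_segment p q = closed_segment (A *v p) (A *v (q::real^3))"
  by (rule closed_segment_linear_image[symmetric]) simp

lemma inj_matrix: "det (A::real^3^3) \<noteq> 0 \<Longrightarrow> inj ((*v) A)"
  by (simp add: inj_matrix_vector_mult invertible_det_nz)

text \<open>A basis is given by the rows of a matrix, so the image of the standard basis under
  \<open>A\<close> is \<open>transpose A\<close>.\<close>

lemma lattice_of_transpose: "lattice_of (transpose A) = (*v) A ` integer_points"
proof -
  have "(\<Sum>i\<in>UNIV. real_of_int (k i) *\<^sub>R (transpose A $ i))
      = A *v (\<Sum>i\<in>UNIV. real_of_int (k i) *\<^sub>R ((mat 1 :: real^3^3) $ i))" for k :: "3 \<Rightarrow> int"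
    by (simp add: vec_eq_iff transpose_def mat_def matrix_vector_mult_def if_distrib mult.commute cong: if_cong)
  then show ?thesis by (auto simp: lattice_of_def simp flip: lattice_of_mat_1)
qed

lemma periodicity_basis_map_net:
  assumes A: "det A \<noteq> 0" and per: "periodicity_basis (mat 1) G"
  shows "periodicity_basis (transpose A) (map_net A G)"
proof -
  let ?Z = integer_points
  have tr: "(\<lambda>p. A *v w + p) ` (*v) A ` s = (*v) A ` (\<lambda>p. w + p) ` s" for w s
    by (simp add: image_image matrix_vector_right_distrib)
  have nod: "(\<lambda>p. w + p) ` nodes G = nodes G" and edg: "(\<lambda>s. (\<lambda>p. w + p) ` s) ` edges G = edges G" if "w \<in> ?Z" for w
    using per that by (simp_all add: periodicity_basis_def lattice_of_mat_1)
  have f1: "finite ((\<lambda>p. {v + p | v. v \<in> ?Z}) ` nodes G)" and f2: "finite ((\<lambda>s. {(\<lambda>p. v + p) ` s | v. v \<in> ?Z}) ` edges G)"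
    using per by (simp_all add: periodicity_basis_def lattice_of_mat_1)
  have "(\<lambda>p. v + p) ` nodes (map_net A G) = nodes (map_net A G)" if v: "v \<in> lattice_of (transpose A)" for v
  proof -
    obtain w where w: "w \<in> ?Z" "v = A *v w" using v by (auto simp: lattice_of_transpose)
    show ?thesis by (simp only: nodes_map_net w(2) tr nod[OF w(1)])
  qed
  moreover have "(\<lambda>s. (\<lambda>p. v + p) ` s) ` edges (map_net A G) = edges (map_net A G)" if v: "v \<in> lattice_of (transpose A)" for v
  proof -
    obtain w where w: "w \<in> ?Z" "v = A *v w" using v by (auto simp: lattice_of_transpose)
    have "(\<lambda>s. (\<lambda>p. v + p) ` s) ` edges (map_net A G) = (\<lambda>s. (*v) A ` s) ` (\<lambda>s. (\<lambda>p. w + p) ` s) ` edges G"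
      unfolding edges_map_net image_image[of _ "\<lambda>s. (*v) A ` s"] image_image[of "\<lambda>s. (*v) A ` s"] w(2) tr ..
    then show ?thesis by (simp only: edg[OF w(1)] edges_map_net)
  qed
  moreover have "finite ((\<lambda>p. {v + p | v. v \<in> lattice_of (transpose A)}) ` nodes (map_net A G))"
  proof -
    have "{v + A *v p | v. v \<in> lattice_of (transpose A)} = (*v) A ` {v + p | v. v \<in> ?Z}" for p
    proof -
      have "{v + A *v p | v. v \<in> lattice_of (transpose A)} = {A *v w + A *v p | w. w \<in> ?Z}"
        unfolding lattice_of_transpose by blast
      also have "\<dots> = {A *v (w + p) | w. w \<in> ?Z}" by (simp only: matrix_vector_right_distrib)
      finally show ?thesis by (simp only: setcompr_eq_image image_image)
    qed
    then have "(\<lambda>p. {v + p | v. v \<in> lattice_of (transpose A)}) ` nodes (map_net A G)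
        = (\<lambda>s. (*v) A ` s) ` (\<lambda>p. {v + p | v. v \<in> ?Z}) ` nodes G"
      by (simp add: image_image)
    then show ?thesis using f1 by simp
  qed
  moreover have "finite ((\<lambda>s. {(\<lambda>p. v + p) ` s | v. v \<in> lattice_of (transpose A)}) ` edges (map_net A G))"
  proof -
    have "{(\<lambda>p. v + p) ` (*v) A ` s | v. v \<in> lattice_of (transpose A)} = (\<lambda>s. (*v) A ` s) ` {(\<lambda>p. v + p) ` s | v. v \<in> ?Z}" for s
    proof -
      have "{(\<lambda>p. v + p) ` (*v) A ` s | v. v \<in> lattice_of (transpose A)} = {(\<lambda>p. A *v w + p) ` (*v) A ` s | w. w \<in> ?Z}"
        unfolding lattice_of_transpose by blast
      also have "\<dots> = {(*v) A ` (\<lambda>p. w + p) ` s | w. w \<in> ?Z}" by (simp only: tr)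
      finally show ?thesis by (simp only: setcompr_eq_image image_image)
    qed
    then have "(\<lambda>s. {(\<lambda>p. v + p) ` s | v. v \<in> lattice_of (transpose A)}) ` edges (map_net A G)
        = (\<lambda>S. (\<lambda>s. (*v) A ` s) ` S) ` (\<lambda>s. {(\<lambda>p. v + p) ` s | v. v \<in> ?Z}) ` edges G"
      by (simp only: edges_map_net image_image)
    then show ?thesis using f2 by simp
  qed
  moreover have "is_basis (transpose A)" using A by (intro is_basis_det) (simp add: det_transpose)
  ultimately show ?thesis unfolding periodicity_basis_def by blast
qed

lemma linear_3periodic_net_map_net:
  assumes A: "det A \<noteq> 0" and per: "periodicity_basis (mat 1) G" and G: "linear_3periodic_net G"
  shows "linear_3periodic_net (map_net A G)"
proof -
  note inj = inj_matrix[OF A]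
  have seg: "\<exists>p q. p \<noteq> q \<and> s = closed_segment p q" if "s \<in> edges G" for s
    using G that by (auto simp: linear_3periodic_net_def is_segment_def)
  have ends: "endpoints ((*v) A ` s) = (*v) A ` endpoints s" if s: "s \<in> edges G" for s
  proof -
    obtain p q where "s = closed_segment p q" using seg[OF s] by blast
    then show ?thesis by (simp add: linear_image_closed_segment endpoints_closed_segment)
  qed
  have "is_segment ((*v) A ` s)" if s: "s \<in> edges G" for s
  proof -
    obtain p q where pq: "p \<noteq> q" "s = closed_segment p q" using seg[OF s] by blast
    then have "A *v p \<noteq> A *v q" using inj by (auto dest: injD)
    then show ?thesis using pq by (auto simp: linear_image_closed_segment is_segment_def)
  qed
  moreover have "(*v) A ` s \<inter> (*v) A ` s' \<subseteq> endpoints ((*v) A ` s) \<inter> endpoints ((*v) A ` s')"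
    if "s \<in> edges G" "s' \<in> edges G" "(*v) A ` s \<noteq> (*v) A ` s'" for s s'
  proof -
    have "s \<inter> s' \<subseteq> endpoints s \<inter> endpoints s'" using G that unfolding linear_3periodic_net_def by blast
    then show ?thesis unfolding ends[OF that(1)] ends[OF that(2)] image_Int[OF inj, symmetric] by blast
  qed
  moreover have "nodes (map_net A G) = \<Union>(endpoints ` edges (map_net A G))"
  proof -
    have "nodes G = \<Union>(endpoints ` edges G)" using G by (simp add: linear_3periodic_net_def)
    then show ?thesis using ends by (auto simp: edges_map_net)
  qed
  moreover have "countable (edges (map_net A G))" using G by (simp add: linear_3periodic_net_def edges_map_net)
  ultimately show ?thesis unfolding linear_3periodic_net_def
    using periodicity_basis_map_net[OF A per] by (auto simp: edges_map_net)
qed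

lemma rotate_grid_nodes:
  assumes X: "X \<in> integral_rotations" shows "(*v) X ` grid_nodes P = grid_nodes ((*v) X ` P)"
proof -
  have sub: "(*v) Y ` grid_nodes R \<subseteq> grid_nodes ((*v) Y ` R)" if "Y \<in> integral_rotations" for Y R
  proof
    fix y assume "y \<in> (*v) Y ` grid_nodes R"
    then obtain x r where "y = Y *v x" "r \<in> R" "torus_proj x = torus_proj r" by (auto simp: grid_nodes_def)
    then have "torus_proj y = torus_proj (Y *v r)" "Y *v r \<in> (*v) Y ` R"
      using rotation_torus_proj_cong[OF that] by blast+
    then show "y \<in> grid_nodes ((*v) Y ` R)" unfolding grid_nodes_def by blast
  qed
  have "grid_nodes ((*v) X ` P) = (*v) X ` (*v) (transpose X) ` grid_nodes ((*v) X ` P)"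
    by (simp add: image_image rotation_inverse[OF X])
  also have "\<dots> \<subseteq> (*v) X ` grid_nodes ((*v) (transpose X) ` (*v) X ` P)"
    using sub[OF integral_rotations_transpose[OF X]] by blast
  also have "\<dots> = (*v) X ` grid_nodes P" by (simp add: image_image rotation_inverse[OF X])
  finally show ?thesis using sub[OF X] by blast
qed

text \<open>The image of an edge is a unit segment in an axis direction, possibly traversed backwards; it is
  then based at its other endpoint. Applying this to the inverse rotation shows that all edges are
  obtained.\<close>

lemma map_net_grid_rotation:
  assumes X: "X \<in> integral_rotations" shows "map_net X (grid P) = grid ((*v) X ` P)"
proof -
  have sub: "(*v) Y ` unit_edge v i \<in> edges (grid ((*v) Y ` R))"
    if Y: "Y \<in> integral_rotations" and v: "v \<in> grid_nodes R" for Y R v i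
  proof -
    have Yv: "Y *v v \<in> grid_nodes ((*v) Y ` R)" using rotate_grid_nodes[OF Y, of R] v by blast
    obtain j s where js: "s = 1 \<or> s = -1" "Y *v axis i 1 = s *\<^sub>R axis j 1" using rotation_axis[OF Y] by metis
    have img: "(*v) Y ` unit_edge v i = closed_segment (Y *v v) (Y *v v + s *\<^sub>R axis j 1)"
      by (simp add: unit_edge_def linear_image_closed_segment matrix_vector_right_distrib js(2))
    from js(1) show ?thesis
    proof
      assume "s = 1"
      then have "(*v) Y ` unit_edge v i = unit_edge (Y *v v) j" unfolding img by (simp add: unit_edge_def)
      then show ?thesis using Yv by (auto simp: edges_grid)
    next
      assume "s = -1"
      then have "(*v) Y ` unit_edge v i = unit_edge (Y *v v + - axis j 1) j"
        unfolding img by (simp add: unit_edge_def closed_segment_commute)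
      moreover have "Y *v v + - axis j 1 \<in> grid_nodes ((*v) Y ` R)"
        using grid_nodes_add[of "- axis j 1"] Yv integer_points_minus[OF integer_points_axis] by blast
      ultimately show ?thesis unfolding edges_grid by blast
    qed
  qed
  have "edges (map_net X (grid P)) = edges (grid ((*v) X ` P))"
  proof
    show "edges (map_net X (grid P)) \<subseteq> edges (grid ((*v) X ` P))"
      using sub[OF X] by (auto simp: edges_map_net edges_grid[of P])
    show "edges (grid ((*v) X ` P)) \<subseteq> edges (map_net X (grid P))"
    proof
      fix e assume "e \<in> edges (grid ((*v) X ` P))"
      then obtain w j where w: "w \<in> grid_nodes ((*v) X ` P)" "e = unit_edge w j" by (auto simp: edges_grid)
      have "(*v) (transpose X) ` e \<in> edges (grid ((*v) (transpose X) ` (*v) X ` P))"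
        using sub[OF integral_rotations_transpose[OF X] w(1)] w(2) by simp
      then have "(*v) (transpose X) ` e \<in> edges (grid P)" by (simp add: image_image rotation_inverse[OF X])
      moreover have "e = (*v) X ` (*v) (transpose X) ` e" by (simp add: image_image rotation_inverse[OF X])
      ultimately show "e \<in> edges (map_net X (grid P))" unfolding edges_map_net by blast
    qed
  qed
  moreover have "nodes (map_net X (grid P)) = nodes (grid ((*v) X ` P))"
    using rotate_grid_nodes[OF X] by simp
  ultimately show ?thesis by (metis edges_def nodes_def prod.collapse)
qed

lemma grid_knot_rotation:
  assumes X: "X \<in> integral_rotations"
  shows "(torus_map X ` nodes (grid_knot P), (\<lambda>s. torus_map X ` s) ` edges (grid_knot P)) = grid_knot ((*v) X ` P)"
proof -
  have tm: "torus_map X (torus_proj x) = torus_proj (X *v x)" for x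
    unfolding torus_map_def by (rule rotation_torus_proj_cong[OF X]) simp
  have "grid_knot ((*v) X ` P) = standard_knot (map_net X (grid P))" by (simp only: map_net_grid_rotation[OF X])
  also have "\<dots> = (torus_map X ` nodes (grid_knot P), (\<lambda>s. torus_map X ` s) ` edges (grid_knot P))"
    by (simp add: standard_knot_def nodes_def edges_def map_net_def image_image tm)
  finally show ?thesis by simp
qed

text \<open>The matrices joined to the identity by a path in the group of matrices with positive determinant.\<close>

definition in_identity_component :: "real^3^3 \<Rightarrow> bool" where
  "in_identity_component X \<longleftrightarrow> (\<exists>A. continuous_on {0..1::real} A \<and> A 0 = mat 1 \<and> A 1 = X \<and> (\<forall>t\<in>{0..1}. det (A t) > 0))"

lemma continuous_on_matrix_mult:
  fixes A B :: "real \<Rightarrow> real^3^3"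
  assumes "continuous_on S A" "continuous_on S B" shows "continuous_on S (\<lambda>t. A t ** B t)"
  unfolding matrix_matrix_mult_def by (intro continuous_intros assms)

lemma continuous_on_matrix_vector_mult:
  fixes A :: "real \<Rightarrow> real^3^3"
  assumes "continuous_on S A" "continuous_on S v" shows "continuous_on S (\<lambda>t. A t *v v t)"
  unfolding matrix_vector_mult_def by (intro continuous_intros assms)

lemma in_identity_component_mult:
  assumes "in_identity_component X" "in_identity_component Y" shows "in_identity_component (X ** Y)"
proof -
  obtain A B where A: "continuous_on {0..1::real} A" "A 0 = mat 1" "A 1 = X" "\<And>t. t \<in> {0..1} \<Longrightarrow> det (A t) > 0"
    and B: "continuous_on {0..1::real} B" "B 0 = mat 1" "B 1 = Y" "\<And>t. t \<in> {0..1} \<Longrightarrow> det (B t) > 0"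
    using assms unfolding in_identity_component_def by metis
  show ?thesis unfolding in_identity_component_def
    by (intro exI[of _ "\<lambda>t. A t ** B t"] conjI ballI continuous_on_matrix_mult A(1) B(1))
       (simp_all add: A B det_mul)
qed

text \<open>A rotation maps the cross product of two axes to the cross product of their images. So its
  cofactors are its entries.\<close>

lemma rotation_principal_minors:
  assumes "rotation_matrix (X :: real^3^3)"
  shows "X$1$1 * X$2$2 - X$2$1 * X$1$2 = X$3$3" "X$2$2 * X$3$3 - X$3$2 * X$2$3 = X$1$1"
    "X$3$3 * X$1$1 - X$1$3 * X$3$1 = X$2$2"
proof -
  have c: "(X *v axis j 1) $ i = X $ i $ j" for i j by (simp add: matrix_vector_mult_basis column_def)
  have "cross3 (X *v axis 1 1) (X *v axis 2 1) = X *v axis 3 1" "cross3 (X *v axis 2 1) (X *v axis 3 1) = X *v axis 1 1"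
    "cross3 (X *v axis 3 1) (X *v axis 1 1) = X *v axis 2 1"
    by (simp_all add: cross_rotation_matrix[OF assms] cross_basis)
  then have "cross3 (X *v axis 1 1) (X *v axis 2 1) $ 3 = X$3$3" "cross3 (X *v axis 2 1) (X *v axis 3 1) $ 1 = X$1$1"
    "cross3 (X *v axis 3 1) (X *v axis 1 1) $ 2 = X$2$2" by (simp_all add: c)
  then show "X$1$1 * X$2$2 - X$2$1 * X$1$2 = X$3$3" "X$2$2 * X$3$3 - X$3$2 * X$2$3 = X$1$1"
    "X$3$3 * X$1$1 - X$1$3 * X$3$1 = X$2$2" by (simp_all add: cross_components c mult.commute)
qed

text \<open>On the segment from the identity to \<open>X\<close> the determinant is \<open>1 + (\<tau> - 3) t
  (1 - t)\<close> where \<open>\<tau>\<close> is the trace of \<open>X\<close>, and \<open>t (1 -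
  t)\<close> is at most \<open>1/4\<close>.\<close>

lemma in_identity_component_trace:
  assumes rot: "rotation_matrix (X :: real^3^3)" and tr: "X$1$1 + X$2$2 + X$3$3 \<ge> 0"
  shows "in_identity_component X"
proof -
  define A where "A t = (1 - t) *\<^sub>R mat 1 + t *\<^sub>R X" for t :: real
  have comp: "A t $ i $ j = (if i = j then 1 - t else 0) + t * X $ i $ j" for t i j by (simp add: A_def mat_def)
  have "det (A t) > 0" if t: "t \<in> {0..1}" for t
  proof -
    let ?\<tau> = "X$1$1 + X$2$2 + X$3$3"
    let ?m = "(X$1$1 * X$2$2 - X$2$1 * X$1$2) + (X$2$2 * X$3$3 - X$3$2 * X$2$3) + (X$3$3 * X$1$1 - X$1$3 * X$3$1)"
    have "det (A t) = (1-t)^3 + (1-t)^2 * t * ?\<tau> + (1-t) * t^2 * ?m + t^3 * det X"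
      unfolding det_3 comp by (simp add: algebra_simps power2_eq_square power3_eq_cube)
    also have "\<dots> = (1-t)^3 + (1-t)^2 * t * ?\<tau> + (1-t) * t^2 * ?\<tau> + t^3"
      using rotation_principal_minors[OF rot] rot by (simp add: rotation_matrix_def algebra_simps)
    also have "\<dots> = (1 - 3 * (t * (1 - t))) + ?\<tau> * (t * (1 - t))"
      by (simp add: algebra_simps power2_eq_square power3_eq_cube)
    also have "\<dots> > 0"
    proof -
      have "0 \<le> (2 * t - 1)\<^sup>2" by simp
      then have "t * (1 - t) \<le> 1/4" by (simp add: power2_eq_square algebra_simps)
      moreover have "?\<tau> * (t * (1 - t)) \<ge> 0" using tr t by simp
      ultimately show ?thesis by linarith
    qed
    finally show ?thesis .
  qed
  moreover have "continuous_on {0..1} A" unfolding A_def[abs_def] by (intro continuous_intros)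
  moreover have "A 0 = mat 1" "A 1 = X" by (simp_all add: A_def)
  ultimately show ?thesis unfolding in_identity_component_def by blast
qed

text \<open>The rotation by a right angle about the axis \<open>k\<close>.\<close>

definition quarter_turn :: "3 \<Rightarrow> real^3^3" where
  "quarter_turn k = (if k = 1 then vector [vector [1,0,0], vector [0,0,-1], vector [0,1,0]]
     else if k = 2 then vector [vector [0,0,1], vector [0,1,0], vector [-1,0,0]]
     else vector [vector [0,-1,0], vector [1,0,0], vector [0,0,1]])"

lemma rotation_quarter_turn: "rotation_matrix (quarter_turn k)"
  unfolding rotation_matrix_def orthogonal_matrix_def quarter_turn_def
  by (simp add: det_3 vec_eq_iff forall_3 matrix_matrix_mult_def sum_3 transpose_def mat_def)

text \<open>For a half-turn the straight path passes through singular matrices. So \<open>X\<close> is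
  composed with a quarter turn about an axis \<open>k\<close> with \<open>X $ k $ k \<ge> 0\<close>,
  in one of the two senses: the traces of the two products add up to \<open>2 * X $ k $ k\<close>,
  so one of them is not negative.\<close>

lemma in_identity_component_rotation:
  assumes "X \<in> integral_rotations" shows "in_identity_component X"
proof -
  have rot: "rotation_matrix X" using assms by (simp add: integral_rotations_def)
  have "\<exists>k. X $ k $ k \<ge> 0"
  proof (rule ccontr)
    assume "\<not> ?thesis"
    then have neg: "X $ k $ k < 0" for k by (simp add: not_le)
    have "X $ k = - axis k 1" for k
    proof -
      obtain j s where js: "s = 1 \<or> s = -1" "\<And>x. (X *v x) $ k = s * x $ j" using rotation_component[OF assms, of k] by metis
      have comp: "X $ k $ l = s * axis l 1 $ j" for l
        using js(2)[of "axis l 1"] by (simp add: matrix_vector_mult_basis column_def)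
      then have "j = k" "s = -1" using neg[of k] js(1) by (auto simp: axis_def split: if_splits)
      then show ?thesis using comp by (auto simp: vec_eq_iff axis_def)
    qed
    then have "det X = -1" unfolding det_3 by (simp add: axis_def)
    then show False using rot by (simp add: rotation_matrix_def)
  qed
  then obtain k where k: "X $ k $ k \<ge> 0" by blast
  obtain D where D: "rotation_matrix D" "D$1$1 + D$2$2 + D$3$3 = 1"
    "(X ** D)$1$1 + (X ** D)$2$2 + (X ** D)$3$3 \<ge> 0"
  proof -
    let ?D = "quarter_turn k" and ?E = "transpose (quarter_turn k)"
    have rotD: "rotation_matrix ?D" "rotation_matrix ?E"
      using rotation_quarter_turn[of k] by (auto simp: rotation_matrix_def orthogonal_matrix_transpose det_transpose)
    have trD: "?D$1$1 + ?D$2$2 + ?D$3$3 = 1" "?E$1$1 + ?E$2$2 + ?E$3$3 = 1"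
      by (simp_all add: quarter_turn_def transpose_def)
    have "(X ** ?D)$1$1 + (X ** ?D)$2$2 + (X ** ?D)$3$3 + ((X ** ?E)$1$1 + (X ** ?E)$2$2 + (X ** ?E)$3$3) = 2 * X $ k $ k"
      using exhaust_3[of k] by (auto simp: matrix_matrix_mult_def sum_3 quarter_turn_def transpose_def)
    then have "(X ** ?D)$1$1 + (X ** ?D)$2$2 + (X ** ?D)$3$3 \<ge> 0 \<or> (X ** ?E)$1$1 + (X ** ?E)$2$2 + (X ** ?E)$3$3 \<ge> 0"
      using k by linarith
    then show thesis using that rotD trD by blast
  qed
  have "rotation_matrix (X ** D)" using rot D(1) by (simp add: rotation_matrix_def orthogonal_matrix_mul det_mul)
  then have "in_identity_component (X ** D)" using D(3) by (rule in_identity_component_trace)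
  moreover have "in_identity_component (transpose D)"
  proof (rule in_identity_component_trace)
    show "rotation_matrix (transpose D)" using D(1) by (simp add: rotation_matrix_def orthogonal_matrix_transpose det_transpose)
    show "transpose D $ 1 $ 1 + transpose D $ 2 $ 2 + transpose D $ 3 $ 3 \<ge> 0" using D(2) by (simp add: transpose_def)
  qed
  moreover have "X ** D ** transpose D = X"
    using D(1) by (simp add: rotation_matrix_def orthogonal_matrix_def flip: matrix_mul_assoc)
  ultimately show ?thesis using in_identity_component_mult by metis
qed

section \<open>Periodic isotopies of grids\<close>

text \<open>The straight line motion to the inverse rotation of \<open>Q\<close> is composed with a path of
  matrices from the identity to the rotation. The matrices also move the standard basis.\<close>

lemma periodically_isotopic_if_rot_equiv:
  assumes P: "finite P" "generic P" and rot: "rot_equiv P Q"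
  shows "periodically_isotopic (grid P) (grid Q)"
proof -
  obtain X where X: "X \<in> integral_rotations" "order_equiv ((*v) X ` P) Q" using rot by (auto simp: rot_equiv_def)
  have "order_equiv ((*v) (transpose X) ` (*v) X ` P) ((*v) (transpose X) ` Q)"
    using order_equiv_rotate[OF integral_rotations_transpose[OF X(1)] generic_rotate[OF X(1) P(2)] X(2)] .
  then have "order_equiv P ((*v) (transpose X) ` Q)" by (simp add: image_image rotation_inverse[OF X(1)])
  then obtain g where g: "preserves_order g P" "torus_proj ` g ` P = torus_proj ` (*v) (transpose X) ` Q"
    by (auto simp: order_equiv_def)
  obtain A where A: "continuous_on {0..1::real} A" "A 0 = mat 1" "A 1 = X" "\<And>t. t \<in> {0..1} \<Longrightarrow> det (A t) > 0"
    using in_identity_component_rotation[OF X(1)] unfolding in_identity_component_def by metis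
  interpret straight_line_motion P g by unfold_locales (use P g in auto)
  define f where "f t x = A t *v move t x" for t x
  have img: "move t ` body (grid P) = body (grid (config_at t))" for t
  proof -
    have "move t ` frame p = frame (p + displacement t p)" if p: "p \<in> P" for p
    proof (intro equalityI subsetI)
      fix y assume "y \<in> frame (p + displacement t p)"
      then have "y - displacement t p \<in> frame p" by (simp add: frame_def algebra_simps)
      then show "y \<in> move t ` frame p"
        using move_eq[OF p] by (intro image_eqI[of _ _ "y - displacement t p"]) simp_all
    qed (use move_in_frame[OF p] in auto)
    then show ?thesis unfolding body_grid config_at_def by (simp only: image_UN image_image cong: image_cong)
  qed
  have inj: "inj_on (move t) (body (grid P))" if t: "t \<in> {0..1}" for t
  proof (rule inj_onI)
    fix x y assume "x \<in> body (grid P)" "y \<in> body (grid P)" and eq: "move t x = move t y"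
    then obtain p q where pq: "p \<in> P" "x \<in> frame p" "q \<in> P" "y \<in> frame q" unfolding body_grid by blast
    have "p = q" using move_proj_inj(1)[OF t pq] eq by simp
    then show "x = y" using eq move_eq pq by simp
  qed
  have bij: "bij_betw (f t) (body (grid P)) (body (map_net (A t) (grid (config_at t))))" if t: "t \<in> {0..1}" for t
    unfolding bij_betw_def
  proof
    have "inj ((*v) (A t))" using A(4)[OF t] by (intro inj_matrix) simp
    then show "inj_on (f t) (body (grid P))" using inj[OF t] unfolding f_def inj_on_def by blast
    show "f t ` body (grid P) = body (map_net (A t) (grid (config_at t)))"
      by (simp add: f_def[abs_def] body_map_net img[symmetric] image_image)
  qed
  have hnodes: "move t v \<in> grid_nodes (config_at t)" if v: "v \<in> grid_nodes P" for t v
  proof -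
    obtain p where p: "p \<in> P" "v - p \<in> integer_points" using v by (auto simp: grid_nodes_iff)
    then have "v \<in> frame p" by (auto simp: frame_def integer_points_def)
    then have "move t v - (p + displacement t p) \<in> integer_points" using move_eq[OF p(1)] p(2) by simp
    then show ?thesis using p(1) unfolding grid_nodes_iff config_at_def by blast
  qed
  have edge: "closed_segment (f t p) (f t q) \<in> edges (map_net (A t) (grid (config_at t)))
      \<and> (\<forall>u\<in>{0..1}. f t ((1 - u) *\<^sub>R p + u *\<^sub>R q) = (1 - u) *\<^sub>R f t p + u *\<^sub>R f t q)"
    if pq: "closed_segment p q \<in> edges (grid P)" for t p q
  proof -
    obtain v i where v: "v \<in> grid_nodes P" "closed_segment p q = unit_edge v i" using pq by (auto simp: edges_grid)
    obtain r where r: "r \<in> P" "torus_proj v = torus_proj r" using v(1) by (auto simp: grid_nodes_def)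
    have "closed_segment p q \<subseteq> frame r" using unit_edge_subset_frame[OF r(2)] v(2) by simp
    then have hh: "move t x = x + displacement t r" if "x \<in> closed_segment p q" for x using move_eq[OF r(1)] that by blast
    have "closed_segment (f t p) (f t q) = (*v) (A t) ` closed_segment (displacement t r + p) (displacement t r + q)"
      by (simp add: f_def hh linear_image_closed_segment add.commute)
    also have "closed_segment (displacement t r + p) (displacement t r + q) = (\<lambda>x. displacement t r + x) ` unit_edge v i"
      unfolding closed_segment_translation v(2) ..
    also have "\<dots> = unit_edge (displacement t r + v) i" by (rule translate_unit_edge)
    also have "displacement t r + v = move t v" using hh[of v] unit_edge_self[of v i] v(2) by (simp add: add.commute)
    finally have 1: "closed_segment (f t p) (f t q) \<in> edges (map_net (A t) (grid (config_at t)))"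
      using hnodes[OF v(1)] unfolding edges_map_net edges_grid by blast
    have 2: "f t ((1 - u) *\<^sub>R p + u *\<^sub>R q) = (1 - u) *\<^sub>R f t p + u *\<^sub>R f t q" if u: "u \<in> {0..1}" for u
    proof -
      have "(1 - u) *\<^sub>R p + u *\<^sub>R q \<in> closed_segment p q" using u by (auto simp: in_segment)
      then have "move t ((1 - u) *\<^sub>R p + u *\<^sub>R q) = (1 - u) *\<^sub>R move t p + u *\<^sub>R move t q"
        by (simp add: hh algebra_simps)
      then show ?thesis by (simp add: f_def matrix_vector_right_distrib matrix_vector_mult_scaleR)
    qed
    show ?thesis using 1 2 by blast
  qed
  have G0: "map_net (A 0) (grid (config_at 0)) = grid P"
    by (simp add: A(2) config_at_0 map_net_def nodes_def edges_def)
  have G1: "map_net (A 1) (grid (config_at 1)) = grid Q"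
  proof -
    have "grid (config_at 1) = grid ((*v) (transpose X) ` Q)" by (rule grid_cong) (use g(2) in \<open>simp add: config_at_1\<close>)
    then have "map_net (A 1) (grid (config_at 1)) = grid ((*v) X ` (*v) (transpose X) ` Q)"
      by (simp add: A(3) map_net_grid_rotation[OF X(1)])
    then show ?thesis by (simp add: image_image rotation_inverse[OF X(1)])
  qed
  have net: "linear_3periodic_net (map_net (A t) (grid (config_at t)))" if t: "t \<in> {0..1}" for t
    using A(4)[OF t] periodicity_basis_grid[OF finite_config_at] linear_3periodic_net_grid[OF finite_config_at generic_config_at[OF t]]
    by (intro linear_3periodic_net_map_net) auto
  have per: "periodicity_basis (transpose (A t)) (map_net (A t) (grid (config_at t)))" if t: "t \<in> {0..1}" for t
    using A(4)[OF t] periodicity_basis_grid[OF finite_config_at] by (intro periodicity_basis_map_net) auto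
  have conta: "continuous_on {0..1} (\<lambda>t. transpose (A t))"
    unfolding transpose_def by (intro continuous_intros A(1))
  have contf: "continuous_on {0..1} (\<lambda>t. f t p)" for p
    unfolding f_def by (intro continuous_on_matrix_vector_mult A(1) continuous_on_move)
  have f0: "f 0 p = p" for p by (simp add: f_def move_0 A(2))
  have nod: "f t ` nodes (grid P) \<subseteq> nodes (map_net (A t) (grid (config_at t)))" for t
    using hnodes by (auto simp: f_def)
  show ?thesis unfolding periodically_isotopic_def right_handed_def
    by (rule exI[of _ "\<lambda>t. map_net (A t) (grid (config_at t))"], rule exI[of _ "\<lambda>t. transpose (A t)"], rule exI[of _ f],
        intro conjI ballI allI impI)
       (use G0 G1 net per conta contf f0 nod bij edge A(4) in \<open>simp_all add: det_transpose\<close>)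
qed

text \<open>The data of a periodic isotopy that starts and ends at a grid.\<close>

locale grid_isotopy =
  fixes P Q :: "(real^3) set" and G :: "real \<Rightarrow> net" and a :: "real \<Rightarrow> real^3^3" and f :: "real \<Rightarrow> real^3 \<Rightarrow> real^3"
  assumes finP: "finite P" and genP: "generic P" and neP: "P \<noteq> {}"
    and G0: "G 0 = grid P" and G1: "G 1 = grid Q"
    and net: "t \<in> {0..1} \<Longrightarrow> linear_3periodic_net (G t)"
    and cont_a: "continuous_on {0..1} a"
    and per: "t \<in> {0..1} \<Longrightarrow> periodicity_basis (a t) (G t)"
    and rh: "t \<in> {0..1} \<Longrightarrow> det (a t) > 0"
    and bij: "t \<in> {0..1} \<Longrightarrow> bij_betw (f t) (body (grid P)) (body (G t))"
    and nodes_sub: "t \<in> {0..1} \<Longrightarrow> f t ` nodes (grid P) \<subseteq> nodes (G t)"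
    and f0: "p \<in> body (grid P) \<Longrightarrow> f 0 p = p"
    and cont_f: "p \<in> nodes (grid P) \<Longrightarrow> continuous_on {0..1} (\<lambda>t. f t p)"
    and edge: "t \<in> {0..1} \<Longrightarrow> closed_segment p q \<in> edges (grid P) \<Longrightarrow> closed_segment (f t p) (f t q) \<in> edges (G t)"
    and affine: "t \<in> {0..1} \<Longrightarrow> closed_segment p q \<in> edges (grid P) \<Longrightarrow> u \<in> {0..1}
        \<Longrightarrow> f t ((1 - u) *\<^sub>R p + u *\<^sub>R q) = (1 - u) *\<^sub>R f t p + u *\<^sub>R f t q"
begin

abbreviation "N \<equiv> grid_nodes P"

lemma node_in_body: "v \<in> N \<Longrightarrow> v \<in> body (grid P)"
  unfolding body_def edges_grid using unit_edge_self by blast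

lemma inj_f: "t \<in> {0..1} \<Longrightarrow> inj_on (f t) (body (grid P))"
  using bij by (simp add: bij_betw_def)

lemma inj_f_nodes: "t \<in> {0..1} \<Longrightarrow> v \<in> N \<Longrightarrow> w \<in> N \<Longrightarrow> f t v = f t w \<Longrightarrow> v = w"
  using inj_f node_in_body by (blast dest: inj_onD)

lemma unit_edge_in_edges: "v \<in> N \<Longrightarrow> closed_segment v (v + axis i 1) \<in> edges (grid P)"
  unfolding edges_grid unit_edge_def by blast

text \<open>The midpoint of an edge of the moved net is the image of a point of some initial edge, so it lies
  on the image of that edge. Distinct edges meet only in endpoints, so the two coincide.\<close>

lemma edges_onto:
  assumes t: "t \<in> {0..1}" and e: "e \<in> edges (G t)"
  obtains v i where "v \<in> N" "e = closed_segment (f t v) (f t (v + axis i 1))"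
proof -
  obtain c d where cd: "c \<noteq> d" "e = closed_segment c d"
    using net[OF t] e by (auto simp: linear_3periodic_net_def is_segment_def)
  define m where "m = midpoint c d"
  have m: "m \<in> e" "m \<noteq> c" "m \<noteq> d" using cd by (auto simp: m_def midpoint_in_closed_segment)
  then have "m \<in> f t ` body (grid P)" using e bij[OF t] by (auto simp: body_def bij_betw_def)
  then obtain y where y: "y \<in> body (grid P)" "m = f t y" by blast
  then obtain v i where v: "v \<in> N" "y \<in> unit_edge v i" unfolding body_def edges_grid by blast
  then obtain u where u: "u \<in> {0..1}" "y = (1 - u) *\<^sub>R v + u *\<^sub>R (v + axis i 1)"
    by (auto simp: unit_edge_def in_segment)
  let ?e = "closed_segment (f t v) (f t (v + axis i 1))"
  have me: "m \<in> ?e" using affine[OF t unit_edge_in_edges[OF v(1)] u(1)] u y(2) by (auto simp: in_segment)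
  have "?e \<in> edges (G t)" by (rule edge[OF t unit_edge_in_edges[OF v(1)]])
  then have "e \<noteq> ?e \<Longrightarrow> e \<inter> ?e \<subseteq> endpoints e \<inter> endpoints ?e"
    using net[OF t] e unfolding linear_3periodic_net_def by blast
  moreover have "m \<notin> endpoints e" using m cd by (simp add: endpoints_closed_segment)
  ultimately have "e = ?e" using m me by blast
  then show thesis using that v(1) by blast
qed

lemma nodes_onto: assumes t: "t \<in> {0..1}" shows "nodes (G t) = f t ` N"
proof
  show "nodes (G t) \<subseteq> f t ` N"
  proof
    fix y assume "y \<in> nodes (G t)"
    then obtain e where e: "e \<in> edges (G t)" "y \<in> endpoints e" using net[OF t] by (auto simp: linear_3periodic_net_def)
    obtain v i where v: "v \<in> N" "e = closed_segment (f t v) (f t (v + axis i 1))" by (rule edges_onto[OF t e(1)])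
    have "v + axis i 1 \<in> N" using v(1) by (simp add: grid_nodes_add)
    then show "y \<in> f t ` N" using e(2) v by (auto simp: endpoints_closed_segment)
  qed
  show "f t ` N \<subseteq> nodes (G t)" using nodes_sub[OF t] by simp
qed

lemma countable_N: "countable N"
  unfolding grid_nodes_eq_Union using finP countable_integer_points by (simp add: countable_finite)

text \<open>The moving lattice vector with coordinates \<open>k\<close>.\<close>

definition lat :: "(3 \<Rightarrow> int) \<Rightarrow> real \<Rightarrow> real^3" where
  "lat k t = (\<Sum>i\<in>UNIV. real_of_int (k i) *\<^sub>R (a t $ i))"

lemma lat_in_lattice: "lat k t \<in> lattice_of (a t)"
  by (auto simp: lat_def lattice_of_def)

lemma lat_translate: assumes "t \<in> {0..1}" "y \<in> nodes (G t)" shows "lat k t + y \<in> nodes (G t)"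
proof -
  have "(\<lambda>p. lat k t + p) ` nodes (G t) = nodes (G t)"
    using per[OF assms(1)] lat_in_lattice unfolding periodicity_basis_def by blast
  then show ?thesis using assms(2) by blast
qed

text \<open>At each time the point \<open>f t v + lat k t\<close> is a node, hence \<open>f t q\<close> for a
  unique initial node \<open>q\<close>. The times that belong to a given \<open>q\<close> form a
  closed set, and there are countably many nodes. By Sierpinski's theorem \<open>q\<close> is the
  same as at time 0.\<close>

lemma equivariant:
  assumes v: "v \<in> N" and t: "t \<in> {0..1}"
  shows "v + lat k 0 \<in> N" "f t (v + lat k 0) = f t v + lat k t"
proof -
  define w where "w = v + lat k 0"
  show w: "v + lat k 0 \<in> N" using lat_translate[of 0 v k] v by (simp add: G0 add.commute)
  define C where "C q = {t \<in> {0..1}. f t q - (f t v + lat k t) = 0}" for q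
  have cont_lat: "continuous_on {0..1} (lat k)" unfolding lat_def[abs_def] by (intro continuous_intros cont_a)
  have closed: "closed (C q)" if "q \<in> N" for q
    unfolding C_def using that v cont_f
    by (intro continuous_closed_preimage_constant continuous_intros cont_lat) auto
  define \<U> where "\<U> = {C q | q. q \<in> N \<and> C q \<noteq> {}}"
  have "\<U> = {{0..1}}"
  proof (rule real_Sierpinski_lemma)
    have "\<U> \<subseteq> C ` N" by (auto simp: \<U>_def)
    then show "countable \<U>" by (rule countable_subset) (simp add: countable_N)
    show "pairwise disjnt \<U>"
    proof (rule pairwiseI)
      fix A B assume "A \<in> \<U>" "B \<in> \<U>" "A \<noteq> B"
      then obtain q r where qr: "A = C q" "B = C r" "q \<in> N" "r \<in> N" "q \<noteq> r" by (auto simp: \<U>_def)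
      have False if "t \<in> C q" "t \<in> C r" for t
        using that inj_f_nodes[of t q r] qr by (auto simp: C_def)
      then show "disjnt A B" using qr by (auto simp: disjnt_def)
    qed
    show "closed A \<and> A \<noteq> {}" if "A \<in> \<U>" for A using that closed by (auto simp: \<U>_def)
    have "t \<in> \<Union>\<U>" if t: "t \<in> {0..1}" for t
    proof -
      have "lat k t + f t v \<in> f t ` N" using lat_translate[OF t] nodes_onto[OF t] v by blast
      then obtain q where "q \<in> N" "lat k t + f t v = f t q" by blast
      then have "q \<in> N" "t \<in> C q" using t by (auto simp: C_def algebra_simps)
      then show ?thesis by (auto simp: \<U>_def)
    qed
    moreover have "\<Union>\<U> \<subseteq> {0..1}" unfolding \<U>_def C_def by blast
    ultimately show "\<Union>\<U> = {0..1}" by (meson equalityI subsetI)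
  qed simp
  moreover have "0 \<in> C (v + lat k 0)" using f0 node_in_body v w by (simp add: C_def)
  then have "C (v + lat k 0) \<in> \<U>" using w by (auto simp: \<U>_def)
  ultimately have "t \<in> C (v + lat k 0)" using t by blast
  then show "f t (v + lat k 0) = f t v + lat k t" by (simp add: C_def)
qed

lemma lat_scale: "lat (\<lambda>i. m * k i) t = of_int m *\<^sub>R lat k t"
  by (simp add: lat_def scaleR_sum_right)

text \<open>Among the infinitely many nodes \<open>p + m *\<^sub>R axis i 1\<close> two belong to the same of
  the finitely many orbits.\<close>

lemma axis_multiple_in_lattice: "\<exists>m>0. \<exists>k. lat k 0 = of_int m *\<^sub>R axis i 1"
proof -
  obtain p where p: "p \<in> P" using neP by blast
  let ?L = "lattice_of (a 0)"
  let ?o = "\<lambda>x. {v + x | v. v \<in> ?L}" and ?x = "\<lambda>m::nat. p + real m *\<^sub>R axis i 1"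
  have "?x m \<in> N" for m
    using grid_nodes_add[of "real m *\<^sub>R axis i 1" p P] self_in_grid_nodes[OF p]
    by (simp add: integer_points_def axis_def)
  then have "(?o \<circ> ?x) ` UNIV \<subseteq> ?o ` nodes (G 0)" by (auto simp: G0)
  moreover have "finite (?o ` nodes (G 0))" using per[of 0] by (simp add: periodicity_basis_def)
  ultimately have "finite ((?o \<circ> ?x) ` UNIV)" by (rule finite_subset)
  then have "\<not> inj (?o \<circ> ?x)" using finite_imageD by blast
  then obtain m n :: nat where mn: "m \<noteq> n" "?o (?x m) = ?o (?x n)" by (auto simp: inj_def)
  have *: "\<exists>m>0. \<exists>k. lat k 0 = of_int m *\<^sub>R axis i 1" if "m < n" "?o (?x m) = ?o (?x n)" for m n :: nat
  proof -
    have "lat (\<lambda>_. 0) 0 = 0" by (simp add: lat_def)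
    then have "0 \<in> ?L" by (metis lat_in_lattice)
    then have "?x n \<in> ?o (?x n)" by force
    then have "?x n \<in> ?o (?x m)" using that by simp
    then obtain w where w: "w \<in> ?L" "?x n = w + ?x m" by blast
    then have "w = real (n - m) *\<^sub>R axis i 1" using \<open>m < n\<close> by (simp add: of_nat_diff algebra_simps)
    moreover obtain k where "w = lat k 0" using w(1) by (auto simp: lattice_of_def lat_def)
    ultimately show ?thesis using \<open>m < n\<close> by (intro exI[of _ "int (n - m)"]) auto
  qed
  show ?thesis
  proof (cases "m < n")
    case True then show ?thesis using *[OF _ mn(2)] by blast
  next
    case False then have "n < m" using mn(1) by simp
    then show ?thesis using *[OF _ mn(2)[symmetric]] by blast
  qed
qed

lemma common_period:
  obtains M :: int and k :: "3 \<Rightarrow> 3 \<Rightarrow> int" where "M > 0" "\<And>i. lat (k i) 0 = of_int M *\<^sub>R axis i 1"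
proof -
  obtain m k where mk: "\<And>i. (m i :: int) > 0" "\<And>i. lat (k i) 0 = of_int (m i) *\<^sub>R axis i 1"
    using axis_multiple_in_lattice by metis
  define M where "M = (\<Prod>i\<in>UNIV. m i)"
  have "M > 0" unfolding M_def using mk(1) by (intro prod_pos) auto
  moreover have "lat (\<lambda>j. (\<Prod>l\<in>UNIV - {i}. m l) * k i j) 0 = of_int M *\<^sub>R axis i 1" for i
  proof -
    have "M = m i * (\<Prod>l\<in>UNIV - {i}. m l)" unfolding M_def by (simp add: prod.remove)
    then show ?thesis by (simp add: lat_scale mk(2))
  qed
  ultimately show thesis by (rule that)
qed

end

section \<open>Graph embeddings of the cubic lattice\<close>

definition unit_vectors :: "(real^3) set" where
  "unit_vectors = {s *\<^sub>R axis j 1 | s j. s = 1 \<or> s = -1}"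

lemma axis_in_unit_vectors: "axis j 1 \<in> unit_vectors"
  unfolding unit_vectors_def by (rule CollectI, rule exI[of _ 1], rule exI[of _ j]) simp

lemma unit_vectors_uminus: assumes "d \<in> unit_vectors" shows "- d \<in> unit_vectors"
proof -
  obtain s j where "d = s *\<^sub>R axis j 1" "s = 1 \<or> s = -1" using assms by (auto simp: unit_vectors_def)
  then have "- d = (- s) *\<^sub>R axis j 1" "- s = 1 \<or> - s = -1" by auto
  then show ?thesis unfolding unit_vectors_def by blast
qed

lemma unit_vectors_cases: "d \<in> unit_vectors \<Longrightarrow> (\<exists>j. d = axis j 1) \<or> (\<exists>j. d = - axis j 1)"
  unfolding unit_vectors_def by (elim CollectE exE conjE disjE) auto

lemma unit_vectors_integer: "d \<in> unit_vectors \<Longrightarrow> d \<in> integer_points"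
  using unit_vectors_cases integer_points_minus[OF integer_points_axis] integer_points_axis by metis

lemma finite_unit_vectors: "finite unit_vectors"
proof -
  have "unit_vectors \<subseteq> range (\<lambda>j. axis j 1) \<union> range (\<lambda>j. - axis j 1)" using unit_vectors_cases by blast
  then show ?thesis by (rule finite_subset) simp
qed

lemma unit_vectors_inner:
  assumes "d \<in> unit_vectors" "e \<in> unit_vectors"
  shows "d \<bullet> e = 0 \<and> d \<noteq> e \<and> d \<noteq> - e \<or> d = e \<and> d \<bullet> e = 1 \<or> d = - e \<and> d \<bullet> e = -1"
proof -
  have sq: "x \<bullet> x = 1" if "x \<in> unit_vectors" for x
    using unit_vectors_cases[OF that] by (auto simp: inner_axis_axis)
  have "d \<bullet> e = 0 \<or> d = e \<or> d = - e"
    using unit_vectors_cases[OF assms(1)] unit_vectors_cases[OF assms(2)] by (auto simp: inner_axis_axis split: if_splits)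
  then show ?thesis using sq[OF assms(1)] sq[OF assms(2)] by auto
qed

lemma unit_vectors_inner_self: "d \<in> unit_vectors \<Longrightarrow> d \<bullet> d = 1"
  using unit_vectors_cases[of d] by (auto simp: inner_axis_axis)

text \<open>The situation at the end of a periodic isotopy between grids: an embedding of cubic lattice
  graphs, with several components on each side.\<close>

locale lattice_graph_map =
  fixes N :: "(real^3) set" and \<phi> :: "real^3 \<Rightarrow> real^3"
  assumes closed: "v \<in> N \<Longrightarrow> z \<in> integer_points \<Longrightarrow> v + z \<in> N"
    and inj: "inj_on \<phi> N"
    and step: "v \<in> N \<Longrightarrow> \<phi> (v + axis i 1) - \<phi> v \<in> unit_vectors"
begin

text \<open>The direction of the image of the edge that leaves \<open>v\<close> in the direction
  \<open>d\<close>. At each node it permutes the six unit vectors.\<close>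

definition u :: "real^3 \<Rightarrow> real^3 \<Rightarrow> real^3" where "u v d = \<phi> (v + d) - \<phi> v"

lemma closed_unit: "v \<in> N \<Longrightarrow> d \<in> unit_vectors \<Longrightarrow> v + d \<in> N"
  using closed unit_vectors_integer by blast

lemma u_unit: assumes "v \<in> N" "d \<in> unit_vectors" shows "u v d \<in> unit_vectors"
  using unit_vectors_cases[OF assms(2)]
proof
  assume "\<exists>j. d = axis j 1" then show ?thesis using step[OF assms(1)] by (auto simp: u_def)
next
  assume "\<exists>j. d = - axis j 1"
  then obtain j where j: "d = - axis j 1" by blast
  have "\<phi> (v + d + axis j 1) - \<phi> (v + d) \<in> unit_vectors" by (rule step[OF closed_unit[OF assms]])
  then have "- u v d \<in> unit_vectors" by (simp add: u_def j)
  then show ?thesis using unit_vectors_uminus by fastforce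
qed

lemma phi_eq: "v \<in> N \<Longrightarrow> w \<in> N \<Longrightarrow> \<phi> v = \<phi> w \<Longrightarrow> v = w"
  using inj by (auto dest: inj_onD)

lemma u_surj: assumes "v \<in> N" shows "u v ` unit_vectors = unit_vectors"
proof (rule endo_inj_surj[OF finite_unit_vectors])
  show "u v ` unit_vectors \<subseteq> unit_vectors" using u_unit[OF assms] by blast
  show "inj_on (u v) unit_vectors"
  proof (rule inj_onI)
    fix d e assume "d \<in> unit_vectors" "e \<in> unit_vectors" "u v d = u v e"
    then have "v + d = v + e" using phi_eq[of "v + d" "v + e"] closed_unit[OF assms] by (simp add: u_def)
    then show "d = e" by simp
  qed
qed

lemma phi_add: "\<phi> (v + d) = \<phi> v + u v d"
  by (simp add: u_def)

text \<open>Two neighbours \<open>v + d\<close> and \<open>v + d'\<close> of \<open>v\<close> have the further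
  common neighbour \<open>v + d + d'\<close>, unless \<open>d' = - d\<close>; but two neighbours in
  opposite directions have no further common neighbour. So opposite directions are mapped to
  opposite directions.\<close>

lemma u_opposite: assumes v: "v \<in> N" and d: "d \<in> unit_vectors" shows "u v (- d) = - u v d"
proof -
  define w where "w = u v d"
  have w: "w \<in> unit_vectors" unfolding w_def by (rule u_unit[OF v d])
  obtain d' where d': "d' \<in> unit_vectors" "u v d' = - w" using u_surj[OF v] unit_vectors_uminus[OF w] by (metis imageE)
  have "d' = - d"
  proof (rule ccontr)
    assume ne: "d' \<noteq> - d"
    define x where "x = u (v + d) d'" define y where "y = u (v + d') d"
    have xy: "x \<in> unit_vectors" "y \<in> unit_vectors"
      unfolding x_def y_def using u_unit closed_unit v d d' by blast+
    have c1: "\<phi> (v + d + d') = \<phi> v + w + x" by (simp add: phi_add w_def x_def)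
    have "\<phi> (v + d' + d) = \<phi> v - w + y" by (simp add: phi_add d'(2) y_def)
    then have "\<phi> v + w + x = \<phi> v - w + y" using c1 by (simp add: add.commute add.left_commute)
    then have "2 *\<^sub>R w = y - x" by (simp add: algebra_simps scaleR_2)
    then have "(y - x) \<bullet> w = 2 * (w \<bullet> w)" by (metis inner_scaleR_left)
    then have "y \<bullet> w - x \<bullet> w = 2" using unit_vectors_inner_self[OF w] by (simp add: inner_diff_left)
    then have "x = - w" using unit_vectors_inner[OF xy(1) w] unit_vectors_inner[OF xy(2) w] by auto
    then have "\<phi> (v + (d + d')) = \<phi> v" using c1 by (simp add: add.assoc)
    then have "v + (d + d') = v"
      using phi_eq[of "v + (d + d')" v] v closed_unit[OF closed_unit[OF v d] d'(1)] by (simp add: add.assoc)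
    then have "d + d' = 0" by simp
    then show False using ne by (simp add: eq_neg_iff_add_eq_0 add.commute)
  qed
  then show ?thesis using d' by (simp add: w_def)
qed

text \<open>If \<open>d\<close> and \<open>e\<close> are orthogonal, the image of \<open>v + d + e\<close> is
  the common neighbour, other than the image of \<open>v\<close>, of two neighbours in orthogonal
  directions, which is unique. So unit squares are mapped to parallelograms.\<close>

lemma u_parallel: assumes v: "v \<in> N" and d: "d \<in> unit_vectors" and e: "e \<in> unit_vectors" shows "u (v + d) e = u v e"
proof -
  have same: "u (v + d) d = u v d" if "d \<in> unit_vectors" for d
  proof -
    have "u (v + d) (- d) = - u (v + d) d" by (rule u_opposite[OF closed_unit[OF v that] that])
    then show ?thesis by (simp add: u_def)
  qed
  consider "e = d" | "e = - d" | "e \<noteq> d" "e \<noteq> - d" by blast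
  then show ?thesis
  proof cases
    case 1 then show ?thesis using same[OF d] by simp
  next
    case 2
    then show ?thesis using u_opposite[OF closed_unit[OF v d] d] u_opposite[OF v d] same[OF d] by simp
  next
    case 3
    define x where "x = u (v + d) e" define y where "y = u (v + e) d"
    have xy: "x \<in> unit_vectors" "y \<in> unit_vectors"
      unfolding x_def y_def using u_unit closed_unit v d e by blast+
    have ud: "u v d \<in> unit_vectors" and ue: "u v e \<in> unit_vectors" using u_unit v d e by blast+
    have "\<phi> (v + d + e) = \<phi> v + u v d + x" "\<phi> (v + e + d) = \<phi> v + u v e + y"
      by (simp_all add: phi_add x_def y_def)
    then have eq: "u v d + x = u v e + y" by (simp add: add.commute add.left_commute)
    have "u v d \<noteq> u v e"
      using 3 phi_eq[of "v + d" "v + e"] closed_unit[OF v] d e by (auto simp: u_def)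
    moreover have "u v d \<noteq> - u v e"
    proof
      assume "u v d = - u v e"
      then have "u v d = u v (- e)" using u_opposite[OF v e] by simp
      then have "\<phi> (v + d) = \<phi> (v + - e)" by (simp add: u_def)
      then have "v + d = v + - e"
        using phi_eq closed_unit[OF v d] closed_unit[OF v unit_vectors_uminus[OF e]] by blast
      then show False using 3 by simp
    qed
    ultimately have "u v d \<bullet> u v e = 0" using unit_vectors_inner[OF ud ue] by blast
    then have "x \<bullet> u v e = 1 + y \<bullet> u v e"
      using arg_cong[OF eq, of "\<lambda>z. z \<bullet> u v e"] unit_vectors_inner_self[OF ue] by (simp add: inner_add_left)
    then have "x = u v e \<or> y = - u v e"
      using unit_vectors_inner[OF xy(1) ue] unit_vectors_inner[OF xy(2) ue] by auto
    moreover have "y \<noteq> - u v e"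
    proof
      assume "y = - u v e"
      then have "\<phi> (v + (e + d)) = \<phi> v" using phi_add[of "v + e" d] by (simp add: y_def phi_add add.assoc[symmetric])
      then have "v + (e + d) = v"
        using phi_eq[of "v + (e + d)" v] v closed_unit[OF closed_unit[OF v e] d] by (simp add: add.assoc)
      then show False using 3(2) by (simp add: eq_neg_iff_add_eq_0)
    qed
    ultimately show ?thesis by (simp add: x_def)
  qed
qed

lemma u_along_axis:
  assumes v: "v \<in> N" and e: "e \<in> unit_vectors"
  shows "u (v + of_int m *\<^sub>R axis i 1) e = u v e \<and> \<phi> (v + of_int m *\<^sub>R axis i 1) = \<phi> v + of_int m *\<^sub>R u v (axis i 1)"
proof -
  have nat: "u (v + of_nat n *\<^sub>R d) e = u v e \<and> \<phi> (v + of_nat n *\<^sub>R d) = \<phi> v + of_nat n *\<^sub>R u v d \<and> v + of_nat n *\<^sub>R d \<in> N"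
    if d: "d \<in> unit_vectors" and e: "e \<in> unit_vectors" for d e n
  proof -
    have "(\<forall>e\<in>unit_vectors. u (v + of_nat n *\<^sub>R d) e = u v e) \<and> \<phi> (v + of_nat n *\<^sub>R d) = \<phi> v + of_nat n *\<^sub>R u v d \<and> v + of_nat n *\<^sub>R d \<in> N"
    proof (induction n)
      case 0 then show ?case using v by simp
    next
      case (Suc n)
      define x where "x = v + of_nat n *\<^sub>R d"
      have x: "x \<in> N" "v + of_nat (Suc n) *\<^sub>R d = x + d" using Suc by (simp_all add: x_def algebra_simps)
      have IH: "u x e = u v e" if "e \<in> unit_vectors" for e using Suc that by (simp add: x_def)
      have "\<phi> (x + d) = \<phi> x + u x d" by (rule phi_add)
      also have "\<dots> = \<phi> v + of_nat n *\<^sub>R u v d + u v d" using Suc IH[OF d] by (simp add: x_def)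
      also have "\<dots> = \<phi> v + of_nat (Suc n) *\<^sub>R u v d" by (simp add: algebra_simps)
      finally have "\<phi> (x + d) = \<phi> v + of_nat (Suc n) *\<^sub>R u v d" .
      then show ?case unfolding x(2) using u_parallel[OF x(1) d] IH closed_unit[OF x(1) d] by simp
    qed
    then show ?thesis using e by blast
  qed
  show ?thesis
  proof (cases m rule: int_cases2)
    case (nonneg n)
    then show ?thesis using nat[OF axis_in_unit_vectors[of i] e, of n] by simp
  next
    case (nonpos n)
    then show ?thesis
      using nat[OF unit_vectors_uminus[OF axis_in_unit_vectors[of i]] e, of n] u_opposite[OF v axis_in_unit_vectors[of i]]
      by simp
  qed
qed

text \<open>The map is followed along the three axes in turn, since the image directions do not depend on the
  node.\<close>

lemma phi_affine:
  assumes v: "v \<in> N" and z: "z \<in> integer_points"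
  shows "\<phi> (v + z) = \<phi> v + (\<Sum>i\<in>UNIV. z $ i *\<^sub>R u v (axis i 1))"
proof -
  have "\<exists>k. z $ i = of_int k" for i using z by (auto simp: integer_points_def elim: Ints_cases)
  then obtain k where k: "\<And>i. z $ i = of_int (k i)" by metis
  define v1 where "v1 = v + of_int (k 1) *\<^sub>R axis 1 1"
  define v2 where "v2 = v1 + of_int (k 2) *\<^sub>R axis 2 1"
  have int: "of_int m *\<^sub>R axis i 1 \<in> integer_points" for m i by (simp add: integer_points_def axis_def)
  have v1: "v1 \<in> N" and v2: "v2 \<in> N" unfolding v1_def v2_def using closed int v by blast+
  have vz: "v + z = v2 + of_int (k 3) *\<^sub>R axis 3 1"
    by (simp add: v1_def v2_def vec_eq_iff forall_3 k axis_def)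
  note ax = axis_in_unit_vectors
  have e1: "u v1 e = u v e" if "e \<in> unit_vectors" for e
    using u_along_axis[OF v that, of "k 1" 1] by (simp only: v1_def)
  have e2: "u v2 e = u v1 e" if "e \<in> unit_vectors" for e
    using u_along_axis[OF v1 that, of "k 2" 2] by (simp only: v2_def)
  have p1: "\<phi> v1 = \<phi> v + of_int (k 1) *\<^sub>R u v (axis 1 1)"
    using u_along_axis[OF v ax, of "k 1" 1] unfolding v1_def by blast
  have p2: "\<phi> v2 = \<phi> v1 + of_int (k 2) *\<^sub>R u v1 (axis 2 1)"
    using u_along_axis[OF v1 ax, of "k 2" 2] unfolding v2_def by blast
  have "\<phi> (v + z) = \<phi> v2 + of_int (k 3) *\<^sub>R u v2 (axis 3 1)"
    unfolding vz using u_along_axis[OF v2 ax] by blast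
  also have "\<dots> = \<phi> v + (\<Sum>i\<in>UNIV. z $ i *\<^sub>R u v (axis i 1))"
    unfolding p2 p1 e2[OF ax] e1[OF ax] sum_3 k by (simp only: add.assoc)
  finally show ?thesis .
qed

end

lemma continuous_on_det:
  fixes A :: "'a::topological_space \<Rightarrow> real^3^3"
  assumes "continuous_on S A" shows "continuous_on S (\<lambda>t. det (A t))"
  unfolding det_3 by (intro continuous_intros assms)

lemma matrix_inv_mult: "invertible A \<Longrightarrow> A ** matrix_inv A = mat 1 \<and> matrix_inv A ** A = mat 1"
  unfolding invertible_def matrix_inv_def by (rule someI_ex)

text \<open>Cramer's rule expresses the inverse by determinants.\<close>

lemma continuous_on_matrix_inv:
  fixes A :: "'a::topological_space \<Rightarrow> real^3^3"
  assumes A: "continuous_on S A" and det: "\<And>t. t \<in> S \<Longrightarrow> det (A t) \<noteq> 0"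
  shows "continuous_on S (\<lambda>t. matrix_inv (A t))"
proof -
  let ?C = "\<lambda>t j k. \<chi> i l. if l = k then axis j 1 $ i else A t $ i $ l"
  have eq: "matrix_inv (A t) = (\<chi> k j. det (?C t j k) / det (A t))" if t: "t \<in> S" for t
  proof -
    have inv: "invertible (A t)" using det[OF t] by (simp add: invertible_det_nz)
    have "matrix_inv (A t) $ k $ j = det (?C t j k) / det (A t)" for k j
    proof -
      have "A t *v (matrix_inv (A t) *v axis j 1) = axis j 1"
        using matrix_inv_mult[OF inv] by (simp add: matrix_vector_mul_assoc)
      then have "matrix_inv (A t) *v axis j 1 = (\<chi> k. det (?C t j k) / det (A t))"
        unfolding cramer[OF det[OF t]] .
      then have "(matrix_inv (A t) *v axis j 1) $ k = det (?C t j k) / det (A t)" by simp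
      then show ?thesis by (simp add: matrix_vector_mult_basis column_def)
    qed
    then show ?thesis by (simp add: vec_eq_iff)
  qed
  have entry: "continuous_on S (\<lambda>t. if l = k then axis j 1 $ i else A t $ i $ l)" for i l j k
    by (cases "l = k") (auto intro!: continuous_intros A)
  have "continuous_on S (\<lambda>t. \<chi> k j. det (?C t j k) / det (A t))"
    by (intro continuous_on_vec_lambda continuous_on_divide continuous_on_det entry A) (use det in auto)
  then show ?thesis using eq by (simp cong: continuous_on_cong)
qed

text \<open>Here \<open>\<Phi> t x y\<close> is the difference of a point on a line near the axis
  \<open>j\<close> and a point on a line near the axis \<open>k\<close>, and the sign of its
  component \<open>i\<close> tells which line is above the other one when both are straight. Suppose
  that this sign changes. Extend \<open>\<Phi>\<close> to all real times by moving the lines further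
  apart, before time 0 and after time 1. The result is a map of space to itself that omits the
  origin and, up to the signs of two coordinates, differs from the identity by a bounded map; the
  negative of this bounded map sends a large ball into itself, and its fixed points are the zeros of
  the extended \<open>\<Phi>\<close>.\<close>

lemma linking_sign_invariant:
  fixes \<Phi> :: "real \<Rightarrow> real \<Rightarrow> real \<Rightarrow> real^3" and i j k :: 3
  assumes ijk: "j \<noteq> i" "k \<noteq> i" "j \<noteq> k"
    and nz: "\<And>t x y. t \<in> {0..1} \<Longrightarrow> \<Phi> t x y \<noteq> 0"
    and bd: "\<And>t x y. t \<in> {0..1} \<Longrightarrow> norm (\<Phi> t x y - x *\<^sub>R axis j 1 + y *\<^sub>R axis k 1) \<le> C"
    and cont: "\<And>L. continuous_on ({0..1} \<times> {-L..L} \<times> {-L..L}) (\<lambda>(t, x, y). \<Phi> t x y)"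
    and start: "\<And>x y. \<Phi> 0 x y $ i > 0"
  shows "\<exists>x y. \<Phi> 1 x y $ i > 0"
proof (rule ccontr)
  assume "\<not> ?thesis"
  then have fin: "\<Phi> 1 x y $ i \<le> 0" for x y by (simp add: not_less)
  define \<tau> where "\<tau> z = max 0 (min 1 (z $ i))" for z :: "real^3"
  define \<psi> where "\<psi> z = \<Phi> (\<tau> z) (z $ j) (z $ k) - z $ j *\<^sub>R axis j 1 + z $ k *\<^sub>R axis k 1" for z
  (* A fixed point of T is a zero of the extended map; the signs turn the linear part into the identity. *)
  define T :: "real^3 \<Rightarrow> real^3" where "T z = (\<chi> l. if l = j then - \<psi> z $ l else if l = k then \<psi> z $ l else \<psi> z $ l + \<tau> z)" for z
  have \<tau>: "\<tau> z \<in> {0..1}" for z by (auto simp: \<tau>_def)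
  have C0: "0 \<le> C" using bd[of 0 0 0] norm_ge_zero order_trans by (metis atLeastAtMost_iff order_refl zero_le_one)
  define R where "R = 3 * (C + 1)"
  have bdT: "norm (T z) \<le> R" for z
  proof -
    have "\<bar>\<psi> z $ l\<bar> \<le> C" for l using bd[OF \<tau>] component_le_norm_cart order_trans unfolding \<psi>_def by blast
    then have "\<bar>T z $ l\<bar> \<le> C + 1" for l using \<tau>[of z] by (auto simp: T_def abs_le_iff) (smt (verit))+
    then have "(\<Sum>l\<in>UNIV. \<bar>T z $ l\<bar>) \<le> (\<Sum>l\<in>(UNIV::3 set). C + 1)" by (intro sum_mono) auto
    also have "\<dots> = R" by (simp add: R_def)
    finally show ?thesis using norm_le_l1_cart[of "T z"] by linarith
  qed
  have contT: "continuous_on (cball 0 R) T"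
  proof -
    have c1: "continuous_on (cball 0 R) (\<lambda>z. (\<tau> z, z $ j, z $ k))" unfolding \<tau>_def by (intro continuous_intros)
    have sub: "(\<lambda>z. (\<tau> z, z $ j, z $ k)) ` cball 0 R \<subseteq> {0..1} \<times> {-R..R} \<times> {-R..R}"
    proof -
      have "\<bar>z $ l\<bar> \<le> R" if "z \<in> cball 0 R" for z :: "real^3" and l
        using component_le_norm_cart[of z l] that by simp
      then have "z $ l \<in> {-R..R}" if "z \<in> cball 0 R" for z :: "real^3" and l using that by (auto simp: abs_le_iff minus_le_iff)
      then show ?thesis using \<tau> by blast
    qed
    have "continuous_on (cball 0 R) (\<lambda>z. \<Phi> (\<tau> z) (z $ j) (z $ k))"
      using continuous_on_compose2[OF cont c1 sub] by simp
    then have c\<psi>: "continuous_on (cball 0 R) \<psi>" unfolding \<psi>_def[abs_def] by (intro continuous_intros)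
    have c\<tau>: "continuous_on (cball 0 R) \<tau>" unfolding \<tau>_def[abs_def] by (intro continuous_intros)
    have "continuous_on (cball 0 R) (\<lambda>z. if l = j then - \<psi> z $ l else if l = k then \<psi> z $ l else \<psi> z $ l + \<tau> z)" for l
      by (cases "l = j"; cases "l = k") (auto intro!: continuous_intros c\<psi> c\<tau>)
    then show ?thesis unfolding T_def[abs_def] by (rule continuous_on_vec_lambda)
  qed
  have "R > 0" using C0 by (simp add: R_def)
  then obtain z where z: "T z = z"
    using brouwer_ball[of R 0 T] contT bdT by (metis mem_cball_0 Pi_I)
  have zj: "z $ j = - \<psi> z $ j" and zk: "z $ k = \<psi> z $ k" and zi: "z $ i = \<psi> z $ i + \<tau> z"
    using arg_cong[OF z, of "\<lambda>z. z $ j"] arg_cong[OF z, of "\<lambda>z. z $ k"] arg_cong[OF z, of "\<lambda>z. z $ i"] ijk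
    by (auto simp: T_def)
  let ?F = "\<Phi> (\<tau> z) (z $ j) (z $ k)"
  have F: "?F $ j = 0" "?F $ k = 0" "?F $ i = z $ i - \<tau> z"
  proof -
    have "\<psi> z $ j = ?F $ j - z $ j" "\<psi> z $ k = ?F $ k + z $ k" "\<psi> z $ i = ?F $ i"
      using ijk by (auto simp: \<psi>_def axis_def)
    then show "?F $ j = 0" "?F $ k = 0" "?F $ i = z $ i - \<tau> z" using zj zk zi by linarith+
  qed
  consider "z $ i < 0" | "0 \<le> z $ i" "z $ i \<le> 1" | "z $ i > 1" by linarith
  then show False
  proof cases
    case 1
    then have "\<tau> z = 0" by (simp add: \<tau>_def)
    then show False using F(3) 1 start[of "z $ j" "z $ k"] by simp
  next
    case 2
    then have "\<tau> z = z $ i" by (simp add: \<tau>_def)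
    then have "?F $ l = 0" for l using F index_cases[OF ijk, of l] by auto
    then have "?F = 0" by (simp add: vec_eq_iff)
    then show False using nz[OF \<tau>] by blast
  next
    case 3
    then have "\<tau> z = 1" by (simp add: \<tau>_def)
    then show False using F(3) 3 fin[of "z $ j" "z $ k"] by simp
  qed
qed

section \<open>The rotation and the order at the end of a periodic isotopy\<close>

lemma matrix_vector_mult_sum_columns: "(X :: real^3^3) *v z = (\<Sum>i\<in>UNIV. z $ i *\<^sub>R (X *v axis i 1))"
proof -
  have "(X *v axis i 1) $ r = X $ r $ i" for i r by (simp add: matrix_vector_mult_basis column_def)
  then show ?thesis by (simp add: vec_eq_iff) (simp add: matrix_vector_mult_def mult.commute)
qed

text \<open>A common multiple \<open>M\<close> of the unit vectors in the periodicity lattice, with the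
  coordinates \<open>k i\<close> of its multiples.\<close>

locale grid_isotopy_period = grid_isotopy +
  fixes M :: int and k :: "3 \<Rightarrow> 3 \<Rightarrow> int"
  assumes M: "M > 0" and period: "lat (k i) 0 = of_int M *\<^sub>R axis i 1"
begin

abbreviation "E i \<equiv> (axis i 1 :: real^3)"

text \<open>The moving basis with rows \<open>lat (k i) t\<close>, which starts at \<open>M\<close> times the
  standard basis. It may generate a proper sublattice of the periodicity lattice.\<close>

definition B :: "real \<Rightarrow> real^3^3" where "B t = (\<chi> i. lat (k i) t)"

text \<open>The basis \<open>B t\<close> arises from \<open>a t\<close> by a fixed integer matrix, and this
  matrix has positive determinant because both bases are right-handed at time 0.\<close>

lemma det_B: assumes t: "t \<in> {0..1}" shows "det (B t) > 0"
proof -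
  let ?K = "\<chi> i j. real_of_int (k i j)"
  have eq: "B t = ?K ** a t" for t
    by (simp add: B_def lat_def vec_eq_iff matrix_matrix_mult_def)
  have "det (B 0) = real_of_int M ^ 3"
    unfolding det_3 by (simp add: B_def period axis_def power3_eq_cube)
  then have "det (B 0) > 0" using M by simp
  then have "det ?K > 0" using rh[of 0] unfolding eq det_mul by (simp add: zero_less_mult_iff)
  then show ?thesis unfolding eq det_mul using rh[OF t] by simp
qed

lemma cont_B: "continuous_on {0..1} B"
  unfolding B_def[abs_def] lat_def by (intro continuous_intros cont_a)

lemma node_add: "v \<in> N \<Longrightarrow> z \<in> integer_points \<Longrightarrow> v + z \<in> N"
  by (simp add: grid_nodes_add)

lemma int_axis: "of_int m *\<^sub>R E i \<in> integer_points"
  by (simp add: integer_points_def axis_def)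

sublocale one: lattice_graph_map N "f 1"
proof
  show "v + z \<in> N" if "v \<in> N" "z \<in> integer_points" for v z using that by (rule node_add)
  show "inj_on (f 1) N" using inj_f_nodes[of 1] by (simp add: inj_on_def)
  show "f 1 (v + E i) - f 1 v \<in> unit_vectors" if v: "v \<in> N" for v i
  proof -
    have "closed_segment (f 1 v) (f 1 (v + E i)) \<in> edges (grid Q)"
      using edge[of 1, OF _ unit_edge_in_edges[OF v]] G1 by simp
    then obtain w j where "closed_segment (f 1 v) (f 1 (v + E i)) = closed_segment w (w + E j)"
      by (auto simp: edges_grid unit_edge_def)
    then have "f 1 v = w \<and> f 1 (v + E i) = w + E j \<or> f 1 v = w + E j \<and> f 1 (v + E i) = w"
      by (simp add: closed_segment_eq doubleton_eq_iff)
    then have "f 1 (v + E i) - f 1 v = E j \<or> f 1 (v + E i) - f 1 v = - E j" by auto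
    then show ?thesis using axis_in_unit_vectors unit_vectors_uminus by metis
  qed
qed

text \<open>Going \<open>M\<close> steps along an axis translates the image by \<open>lat (k i) 1\<close>,
  whichever component is followed. This is why all components end up with the same linear part.\<close>

lemma u_eq: assumes v: "v \<in> N" shows "one.u v (E i) = (1 / of_int M) *\<^sub>R lat (k i) 1"
proof -
  have "f 1 v + of_int M *\<^sub>R one.u v (E i) = f 1 (v + of_int M *\<^sub>R E i)"
    using one.u_along_axis[OF v axis_in_unit_vectors, of M i] by simp
  also have "\<dots> = f 1 v + lat (k i) 1"
    using equivariant(2)[OF v, of 1 "k i"] by (simp add: period)
  finally have "lat (k i) 1 = of_int M *\<^sub>R one.u v (E i)" by simp
  then show ?thesis using M by simp
qed

text \<open>The linear part of \<open>f 1\<close> on every component.\<close>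

definition X :: "real^3^3" where "X = (\<chi> r c. ((1 / of_int M) *\<^sub>R lat (k c) 1) $ r)"

lemma X_axis: "X *v E i = (1 / of_int M) *\<^sub>R lat (k i) 1"
  by (simp add: X_def vec_eq_iff matrix_vector_mult_basis column_def)

lemma f1_add: assumes v: "v \<in> N" and z: "z \<in> integer_points" shows "f 1 (v + z) = f 1 v + X *v z"
  unfolding one.phi_affine[OF v z] matrix_vector_mult_sum_columns[of X z] X_axis u_eq[OF v] ..

text \<open>The columns are distinct unit vectors, and no two are opposite, because \<open>f 1\<close> is
  injective. The determinant is positive since it is so along the path of bases.\<close>

lemma X_rotation: "X \<in> integral_rotations"
proof -
  obtain p where "p \<in> P" using neP by blast
  then have p: "p \<in> N" by (rule self_in_grid_nodes)
  have u: "X *v E i = one.u p (E i)" for i by (simp only: X_axis u_eq[OF p])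
  have unit: "X *v E i \<in> unit_vectors" for i
    unfolding u by (rule one.u_unit[OF p axis_in_unit_vectors])
  have ne: "X *v E i \<noteq> X *v E j \<and> X *v E i \<noteq> - (X *v E j)" if ij: "i \<noteq> j" for i j
  proof -
    have inj: "z = z'" if "z \<in> integer_points" "z' \<in> integer_points" "X *v z = X *v z'" for z z'
    proof -
      have "f 1 (p + z) = f 1 (p + z')" using f1_add[OF p] that by simp
      then have "p + z = p + z'" using one.phi_eq node_add[OF p] that by blast
      then show ?thesis by simp
    qed
    have "E i \<noteq> E j" "E i \<noteq> - E j" using ij by (auto simp: axis_def vec_eq_iff)
    moreover have "X *v (- E j) = - (X *v E j)" using matrix_vector_mult_diff_distrib[of X 0 "E j"] by simp
    ultimately show ?thesis
      using inj[of "E i" "E j"] inj[of "E i" "- E j"] integer_points_minus[OF integer_points_axis[of j]] by auto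
  qed
  have "transpose X ** X = mat 1"
  proof -
    have "(transpose X ** X) $ i $ j = (X *v E i) \<bullet> (X *v E j)" for i j
      by (simp add: matrix_matrix_mult_def transpose_def matrix_vector_mult_basis column_def inner_vec_def)
    moreover have "(X *v E i) \<bullet> (X *v E j) = (if i = j then 1 else 0)" for i j
      using unit_vectors_inner[OF unit unit, of i j] ne[of i j] unit_vectors_inner_self[OF unit] by auto
    ultimately show ?thesis by (simp add: vec_eq_iff mat_def)
  qed
  then have orth: "orthogonal_matrix X" by (simp add: orthogonal_matrix)
  have "det (B 1) = of_int M ^ 3 * det X"
  proof -
    have "B 1 $ i $ j = of_int M * X $ j $ i" for i j using M by (simp add: B_def X_def)
    then show ?thesis unfolding det_3 by (simp add: power3_eq_cube algebra_simps)
  qed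
  then have "det X > 0" using det_B[of 1] M by (simp add: zero_less_mult_iff)
  then have "det X = 1" using det_orthogonal_matrix[OF orth] by auto
  moreover have "X $ i $ j \<in> \<int>" for i j
    using unit_vectors_integer[OF unit[of j]] by (simp add: integer_points_def matrix_vector_mult_basis column_def)
  ultimately show ?thesis using orth by (simp add: integral_rotations_def rotation_matrix_def)
qed

lemma f_strip:
  assumes v: "v \<in> N" and t: "t \<in> {0..1}" and s: "of_int m \<le> s" "s \<le> of_int m + 1"
  shows "f t (v + s *\<^sub>R E j) = (1 - (s - of_int m)) *\<^sub>R f t (v + of_int m *\<^sub>R E j)
     + (s - of_int m) *\<^sub>R f t (v + of_int (m + 1) *\<^sub>R E j)"
proof -
  define w where "w = v + of_int m *\<^sub>R E j"
  have w: "w \<in> N" unfolding w_def by (rule node_add[OF v int_axis])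
  have "v + s *\<^sub>R E j = (1 - (s - of_int m)) *\<^sub>R w + (s - of_int m) *\<^sub>R (w + E j)"
    by (simp add: w_def algebra_simps)
  then have "f t (v + s *\<^sub>R E j) = (1 - (s - of_int m)) *\<^sub>R f t w + (s - of_int m) *\<^sub>R f t (w + E j)"
    using affine[OF t unit_edge_in_edges[OF w], of "s - of_int m" j] s by simp
  moreover have "w + E j = v + of_int (m + 1) *\<^sub>R E j" by (simp add: w_def algebra_simps)
  ultimately show ?thesis by (simp only: w_def)
qed

lemma equivariant_line:
  assumes v: "v \<in> N" and t: "t \<in> {0..1}"
  shows "f t (v + s *\<^sub>R E j + lat \<kappa> 0) = f t (v + s *\<^sub>R E j) + lat \<kappa> t"
proof -
  define m where "m = \<lfloor>s\<rfloor>"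
  have s: "of_int m \<le> s" "s \<le> of_int m + 1" unfolding m_def by linarith+
  have nodes: "v + of_int n *\<^sub>R E j \<in> N" for n by (rule node_add[OF v int_axis])
  have eq: "f t (v + lat \<kappa> 0 + of_int n *\<^sub>R E j) = f t (v + of_int n *\<^sub>R E j) + lat \<kappa> t" for n
  proof -
    have "v + lat \<kappa> 0 + of_int n *\<^sub>R E j = v + of_int n *\<^sub>R E j + lat \<kappa> 0" by (simp add: algebra_simps)
    then show ?thesis using equivariant(2)[OF nodes t, of n \<kappa>] by (simp only:)
  qed
  have "v + s *\<^sub>R E j + lat \<kappa> 0 = v + lat \<kappa> 0 + s *\<^sub>R E j" by (simp add: algebra_simps)
  then have "f t (v + s *\<^sub>R E j + lat \<kappa> 0) = f t (v + lat \<kappa> 0 + s *\<^sub>R E j)" by (simp only:)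
  also have "\<dots> = f t (v + s *\<^sub>R E j) + lat \<kappa> t"
    unfolding f_strip[OF equivariant(1)[OF v t] t s] f_strip[OF v t s] eq by (simp add: algebra_simps)
  finally show ?thesis .
qed

text \<open>Joint continuity in time and position: on each strip between two consecutive nodes the value is an
  affine interpolation of two continuous paths.\<close>

lemma continuous_line:
  assumes v: "v \<in> N"
  shows "continuous_on ({0..1} \<times> {-L..L}) (\<lambda>(t, s). f t (v + s *\<^sub>R E j))"
proof -
  define n where "n = \<lceil>L\<rceil>"
  let ?U = "\<lambda>m::int. {0..1} \<times> {of_int m..of_int m + 1 :: real}" and ?F = "\<lambda>(t, s). f t (v + s *\<^sub>R E j)"
  have node: "continuous_on (?U m) (\<lambda>x. f (fst x) (v + of_int l *\<^sub>R E j))" for m l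
  proof -
    have nd: "v + of_int l *\<^sub>R E j \<in> nodes (grid P)" using node_add[OF v int_axis] by simp
    show ?thesis by (rule continuous_on_compose2[OF cont_f[OF nd]]) (auto intro!: continuous_intros)
  qed
  have "continuous_on (?U m) ?F" for m
  proof -
    have "continuous_on (?U m) (\<lambda>x. (1 - (snd x - of_int m)) *\<^sub>R f (fst x) (v + of_int m *\<^sub>R E j)
       + (snd x - of_int m) *\<^sub>R f (fst x) (v + of_int (m + 1) *\<^sub>R E j))"
      by (intro continuous_intros node)
    then show ?thesis by (rule continuous_on_eq) (use f_strip[OF v] in auto)
  qed
  then have "continuous_on (\<Union>m\<in>{-n..n}. ?U m) ?F"
    by (intro continuous_on_closed_Union) (auto intro: closed_Times)
  moreover have "{0..1} \<times> {-L..L} \<subseteq> (\<Union>m\<in>{-n..n}. ?U m)"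
  proof
    fix x assume x: "x \<in> {0..1} \<times> {-L..L}"
    have "\<lfloor>snd x\<rfloor> \<in> {-n..n}" using x unfolding n_def by (auto simp: le_floor_iff floor_le_iff) linarith+
    moreover have "x \<in> ?U \<lfloor>snd x\<rfloor>" using x by (auto simp: mem_Times_iff)
    ultimately show "x \<in> (\<Union>m\<in>{-n..n}. ?U m)" by blast
  qed
  ultimately show ?thesis by (rule continuous_on_subset)
qed

text \<open>The coordinates with respect to the moving basis \<open>B t\<close>.\<close>

definition c :: "real \<Rightarrow> real^3^3" where "c t = matrix_inv (transpose (B t))"

lemma c_inverse:
  assumes t: "t \<in> {0..1}" shows "c t *v (transpose (B t) *v z) = z" "transpose (B t) *v (c t *v z) = z"
proof -
  have "invertible (transpose (B t))" using det_B[OF t] by (simp add: invertible_det_nz det_transpose)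
  from matrix_inv_mult[OF this]
  show "c t *v (transpose (B t) *v z) = z" "transpose (B t) *v (c t *v z) = z"
    by (simp_all add: c_def matrix_vector_mul_assoc)
qed

lemma transpose_B_axis: "transpose (B t) *v E i = lat (k i) t"
  by (simp add: B_def transpose_def vec_eq_iff matrix_vector_mult_basis column_def)

lemma c_lat: "t \<in> {0..1} \<Longrightarrow> c t *v lat (k i) t = E i"
  using c_inverse(1)[of t "E i"] by (simp add: transpose_B_axis)

lemma cont_c: "continuous_on {0..1} c"
  unfolding c_def[abs_def]
proof (rule continuous_on_matrix_inv)
  show "continuous_on {0..1} (\<lambda>t. transpose (B t))" unfolding transpose_def by (intro continuous_intros cont_B)
  show "det (transpose (B t)) \<noteq> 0" if "t \<in> {0..1}" for t using det_B[OF that] by (simp add: det_transpose)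
qed

lemma c_0: "c 0 *v z = (1 / of_int M) *\<^sub>R z"
proof -
  have "transpose (B 0) *v ((1 / of_int M) *\<^sub>R z) = (\<Sum>i\<in>UNIV. (z $ i) *\<^sub>R E i)"
    using M by (subst matrix_vector_mult_sum_columns) (simp add: transpose_B_axis period)
  also have "\<dots> = z" by (simp add: vec_eq_iff axis_def if_distrib cong: if_cong)
  finally show ?thesis using c_inverse(1)[of 0 "(1 / of_int M) *\<^sub>R z"] by simp
qed

lemma c_1: "c 1 *v z = (1 / of_int M) *\<^sub>R (transpose X *v z)"
proof -
  have "transpose (B 1) *v y = of_int M *\<^sub>R (X *v y)" for y
    using M by (subst (1 2) matrix_vector_mult_sum_columns) (simp add: transpose_B_axis X_axis scaleR_sum_right mult.commute)
  then have "transpose (B 1) *v ((1 / of_int M) *\<^sub>R (transpose X *v z)) = z"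
    using M by (simp add: matrix_vector_mult_scaleR rotation_inverse[OF X_rotation])
  then show ?thesis using c_inverse(1)[of 1 "(1 / of_int M) *\<^sub>R (transpose X *v z)"] by simp
qed

lemma continuous_line_c:
  assumes v: "v \<in> N"
  shows "continuous_on ({0..1} \<times> {-L..L}) (\<lambda>x. c (fst x) *v f (fst x) (v + (of_int M * snd x) *\<^sub>R E j))"
proof -
  define L' where "L' = of_int M * L"
  have "of_int M * s \<in> {-L'..L'}" if "s \<in> {-L..L}" for s
    using M that mult_left_mono[of s L "of_int M"] mult_left_mono[of "- L" s "of_int M"] by (simp add: L'_def)
  then have sub: "(\<lambda>x. (fst x, of_int M * snd x)) ` ({0..1} \<times> {-L..L}) \<subseteq> {0..1} \<times> {-L'..L'}" by auto
  have "continuous_on ({0..1} \<times> {-L..L}) (\<lambda>x. (fst x, of_int M * snd x))" by (intro continuous_intros)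
  from continuous_on_compose2[OF continuous_line[OF v, of L' j] this sub]
  have 1: "continuous_on ({0..1} \<times> {-L..L}) (\<lambda>x. f (fst x) (v + (of_int M * snd x) *\<^sub>R E j))" by simp
  have 2: "continuous_on ({0..1} \<times> {-L..L}) (\<lambda>x. c (fst x))"
    by (rule continuous_on_compose2[OF cont_c]) (auto intro!: continuous_intros)
  show ?thesis unfolding matrix_vector_mult_def by (intro continuous_intros 1 2)
qed

text \<open>In coordinates adapted to the moving lattice a moving line is periodic up to its linear part, so
  its deviation from a straight line takes all its values on a compact set.\<close>

lemma line_deviation_bounded:
  assumes v: "v \<in> N"
  obtains C where "\<And>t s. t \<in> {0..1} \<Longrightarrow> norm (c t *v f t (v + (of_int M * s) *\<^sub>R E j) - s *\<^sub>R E j) \<le> C"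
proof -
  let ?h = "\<lambda>x. c (fst x) *v f (fst x) (v + (of_int M * snd x) *\<^sub>R E j) - snd x *\<^sub>R E j"
  have "continuous_on ({0..1} \<times> {-1..1}) ?h"
    using continuous_line_c[OF v, of 1 j] by (auto intro!: continuous_intros)
  moreover have "compact ({0..1::real} \<times> {-1..1::real})" by (intro compact_Times compact_Icc)
  ultimately have "compact (?h ` ({0..1} \<times> {-1..1}))" by (rule compact_continuous_image)
  then have "bounded (?h ` ({0..1} \<times> {-1..1}))" by (rule compact_imp_bounded)
  then obtain C where C: "\<And>y. y \<in> ?h ` ({0..1} \<times> {-1..1}) \<Longrightarrow> norm y \<le> C"
    unfolding bounded_iff by blast
  have "norm (c t *v f t (v + (of_int M * s) *\<^sub>R E j) - s *\<^sub>R E j) \<le> C" if t: "t \<in> {0..1}" for t s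
  proof -
    define m r where "m = \<lfloor>s\<rfloor>" and "r = frac s"
    have s: "s = r + of_int m" by (simp add: m_def r_def frac_def)
    have lat0: "lat (\<lambda>i. m * k j i) 0 = (of_int m * of_int M) *\<^sub>R E j" by (simp add: lat_scale period)
    have "v + (of_int M * s) *\<^sub>R E j = v + (of_int M * r) *\<^sub>R E j + lat (\<lambda>i. m * k j i) 0"
      unfolding lat0 by (simp add: s algebra_simps)
    then have "f t (v + (of_int M * s) *\<^sub>R E j) = f t (v + (of_int M * r) *\<^sub>R E j) + of_int m *\<^sub>R lat (k j) t"
      using equivariant_line[OF v t, of "of_int M * r" j "\<lambda>i. m * k j i"] lat_scale[of m "k j" t] by (simp only:)
    then have "c t *v f t (v + (of_int M * s) *\<^sub>R E j) - s *\<^sub>R E j = ?h (t, r)"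
      by (simp add: matrix_vector_right_distrib matrix_vector_mult_scaleR c_lat[OF t] s algebra_simps)
    moreover have "(t, r) \<in> {0..1} \<times> {-1..1}"
      using t frac_ge_0[of s] frac_lt_1[of s] by (auto simp: r_def intro: less_imp_le order_trans[of _ 0])
    ultimately show ?thesis using C[OF imageI, of "(t, r)"] by simp
  qed
  then show thesis by (rule that)
qed

lemma f1_line: assumes v: "v \<in> N" shows "f 1 (v + s *\<^sub>R E j) = f 1 v + s *\<^sub>R (X *v E j)"
proof -
  define m where "m = \<lfloor>s\<rfloor>"
  have s: "of_int m \<le> s" "s \<le> of_int m + 1" unfolding m_def by linarith+
  have node: "f 1 (v + of_int n *\<^sub>R E j) = f 1 v + of_int n *\<^sub>R (X *v E j)" for n
    unfolding f1_add[OF v int_axis] by (simp add: matrix_vector_mult_scaleR)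
  show ?thesis unfolding f_strip[OF v _ s, of 1, simplified] using node[of m] node[of "m + 1"]
    by (simp add: algebra_simps)
qed

text \<open>A line in a direction \<open>j\<close> through \<open>v\<close> and a line in the third direction
  \<open>l\<close> through \<open>w\<close> never meet, and at both ends of the isotopy they are
  straight and separated by the difference of their \<open>i\<close>-coordinates.\<close>

lemma order_preserved:
  assumes v: "v \<in> N" and w: "w \<in> N" and disj: "frame v \<inter> frame w = {}" and pos: "(v - w) $ i > 0"
  shows "(transpose X *v (f 1 v - f 1 w)) $ i > 0"
proof -
  obtain j l :: 3 where ij: "j \<noteq> i" "l \<noteq> i" "j \<noteq> l" "UNIV = {i, j, l}" by (rule other_two_indices)
  define \<Phi> where "\<Phi> t x y = c t *v (f t (v + (of_int M * x) *\<^sub>R E j) - f t (w + (of_int M * y) *\<^sub>R E l))" for t x y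
  have inbody: "z + s *\<^sub>R E n \<in> body (grid P)" and inframe: "z + s *\<^sub>R E n \<in> frame z" if z: "z \<in> N" for z s n
  proof -
    show 1: "z + s *\<^sub>R E n \<in> frame z" by (auto simp: frame_def axis_def intro!: exI[of _ n])
    obtain p where "p \<in> P" "torus_proj z = torus_proj p" using z by (auto simp: grid_nodes_def)
    then show "z + s *\<^sub>R E n \<in> body (grid P)" using 1 frame_cong body_grid by blast
  qed
  have "\<exists>x y. \<Phi> 1 x y $ i > 0"
  proof -
    obtain C1 where C1: "\<And>t s. t \<in> {0..1} \<Longrightarrow> norm (c t *v f t (v + (of_int M * s) *\<^sub>R E j) - s *\<^sub>R E j) \<le> C1"
      using line_deviation_bounded[OF v, of j] by blast
    obtain C2 where C2: "\<And>t s. t \<in> {0..1} \<Longrightarrow> norm (c t *v f t (w + (of_int M * s) *\<^sub>R E l) - s *\<^sub>R E l) \<le> C2"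
      using line_deviation_bounded[OF w, of l] by blast
    show ?thesis
    proof (rule linking_sign_invariant[OF ij(1-3)])
      fix t x y :: real assume t: "t \<in> {0..1}"
      show "\<Phi> t x y \<noteq> 0"
      proof
        assume "\<Phi> t x y = 0"
        then have "f t (v + (of_int M * x) *\<^sub>R E j) - f t (w + (of_int M * y) *\<^sub>R E l) = 0"
          using c_inverse(2)[OF t] by (metis \<Phi>_def matrix_vector_mult_0_right)
        then have "v + (of_int M * x) *\<^sub>R E j = w + (of_int M * y) *\<^sub>R E l"
          using inj_f[OF t] inbody[OF v] inbody[OF w] by (auto dest: inj_onD)
        then show False using inframe[OF v] inframe[OF w] disj by (metis disjoint_iff)
      qed
      have "\<Phi> t x y - x *\<^sub>R E j + y *\<^sub>R E l = (c t *v f t (v + (of_int M * x) *\<^sub>R E j) - x *\<^sub>R E j)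
          - (c t *v f t (w + (of_int M * y) *\<^sub>R E l) - y *\<^sub>R E l)"
        by (simp add: \<Phi>_def matrix_vector_mult_diff_distrib)
      then show "norm (\<Phi> t x y - x *\<^sub>R E j + y *\<^sub>R E l) \<le> C1 + C2"
        using norm_triangle_le_diff[OF add_mono[OF C1[OF t, of x] C2[OF t, of y]]] by (simp only:)
    next
      fix L :: real
      have 1: "continuous_on ({0..1} \<times> {-L..L} \<times> {-L..L}) (\<lambda>x. c (fst x) *v f (fst x) (v + (of_int M * fst (snd x)) *\<^sub>R E j))"
      proof -
        have "continuous_on ({0..1} \<times> {-L..L} \<times> {-L..L}) (\<lambda>x :: real \<times> real \<times> real. (fst x, fst (snd x)))"
          by (intro continuous_intros)
        from continuous_on_compose2[OF continuous_line_c[OF v, of L j] this] show ?thesis by fastforce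
      qed
      have 2: "continuous_on ({0..1} \<times> {-L..L} \<times> {-L..L}) (\<lambda>x. c (fst x) *v f (fst x) (w + (of_int M * snd (snd x)) *\<^sub>R E l))"
      proof -
        have "continuous_on ({0..1} \<times> {-L..L} \<times> {-L..L}) (\<lambda>x :: real \<times> real \<times> real. (fst x, snd (snd x)))"
          by (intro continuous_intros)
        from continuous_on_compose2[OF continuous_line_c[OF w, of L l] this] show ?thesis by fastforce
      qed
      show "continuous_on ({0..1} \<times> {-L..L} \<times> {-L..L}) (\<lambda>(t, x, y). \<Phi> t x y)"
        unfolding \<Phi>_def matrix_vector_mult_diff_distrib case_prod_unfold by (intro continuous_on_diff 1 2)
    next
      fix x y :: real
      have "\<Phi> 0 x y $ i = (1 / of_int M) * (v - w) $ i"
        using ij f0 inbody[OF v] inbody[OF w] by (simp add: \<Phi>_def c_0 axis_def)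
      then show "\<Phi> 0 x y $ i > 0" using pos M by simp
    qed
  qed
  moreover have "\<Phi> 1 x y $ i = (1 / of_int M) * (transpose X *v (f 1 v - f 1 w)) $ i" for x y
  proof -
    have "\<Phi> 1 x y = (1 / of_int M) *\<^sub>R (transpose X *v (f 1 v - f 1 w) + (of_int M * x) *\<^sub>R E j - (of_int M * y) *\<^sub>R E l)"
      unfolding \<Phi>_def c_1 f1_line[OF v] f1_line[OF w]
      by (simp add: matrix_vector_mult_diff_distrib matrix_vector_right_distrib matrix_vector_mult_scaleR rotation_inverse[OF X_rotation])
    then show ?thesis using ij by (simp add: axis_def)
  qed
  ultimately show ?thesis using M by (auto simp: zero_less_divide_iff)
qed

text \<open>The preceding lemma is applied to the pairs \<open>p\<close>, \<open>q + m *\<^sub>R E i\<close>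
  for the two integers \<open>m\<close> next to the \<open>i\<close>-coordinate of \<open>p -
  q\<close>.\<close>

lemma preserves_order_end: "preserves_order (\<lambda>p. transpose X *v f 1 p) P"
  unfolding preserves_order_def
proof (intro ballI allI)
  fix p q i assume pq: "p \<in> P" "q \<in> P"
  let ?g = "\<lambda>p. transpose X *v f 1 p"
  show "\<lfloor>(?g p - ?g q) $ i\<rfloor> = \<lfloor>(p - q) $ i\<rfloor>"
  proof (cases "p = q")
    case False
    have p: "p \<in> N" and q: "q \<in> N" using pq self_in_grid_nodes by auto
    define m where "m = \<lfloor>(p - q) $ i\<rfloor>"
    have nint: "(p - q) $ i \<notin> \<int>" using genP pq False by (simp add: generic_def)
    have shift: "(?g p - transpose X *v f 1 (q + of_int n *\<^sub>R E i)) $ i = (?g p - ?g q) $ i - of_int n" for n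
      unfolding f1_add[OF q int_axis]
      by (simp add: matrix_vector_right_distrib rotation_inverse[OF X_rotation] axis_def)
    have disj: "frame p \<inter> frame (q + of_int n *\<^sub>R E i) = {}" for n
    proof -
      have "frame (q + of_int n *\<^sub>R E i) = frame q" by (rule frame_cong) (simp add: int_axis)
      then show ?thesis using frame_disjoint[OF genP pq False] by simp
    qed
    have m: "of_int m < (p - q) $ i" "(p - q) $ i < of_int m + 1"
      unfolding m_def using nint by (metis Ints_of_int floor_correct order_le_less, linarith)
    have "(transpose X *v (f 1 p - f 1 (q + of_int m *\<^sub>R E i))) $ i > 0"
      by (rule order_preserved[OF p node_add[OF q int_axis] disj]) (use m in \<open>simp add: axis_def\<close>)
    then have 1: "(?g p - ?g q) $ i > of_int m"
      using shift[of m] by (simp add: matrix_vector_mult_diff_distrib)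
    have "(transpose X *v (f 1 (q + of_int (m + 1) *\<^sub>R E i) - f 1 p)) $ i > 0"
      by (rule order_preserved[OF node_add[OF q int_axis] p])
         (use m disj[of "m + 1"] in \<open>auto simp: axis_def Int_commute\<close>)
    then have 2: "(?g p - ?g q) $ i < of_int m + 1"
      using shift[of "m + 1"] by (simp add: matrix_vector_mult_diff_distrib)
    show ?thesis using 1 2 unfolding m_def by linarith
  qed simp
qed

lemma rot_equiv_end: "rot_equiv P Q"
proof -
  have nodes: "grid_nodes Q = f 1 ` N" using nodes_onto[of 1] G1 by simp
  have "torus_proj ` f 1 ` P = torus_proj ` Q"
  proof (intro equalityI subsetI)
    fix y assume "y \<in> torus_proj ` f 1 ` P"
    then obtain p where p: "p \<in> P" "y = torus_proj (f 1 p)" by blast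
    then have "f 1 p \<in> grid_nodes Q" using nodes self_in_grid_nodes by blast
    then show "y \<in> torus_proj ` Q" using p by (simp add: grid_nodes_def)
  next
    fix y assume "y \<in> torus_proj ` Q"
    then obtain q where q: "q \<in> Q" "y = torus_proj q" by blast
    then obtain v where v: "v \<in> N" "q = f 1 v" using nodes self_in_grid_nodes by blast
    then obtain p where p: "p \<in> P" "v - p \<in> integer_points" by (auto simp: grid_nodes_iff)
    then have "q = f 1 p + X *v (v - p)" using f1_add[of p "v - p"] self_in_grid_nodes v(2) by simp
    then have "y = torus_proj (f 1 p)" using q(2) rotation_integer_points[OF X_rotation p(2)] by simp
    then show "y \<in> torus_proj ` f 1 ` P" using p(1) by blast
  qed
  moreover have "torus_proj ` (\<lambda>p. transpose X *v f 1 p) ` P = torus_proj ` (*v) (transpose X) ` Q"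
    if *: "torus_proj ` f 1 ` P = torus_proj ` Q"
  proof -
    define T where "T y = torus_proj (transpose X *v y)" for y
    have T: "T y = T (torus_proj y)" for y
      unfolding T_def by (rule rotation_torus_proj_cong[OF integral_rotations_transpose[OF X_rotation]]) simp
    have "torus_proj ` (\<lambda>p. transpose X *v f 1 p) ` P = T ` f 1 ` P" by (simp add: image_image T_def)
    also have "\<dots> = T ` torus_proj ` f 1 ` P" by (simp add: image_image flip: T)
    also have "\<dots> = T ` torus_proj ` Q" by (simp only: *)
    also have "\<dots> = torus_proj ` (*v) (transpose X) ` Q" by (simp add: image_image flip: T) (simp add: T_def)
    finally show ?thesis .
  qed
  ultimately have "order_equiv P ((*v) (transpose X) ` Q)"
    unfolding order_equiv_def using preserves_order_end by blast
  from order_equiv_rotate[OF X_rotation genP this]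
  have "order_equiv ((*v) X ` P) Q" by (simp add: image_image rotation_inverse[OF X_rotation])
  then show ?thesis unfolding rot_equiv_def using X_rotation by blast
qed

end

lemma rot_equiv_if_periodically_isotopic:
  assumes "finite P" "generic P" "P \<noteq> {}" and iso: "periodically_isotopic (grid P) (grid Q)"
  shows "rot_equiv P Q"
  using iso unfolding periodically_isotopic_def
proof (elim exE conjE, goal_cases)
  case (1 G a f)
  interpret grid_isotopy P Q G a f
    by (unfold_locales; use assms(1-3) 1 in \<open>(simp add: right_handed_def; fail) | blast\<close>)
  show ?case
  proof (rule common_period)
    fix M :: int and k :: "3 \<Rightarrow> 3 \<Rightarrow> int"
    assume "M > 0" "\<And>i. lat (k i) 0 = of_int M *\<^sub>R axis i 1"
    then interpret grid_isotopy_period P Q G a f M k by unfold_locales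
    show ?thesis by (rule rot_equiv_end)
  qed
qed

section \<open>Patterns and cyclic shifts\<close>

definition pattern_config :: "nat \<Rightarrow> (real^3) set \<Rightarrow> (real^3) set" where
  "pattern_config n T = (\<lambda>p. (1 / real n) *\<^sub>R p) ` T"

lemma order_equiv_translate:
  assumes "torus_proj ` (\<lambda>p. p + w) ` P = torus_proj ` Q" shows "order_equiv P Q"
  unfolding order_equiv_def preserves_order_def using assms by (intro exI[of _ "\<lambda>p. p + w"]) simp

lemma discrete_torus_component:
  assumes "p \<in> discrete_torus n" obtains a where "1 \<le> a" "a \<le> n" "p $ i = real a"
proof -
  have "p $ i \<in> real ` {1..n}" using assms by (simp add: discrete_torus_def)
  then show thesis using that by auto
qed

lemma finite_discrete_torus: "finite (discrete_torus n)"
proof -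
  have "discrete_torus n \<subseteq> (\<lambda>f. \<chi> i. f i) ` (PiE UNIV (\<lambda>_ :: 3. real ` {1..n}))"
  proof
    fix p assume "p \<in> discrete_torus n"
    then show "p \<in> (\<lambda>f. \<chi> i. f i) ` (PiE UNIV (\<lambda>_ :: 3. real ` {1..n}))"
      by (intro image_eqI[of _ _ "\<lambda>i. p $ i"]) (auto simp: discrete_torus_def PiE_UNIV_domain)
  qed
  then show ?thesis by (rule finite_subset) (intro finite_imageI finite_PiE; simp)
qed

lemma finite_patterns: "finite (patterns n)"
proof -
  have "patterns n \<subseteq> Pow (discrete_torus n)" by (auto simp: patterns_def)
  then show ?thesis by (rule finite_subset) (simp add: finite_discrete_torus)
qed

lemma patternD:
  assumes "T \<in> patterns n"
  shows "T \<subseteq> discrete_torus n" "card T = n" "finite T" "p \<in> T \<Longrightarrow> q \<in> T \<Longrightarrow> p \<noteq> q \<Longrightarrow> p $ i \<noteq> q $ i"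
proof -
  show 1: "T \<subseteq> discrete_torus n" "card T = n" using assms by (auto simp: patterns_def)
  show "finite T" using 1(1) finite_discrete_torus finite_subset by blast
  show "p $ i \<noteq> q $ i" if "p \<in> T" "q \<in> T" "p \<noteq> q"
  proof -
    have "(p - q) $ i \<noteq> 0" using assms that unfolding patterns_def by blast
    then show ?thesis by simp
  qed
qed

lemma multiple_in_window:
  assumes "(real a - real b) / real n \<in> \<int>" "1 \<le> a" "a \<le> n" "1 \<le> b" "b \<le> n" shows "a = b"
proof -
  obtain m where m: "(real a - real b) / real n = of_int m" using assms(1) by (rule Ints_cases)
  have "n > 0" using assms by simp
  have "\<bar>(real a - real b) / real n\<bar> < 1" using assms \<open>n > 0\<close> by (simp add: abs_less_iff field_simps)
  then have "m = 0" using m by linarith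
  then show ?thesis using m \<open>n > 0\<close> by simp
qed

lemma pattern_config_in_configs:
  assumes T: "T \<in> patterns n" and n: "n \<ge> 1" shows "pattern_config n T \<in> configs n"
proof -
  have "inj_on (\<lambda>p. (1 / real n) *\<^sub>R p) T" using n by (auto simp: inj_on_def)
  moreover have "generic (pattern_config n T)" unfolding generic_def
  proof (intro ballI impI allI)
    fix x y i assume "x \<in> pattern_config n T" "y \<in> pattern_config n T" "x \<noteq> y"
    then obtain p q where pq: "p \<in> T" "q \<in> T" "p \<noteq> q" "x = (1 / real n) *\<^sub>R p" "y = (1 / real n) *\<^sub>R q"
      by (auto simp: pattern_config_def)
    obtain a where a: "1 \<le> a" "a \<le> n" "p $ i = real a" using discrete_torus_component[of p n i] patternD(1)[OF T] pq(1) by blast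
    obtain b where b: "1 \<le> b" "b \<le> n" "q $ i = real b" using discrete_torus_component[of q n i] patternD(1)[OF T] pq(2) by blast
    have "a \<noteq> b" using patternD(4)[OF T pq(1-3), of i] a b by simp
    then have "(real a - real b) / real n \<notin> \<int>" using multiple_in_window a b by blast
    then show "(x - y) $ i \<notin> \<int>" using pq a b by (simp add: diff_divide_distrib)
  qed
  ultimately show ?thesis using patternD(2,3)[OF T] by (simp add: configs_def card_image pattern_config_def)
qed

lemma floor_small: "- 1 < (x::real) \<Longrightarrow> x < 1 \<Longrightarrow> \<lfloor>x\<rfloor> = (if x \<ge> 0 then 0 else - 1)"
  by (auto simp: floor_eq_iff)

text \<open>The coordinates of the pattern are the ranks of the fractional parts of the coordinates. The
  integer parts are added to the rescaled ranks in order to obtain the lift.\<close>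

lemma config_order_equiv_pattern:
  assumes P: "P \<in> configs n" and n: "n \<ge> 1"
  shows "\<exists>T\<in>patterns n. order_equiv P (pattern_config n T)"
proof -
  have fin: "finite P" and card: "card P = n" and gen: "generic P" using P by (auto simp: configs_def)
  define r where "r p i = card {q \<in> P. frac (q $ i) \<le> frac (p $ i)}" for p :: "real^3" and i
  have r_range: "1 \<le> r p i" "r p i \<le> n" if p: "p \<in> P" for p i
  proof -
    have "{q \<in> P. frac (q $ i) \<le> frac (p $ i)} \<noteq> {}" using p by auto
    then show "1 \<le> r p i" unfolding r_def using fin by (simp add: Suc_le_eq card_gt_0_iff)
    show "r p i \<le> n" unfolding r_def card[symmetric] using fin by (intro card_mono) auto
  qed
  have r_less: "r q i < r p i" if "p \<in> P" "q \<in> P" "frac (q $ i) < frac (p $ i)" for p q i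
  proof -
    let ?A = "{s \<in> P. frac (s $ i) \<le> frac (q $ i)}" and ?B = "{s \<in> P. frac (s $ i) \<le> frac (p $ i)}"
    have "?A \<subseteq> ?B" using that(3) by (auto intro: order_trans less_imp_le)
    moreover have "p \<in> ?B" "p \<notin> ?A" using that by auto
    ultimately have "?A \<subset> ?B" by blast
    then show ?thesis unfolding r_def using fin by (intro psubset_card_mono) simp_all
  qed
  have frac_ne: "frac (p $ i) \<noteq> frac (q $ i)" if "p \<in> P" "q \<in> P" "p \<noteq> q" for p q i
    using gen that by (simp add: generic_def frac_eq_iff_diff_Ints)
  define t where "t p = (\<chi> i. real (r p i))" for p
  have t_ne: "t p $ i \<noteq> t q $ i" if "p \<in> P" "q \<in> P" "p \<noteq> q" for p q i
    using r_less[of p q i] r_less[of q p i] frac_ne[OF that, of i] that by (force simp: t_def)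
  have inj: "inj_on t P" using t_ne by (metis inj_onI)
  have "t ` P \<in> patterns n" unfolding patterns_def
  proof (intro CollectI conjI ballI impI allI)
    show "t ` P \<subseteq> discrete_torus n" using r_range by (auto simp: discrete_torus_def t_def)
    show "card (t ` P) = n" using card inj by (simp add: card_image)
    show "(x - y) $ i \<noteq> 0" if "x \<in> t ` P" "y \<in> t ` P" "x \<noteq> y" for x y i
      using that t_ne by auto
  qed
  moreover have "order_equiv P (pattern_config n (t ` P))"
  proof -
    define h where "h p = (1 / real n) *\<^sub>R t p + (\<chi> i. of_int \<lfloor>p $ i\<rfloor>)" for p
    have "preserves_order h P" unfolding preserves_order_def
    proof (intro ballI allI)
      fix p q i assume pq: "p \<in> P" "q \<in> P"
      define x where "x = (real (r p i) - real (r q i)) / real n"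
      define y where "y = frac (p $ i) - frac (q $ i)"
      have "\<bar>x\<bar> < 1" using r_range[OF pq(1), of i] r_range[OF pq(2), of i] n
        by (auto simp: x_def abs_less_iff field_simps)
      moreover have "\<bar>y\<bar> < 1" unfolding y_def
        using frac_ge_0[of "p $ i"] frac_lt_1[of "p $ i"] frac_ge_0[of "q $ i"] frac_lt_1[of "q $ i"] by linarith
      moreover have "x \<ge> 0 \<longleftrightarrow> y \<ge> 0"
      proof (cases "p = q")
        case False
        then have "frac (q $ i) < frac (p $ i) \<or> frac (p $ i) < frac (q $ i)" using frac_ne[OF pq, of i] by linarith
        then show ?thesis
        proof
          assume a: "frac (q $ i) < frac (p $ i)"
          then show ?thesis using r_less[OF pq a] by (simp add: x_def y_def)
        next
          assume a: "frac (p $ i) < frac (q $ i)"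
          then have "real (r p i) - real (r q i) < 0" using r_less[OF pq(2,1) a] by simp
          then have "x < 0" using n by (simp add: x_def divide_less_0_iff)
          then show ?thesis using a by (simp add: y_def)
        qed
      qed (simp add: x_def y_def)
      ultimately have xy: "\<lfloor>x\<rfloor> = \<lfloor>y\<rfloor>" using floor_small[of x] floor_small[of y] by (simp add: abs_less_iff)
      have "(h p - h q) $ i = x + of_int (\<lfloor>p $ i\<rfloor> - \<lfloor>q $ i\<rfloor>)"
        by (simp add: h_def t_def x_def diff_divide_distrib)
      moreover have "(p - q) $ i = y + of_int (\<lfloor>p $ i\<rfloor> - \<lfloor>q $ i\<rfloor>)" by (simp add: y_def frac_def)
      ultimately show "\<lfloor>(h p - h q) $ i\<rfloor> = \<lfloor>(p - q) $ i\<rfloor>" using xy by (simp only: floor_add_int[symmetric])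
    qed
    moreover have "torus_proj (h p) = torus_proj ((1 / real n) *\<^sub>R t p)" for p
      unfolding h_def by (rule torus_proj_add_integer) (simp add: integer_points_def)
    then have "torus_proj ` h ` P = torus_proj ` pattern_config n (t ` P)"
      by (simp add: pattern_config_def image_image)
    ultimately show ?thesis unfolding order_equiv_def by blast
  qed
  ultimately show ?thesis by blast
qed

lemma cyclic_succ_power:
  assumes "1 \<le> a" "a \<le> n"
  shows "\<exists>b m. 1 \<le> b \<and> b \<le> n \<and> (cyclic_succ n ^^ k) (real a) = real b \<and> real b = real a + real k + of_int m * real n"
proof (induction k)
  case 0
  show ?case using assms by (intro exI[of _ a] exI[of _ 0]) simp
next
  case (Suc k)
  then obtain b m where b: "1 \<le> b" "b \<le> n" "(cyclic_succ n ^^ k) (real a) = real b"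
    "real b = real a + real k + of_int m * real n" by blast
  show ?case
  proof (cases "b = n")
    case True
    have 1: "of_int (m - 1) * real n = of_int m * real n - real n" by (simp add: algebra_simps)
    have 2: "real n = real a + real k + of_int m * real n" using b(4) True by (simp only:)
    have "real 1 = real a + real (Suc k) + of_int (m - 1) * real n" unfolding 1 using 2 by simp
    moreover have "cyclic_succ n (real b) = real 1" using True by (simp add: cyclic_succ_def)
    then have "(cyclic_succ n ^^ Suc k) (real a) = real 1" using b(3) by simp
    moreover have "1 \<le> n" using assms by simp
    ultimately show ?thesis by blast
  next
    case False
    have "cyclic_succ n (real b) = real (Suc b)" using False by (simp add: cyclic_succ_def)
    then have "(cyclic_succ n ^^ Suc k) (real a) = real (Suc b)" using b(3) by simp
    moreover have "real (Suc b) = real a + real (Suc k) + of_int m * real n" using b(4) by simp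
    moreover have "1 \<le> Suc b" "Suc b \<le> n" using b(2) False by simp_all
    ultimately show ?thesis by blast
  qed
qed

definition shift :: "nat \<Rightarrow> (3 \<Rightarrow> nat) \<Rightarrow> real^3 \<Rightarrow> real^3" where
  "shift n k = restrict (\<lambda>p. \<chi> i. (cyclic_succ n ^^ k i) (p $ i)) (discrete_torus n)"

lemma cyclic_shifts_eq: "cyclic_shifts n = range (shift n)"
  by (simp add: cyclic_shifts_def shift_def[abs_def])

lemma shift_component:
  assumes "p \<in> discrete_torus n"
  obtains b m where "1 \<le> b" "b \<le> n" "shift n k p $ i = real b" "real b = p $ i + real (k i) + of_int m * real n"
proof -
  obtain a where a: "1 \<le> a" "a \<le> n" "p $ i = real a" using discrete_torus_component[OF assms] .
  show thesis using cyclic_succ_power[OF a(1,2), of "k i"] that a(3) assms by (auto simp: shift_def)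
qed

lemma shift_in_torus: assumes "p \<in> discrete_torus n" shows "shift n k p \<in> discrete_torus n"
  unfolding discrete_torus_def
proof (intro CollectI allI)
  fix i
  obtain b m where "1 \<le> b" "b \<le> n" "shift n k p $ i = real b" using shift_component[OF assms] by metis
  then show "shift n k p $ i \<in> real ` {1..n}" by auto
qed

lemma shift_component_eq:
  assumes p: "p \<in> discrete_torus n" and q: "q \<in> discrete_torus n" and c: "(q $ i - p $ i - real (k i)) / real n \<in> \<int>"
  shows "shift n k p $ i = q $ i"
proof -
  obtain a where a: "1 \<le> a" "a \<le> n" "q $ i = real a" using discrete_torus_component[OF q] .
  obtain b m where b: "1 \<le> b" "b \<le> n" "shift n k p $ i = real b" "real b = p $ i + real (k i) + of_int m * real n"
    using shift_component[OF p, of k i] .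
  have "n > 0" using a by simp
  then have "(real a - real b) / real n = (q $ i - p $ i - real (k i)) / real n - of_int m"
    using a b by (simp add: field_simps)
  then have "(real a - real b) / real n \<in> \<int>" using c by simp
  then have "a = b" using multiple_in_window a b by blast
  then show ?thesis using a b by simp
qed

lemma shift_component_inj:
  assumes p: "p \<in> discrete_torus n" and q: "q \<in> discrete_torus n" and e: "shift n k p $ i = shift n k q $ i"
  shows "p $ i = q $ i"
proof -
  obtain a where a: "1 \<le> a" "a \<le> n" "p $ i = real a" using discrete_torus_component[OF p] .
  obtain a' where a': "1 \<le> a'" "a' \<le> n" "q $ i = real a'" using discrete_torus_component[OF q] .
  obtain b m where b: "shift n k p $ i = real b" "real b = p $ i + real (k i) + of_int m * real n"
    using shift_component[OF p, of k i] by metis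
  obtain b' m' where b': "shift n k q $ i = real b'" "real b' = q $ i + real (k i) + of_int m' * real n"
    using shift_component[OF q, of k i] by metis
  have "n > 0" using a by simp
  then have "(real a - real a') / real n = of_int (m' - m)"
    using a a' b b' e by (simp add: field_simps)
  then have "(real a - real a') / real n \<in> \<int>" by (metis Ints_of_int)
  then show ?thesis using multiple_in_window a a' by metis
qed

lemma Bij_finiteI:
  assumes "finite D" "\<And>p. p \<in> D \<Longrightarrow> f p \<in> D" "inj_on f D" "f \<in> extensional D" shows "f \<in> Bij D"
proof -
  have "f ` D = D" using assms by (intro endo_inj_surj) auto
  then show ?thesis using assms by (simp add: Bij_def bij_betw_def)
qed

lemma shift_Bij: "shift n k \<in> Bij (discrete_torus n)"
proof (rule Bij_finiteI[OF finite_discrete_torus shift_in_torus])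
  show "inj_on (shift n k) (discrete_torus n)"
  proof (rule inj_onI)
    fix p q assume pq: "p \<in> discrete_torus n" "q \<in> discrete_torus n" "shift n k p = shift n k q"
    have "p $ i = q $ i" for i by (rule shift_component_inj[OF pq(1,2), where k = k]) (simp only: pq(3))
    then show "p = q" by (simp add: vec_eq_iff)
  qed
qed (simp_all only: shift_def restrict_extensional)

lemma image_pattern:
  assumes T: "T \<in> patterns n" and into: "\<And>p. p \<in> discrete_torus n \<Longrightarrow> g p \<in> discrete_torus n"
    and ne: "\<And>p q i. p \<in> T \<Longrightarrow> q \<in> T \<Longrightarrow> p \<noteq> q \<Longrightarrow> g p $ i \<noteq> g q $ i"
  shows "g ` T \<in> patterns n"
  unfolding patterns_def
proof (intro CollectI conjI ballI impI allI)
  show "g ` T \<subseteq> discrete_torus n" using into patternD(1)[OF T] by blast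
  have "inj_on g T" using ne by (metis inj_onI)
  then show "card (g ` T) = n" using patternD(2)[OF T] by (simp add: card_image)
  show "(x - y) $ i \<noteq> 0" if "x \<in> g ` T" "y \<in> g ` T" "x \<noteq> y" for x y i
    using that ne by auto
qed

text \<open>Modulo 1 the rescaled shift is a translation of the torus, which preserves all differences.\<close>

lemma shift_pattern:
  assumes T: "T \<in> patterns n" and n: "n \<ge> 1"
  shows "shift n k ` T \<in> patterns n" "order_equiv (pattern_config n T) (pattern_config n (shift n k ` T))"
proof -
  have D: "p \<in> discrete_torus n" if "p \<in> T" for p using patternD(1)[OF T] that by blast
  show "shift n k ` T \<in> patterns n"
  proof (rule image_pattern[OF T shift_in_torus])
    fix p q i assume pq: "p \<in> T" "q \<in> T" "p \<noteq> q"
    show "shift n k p $ i \<noteq> shift n k q $ i"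
      using shift_component_inj[OF D[OF pq(1)] D[OF pq(2)]] patternD(4)[OF T pq] by metis
  qed
  define w :: "real^3" where "w = (\<chi> i. real (k i) / real n)"
  have "torus_proj ((1 / real n) *\<^sub>R p + w) = torus_proj ((1 / real n) *\<^sub>R shift n k p)" if p: "p \<in> T" for p
    unfolding torus_proj_eq_iff
  proof
    fix i
    obtain b m where b: "shift n k p $ i = real b" "real b = p $ i + real (k i) + of_int m * real n"
      using shift_component[OF D[OF p], of k i] by metis
    have "((1 / real n) *\<^sub>R p + w - (1 / real n) *\<^sub>R shift n k p) $ i = - of_int m"
      using b n by (simp add: w_def field_simps)
    then show "((1 / real n) *\<^sub>R p + w - (1 / real n) *\<^sub>R shift n k p) $ i \<in> \<int>" by simp
  qed
  then show "order_equiv (pattern_config n T) (pattern_config n (shift n k ` T))"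
    by (intro order_equiv_translate[of w]) (simp add: pattern_config_def image_image)
qed

lemma increasing_in_window:
  fixes \<beta> :: "nat \<Rightarrow> int"
  assumes inc: "\<And>r s. 1 \<le> r \<Longrightarrow> r < s \<Longrightarrow> s \<le> n \<Longrightarrow> \<beta> r < \<beta> s" and width: "\<beta> n < \<beta> 1 + int n"
    and r: "1 \<le> r" "r \<le> n"
  shows "\<beta> r = \<beta> 1 + int r - 1"
proof -
  have grow: "\<beta> s \<ge> \<beta> r + int (s - r)" if "1 \<le> r" "r \<le> s" "s \<le> n" for r s
    using that(2,3)
  proof (induction s rule: dec_induct)
    case (step s)
    then have "\<beta> s < \<beta> (Suc s)" using inc[of s "Suc s"] that(1) by simp
    then show ?case using step by (simp add: Suc_diff_le)
  qed simp
  show ?thesis using grow[of 1 r] grow[of r n] r width by (simp add: of_nat_diff)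
qed

text \<open>Sort the points of \<open>T\<close> by their \<open>i\<close>-coordinate. The lifted coordinates
  of the points of \<open>T'\<close>, in units of \<open>1/n\<close>, are then \<open>n\<close>
  increasing integers within less than \<open>n\<close>, hence consecutive. So they differ from the
  coordinates of \<open>T\<close> by a constant, which is the amount of the cyclic shift.\<close>

lemma order_equiv_imp_shift:
  assumes T: "T \<in> patterns n" and T': "T' \<in> patterns n" and n: "n \<ge> 1"
    and equiv: "order_equiv (pattern_config n T) (pattern_config n T')"
  shows "\<exists>k. T' = shift n k ` T"
proof -
  let ?s = "\<lambda>p :: real^3. (1 / real n) *\<^sub>R p"
  obtain g where g: "preserves_order g (pattern_config n T)"
    "torus_proj ` g ` pattern_config n T = torus_proj ` pattern_config n T'"
    using equiv by (auto simp: order_equiv_def)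
  have D: "p \<in> discrete_torus n" if "p \<in> T" for p using patternD(1)[OF T] that by blast
  have D': "p \<in> discrete_torus n" if "p \<in> T'" for p using patternD(1)[OF T'] that by blast
  have gen: "generic (pattern_config n T)" using pattern_config_in_configs[OF T n] by (simp add: configs_def)
  define b where "b p i = real n * g (?s p) $ i" for p i
  have match: "torus_proj ` (\<lambda>p. g (?s p)) ` T = torus_proj ` ?s ` T'"
    using g(2) by (simp add: pattern_config_def image_image)
  have cong: "(q $ i - b p i) / real n \<in> \<int>" if "torus_proj (g (?s p)) = torus_proj (?s q)" for p q i
  proof -
    have "(?s q - g (?s p)) $ i \<in> \<int>" using that[symmetric] by (simp only: torus_proj_eq_iff)
    moreover have "(?s q - g (?s p)) $ i = (q $ i - b p i) / real n" using n by (simp add: b_def field_simps)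
    ultimately show ?thesis by simp
  qed
  have bint: "b p i \<in> \<int>" if p: "p \<in> T" for p i
  proof -
    obtain q where q: "q \<in> T'" "torus_proj (g (?s p)) = torus_proj (?s q)" using match p by blast
    obtain a where a: "q $ i = real a" using discrete_torus_component[OF D'[OF q(1)], of i] by metis
    obtain m where "(q $ i - b p i) / real n = of_int m" using cong[OF q(2), of i] by (auto elim: Ints_cases)
    then have "b p i = of_int (int a - m * int n)" using a n by (simp add: field_simps)
    then show ?thesis by (metis Ints_of_int)
  qed
  have "\<exists>c::int. \<forall>p\<in>T. b p i = p $ i + of_int c" for i
  proof -
    have "(\<lambda>p. p $ i) ` T = real ` {1..n}"
    proof (rule card_subset_eq)
      show "(\<lambda>p. p $ i) ` T \<subseteq> real ` {1..n}" using D by (auto simp: discrete_torus_def)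
      have "inj_on (\<lambda>p. p $ i) T" using patternD(4)[OF T] by (metis inj_onI)
      then show "card ((\<lambda>p. p $ i) ` T) = card (real ` {1..n})"
        using patternD(2)[OF T] by (simp add: card_image)
    qed simp
    then have "\<forall>r\<in>{1..n}. \<exists>p\<in>T. p $ i = real r" by (metis (no_types, lifting) imageE imageI)
    then obtain e where e: "\<And>r. r \<in> {1..n} \<Longrightarrow> e r \<in> T" "\<And>r. r \<in> {1..n} \<Longrightarrow> e r $ i = real r" by metis
    define \<beta> where "\<beta> r = \<lfloor>b (e r) i\<rfloor>" for r
    have \<beta>: "of_int (\<beta> r) = b (e r) i" if "r \<in> {1..n}" for r
      using bint[OF e(1)[OF that], of i] by (auto simp: \<beta>_def elim: Ints_cases)
    have step: "\<beta> r < \<beta> s \<and> \<beta> s < \<beta> r + int n" if rs: "r \<in> {1..n}" "s \<in> {1..n}" "r < s" for r s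
    proof -
      have ne: "?s (e s) \<noteq> ?s (e r)" using e(2)[OF rs(1)] e(2)[OF rs(2)] rs(3) n by auto
      have mem: "?s (e s) \<in> pattern_config n T" "?s (e r) \<in> pattern_config n T"
        using e(1)[OF rs(1)] e(1)[OF rs(2)] by (auto simp: pattern_config_def)
      have "\<lfloor>(?s (e s) - ?s (e r)) $ i\<rfloor> = 0"
        using e(2)[OF rs(1)] e(2)[OF rs(2)] rs by (auto simp: floor_eq_iff field_simps)
      then have fl: "\<lfloor>(g (?s (e s)) - g (?s (e r))) $ i\<rfloor> = 0" using preserves_orderD[OF g(1) mem] by simp
      have "(g (?s (e s)) - g (?s (e r))) $ i \<notin> \<int>" by (rule preserves_order_generic[OF g(1) gen mem ne])
      then have "(g (?s (e s)) - g (?s (e r))) $ i \<noteq> 0" by (metis Ints_0)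
      then have "0 < (g (?s (e s)) - g (?s (e r))) $ i" "(g (?s (e s)) - g (?s (e r))) $ i < 1"
        using fl by linarith+
      moreover have "(g (?s (e s)) - g (?s (e r))) $ i = (of_int (\<beta> s) - of_int (\<beta> r)) / real n"
        using n by (simp add: \<beta>[OF rs(1)] \<beta>[OF rs(2)] b_def field_simps)
      ultimately have "0 < (of_int (\<beta> s) - of_int (\<beta> r)) / real n" "(of_int (\<beta> s) - of_int (\<beta> r)) / real n < 1"
        by (simp_all only:)
      then have "0 < of_int (\<beta> s) - (of_int (\<beta> r) :: real)" "of_int (\<beta> s) - of_int (\<beta> r) < real n"
        using n by (simp_all add: zero_less_divide_iff divide_less_eq)
      then show ?thesis by linarith
    qed
    have "\<beta> n < \<beta> 1 + int n" using step[of 1 n] n by (cases "n = 1") auto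
    then have eq: "\<beta> r = \<beta> 1 + int r - 1" if "r \<in> {1..n}" for r
      using increasing_in_window[of n \<beta> r] step that by auto
    have "b p i = p $ i + of_int (\<beta> 1 - 1)" if p: "p \<in> T" for p
    proof -
      obtain r where r: "1 \<le> r" "r \<le> n" "p $ i = real r" using discrete_torus_component[OF D[OF p]] .
      then have "e r = p" using e[of r] patternD(4)[OF T _ p, of "e r" i] by force
      then show ?thesis using \<beta>[of r] eq[of r] r by simp
    qed
    then show ?thesis by blast
  qed
  then obtain c :: "3 \<Rightarrow> int" where c: "\<And>p i. p \<in> T \<Longrightarrow> b p i = p $ i + of_int (c i)" by metis
  (* Cyclic shifts have natural exponents, so the integer shift is reduced modulo n. *)
  define k where "k i = nat (c i mod int n)" for i
  have k: "\<exists>m::int. of_int (c i) = real (k i) + of_int m * real n" for i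
  proof -
    have "int (k i) = c i mod int n" using n by (simp add: k_def)
    then have "c i = int (k i) + (c i div int n) * int n" by (metis add.commute div_mult_mod_eq)
    then have "of_int (c i) = (of_int (int (k i) + (c i div int n) * int n) :: real)" by simp
    then show ?thesis by (intro exI[of _ "c i div int n"]) simp
  qed
  have key: "shift n k p = q" if p: "p \<in> T" and q: "q \<in> T'" and e: "torus_proj (g (?s p)) = torus_proj (?s q)" for p q
  proof (rule vec_eq_iff[THEN iffD2], rule allI, rule shift_component_eq[OF D[OF p] D'[OF q]])
    fix i
    obtain m :: int where m: "of_int (c i) = real (k i) + of_int m * real n" using k by blast
    have "(q $ i - p $ i - real (k i)) / real n = (q $ i - b p i) / real n + of_int m"
      using n m by (simp add: c[OF p] field_simps)
    then show "(q $ i - p $ i - real (k i)) / real n \<in> \<int>" using cong[OF e, of i] by simp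
  qed
  have "T' = shift n k ` T"
  proof (intro equalityI subsetI)
    fix q assume q: "q \<in> T'"
    then have "torus_proj (?s q) \<in> torus_proj ` (\<lambda>p. g (?s p)) ` T" unfolding match by blast
    then obtain p where p: "p \<in> T" "torus_proj (?s q) = torus_proj (g (?s p))" by blast
    show "q \<in> shift n k ` T" using key[OF p(1) q p(2)[symmetric]] p(1) by blast
  next
    fix x assume "x \<in> shift n k ` T"
    then obtain p where p: "p \<in> T" "x = shift n k p" by blast
    have "torus_proj (g (?s p)) \<in> torus_proj ` ?s ` T'" unfolding match[symmetric] using p by blast
    then obtain q where q: "q \<in> T'" "torus_proj (g (?s p)) = torus_proj (?s q)" by blast
    show "x \<in> T'" using key[OF p(1) q] p(2) q(1) by simp
  qed
  then show ?thesis by blast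
qed

section \<open>Rotations of patterns and the count of orbits\<close>

lemma rotation_half_cube_le:
  fixes x :: "real^3"
  assumes "X \<in> integral_rotations" "\<And>i. \<bar>x $ i\<bar> \<le> h" shows "\<bar>(X *v x) $ i\<bar> \<le> h"
proof -
  obtain j s where js: "s = 1 \<or> s = -1" "\<And>x. (X *v x) $ i = s * x $ j" using rotation_component[OF assms(1), of i] by metis
  then show ?thesis using assms(2)[of j] by auto
qed

lemma rotate_about_cube_iff:
  "rotate_about (\<chi> i. 1/2) X ` cbox 0 (\<chi> i. 1) \<subseteq> cbox 0 (\<chi> i. 1)
    \<longleftrightarrow> (\<forall>x. (\<forall>i. \<bar>x $ i\<bar> \<le> 1/2) \<longrightarrow> (\<forall>i. \<bar>(X *v x) $ i\<bar> \<le> 1/2))" (is "?L \<longleftrightarrow> ?R")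
proof -
  let ?c = "(\<chi> i. 1/2) :: real^3"
  have box: "y \<in> cbox 0 (\<chi> i. 1) \<longleftrightarrow> (\<forall>i. \<bar>(y - ?c) $ i\<bar> \<le> 1/2)" for y :: "real^3"
    by (auto simp: mem_box_cart abs_le_iff field_simps)
  have rot: "rotate_about ?c X y - ?c = X *v (y - ?c)" for y by (simp add: rotate_about_def)
  have "?L \<longleftrightarrow> (\<forall>y. y \<in> cbox 0 (\<chi> i. 1) \<longrightarrow> rotate_about ?c X y \<in> cbox 0 (\<chi> i. 1))" by blast
  also have "\<dots> \<longleftrightarrow> (\<forall>y. (\<forall>i. \<bar>(y - ?c) $ i\<bar> \<le> 1/2) \<longrightarrow> (\<forall>i. \<bar>(X *v (y - ?c)) $ i\<bar> \<le> 1/2))"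
    unfolding box rot ..
  also have "\<dots> \<longleftrightarrow> ?R"
  proof
    assume *: "\<forall>y. (\<forall>i. \<bar>(y - ?c) $ i\<bar> \<le> 1/2) \<longrightarrow> (\<forall>i. \<bar>(X *v (y - ?c)) $ i\<bar> \<le> 1/2)"
    show ?R
    proof (intro allI impI)
      fix x :: "real^3" and i assume "\<forall>i. \<bar>x $ i\<bar> \<le> 1/2"
      then show "\<bar>(X *v x) $ i\<bar> \<le> 1/2" using *[rule_format, of "x + ?c" i] by simp
    qed
  qed blast
  finally show ?thesis .
qed

text \<open>A rotation maps the cube with vertices \<open>(\<plusminus>1/2, \<plusminus>1/2,
  \<plusminus>1/2)\<close> into itself only if the absolute values in each row add up to at most 1,
  as one sees at the vertex given by the signs of the row. As their squares add up to 1, each entry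
  is its own square up to sign.\<close>

lemma cube_rotations_eq: "cube_rotations = integral_rotations"
proof (intro equalityI subsetI)
  fix X assume "X \<in> cube_rotations"
  then have rot: "rotation_matrix X" and
    cube: "\<And>x i. (\<And>i. \<bar>x $ i\<bar> \<le> 1/2) \<Longrightarrow> \<bar>(X *v x) $ i\<bar> \<le> 1/2"
    using rotate_about_cube_iff[of X] by (auto simp: cube_rotations_def)
  have "X $ i $ j \<in> \<int>" for i j
  proof -
    (* The vertex at which the linear form given by row i is largest. *)
    define x :: "real^3" where "x = (\<chi> j. sgn (X $ i $ j) / 2)"
    have "\<bar>x $ j\<bar> \<le> 1/2" for j by (simp add: x_def abs_sgn_eq)
    then have "\<bar>(X *v x) $ i\<bar> \<le> 1/2" by (rule cube)
    moreover have "(X *v x) $ i = (\<Sum>j\<in>UNIV. \<bar>X $ i $ j\<bar>) / 2"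
      unfolding matrix_vector_mult_def x_def by (simp add: sum_divide_distrib abs_sgn)
    ultimately have l1: "(\<Sum>j\<in>UNIV. \<bar>X $ i $ j\<bar>) \<le> 1" by linarith
    have "(X ** transpose X) $ i $ i = 1"
      using rot by (simp add: rotation_matrix_def orthogonal_matrix_def mat_def)
    then have l2: "(\<Sum>j\<in>UNIV. (X $ i $ j)\<^sup>2) = 1"
      by (simp add: matrix_matrix_mult_def transpose_def power2_eq_square)
    have le1: "\<bar>X $ i $ j\<bar> \<le> 1" for j
      using member_le_sum[of j UNIV "\<lambda>j. \<bar>X $ i $ j\<bar>"] l1 by simp
    have nonneg: "0 \<le> \<bar>X $ i $ j\<bar> - (X $ i $ j)\<^sup>2" for j
      using mult_left_mono[OF le1[of j], of "\<bar>X $ i $ j\<bar>"] by (simp add: power2_eq_square flip: abs_mult)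
    have "(\<Sum>j\<in>UNIV. \<bar>X $ i $ j\<bar> - (X $ i $ j)\<^sup>2) \<le> 0" using l1 l2 by (simp add: sum_subtractf)
    moreover have "0 \<le> (\<Sum>j\<in>UNIV. \<bar>X $ i $ j\<bar> - (X $ i $ j)\<^sup>2)" by (intro sum_nonneg nonneg)
    ultimately have "(\<Sum>j\<in>UNIV. \<bar>X $ i $ j\<bar> - (X $ i $ j)\<^sup>2) = 0" by linarith
    then have "\<bar>X $ i $ j\<bar> = (X $ i $ j)\<^sup>2" using nonneg by (simp add: sum_nonneg_eq_0_iff)
    moreover have "\<bar>X $ i $ j\<bar> * \<bar>X $ i $ j\<bar> = (X $ i $ j)\<^sup>2" by (simp add: power2_eq_square)
    ultimately have "\<bar>X $ i $ j\<bar> * (\<bar>X $ i $ j\<bar> - 1) = 0" unfolding right_diff_distrib by linarith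
    then have "X $ i $ j = 0 \<or> X $ i $ j = 1 \<or> X $ i $ j = -1" by auto
    then show ?thesis by auto
  qed
  then show "X \<in> integral_rotations" using rot by (simp add: integral_rotations_def)
next
  fix X assume X: "X \<in> integral_rotations"
  have sub: "rotate_about (\<chi> i. 1/2) Y ` cbox 0 (\<chi> i. 1) \<subseteq> cbox 0 (\<chi> i. 1)" if "Y \<in> integral_rotations" for Y
    unfolding rotate_about_cube_iff using rotation_half_cube_le[OF that] by blast
  have inv: "rotate_about (\<chi> i. 1/2) X (rotate_about (\<chi> i. 1/2) (transpose X) y) = y" for y
    by (simp add: rotate_about_def rotation_inverse[OF X])
  have "cbox 0 (\<chi> i. 1) \<subseteq> rotate_about (\<chi> i. 1/2) X ` cbox 0 (\<chi> i. 1)"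
  proof
    fix y :: "real^3" assume y: "y \<in> cbox 0 (\<chi> i. 1)"
    have "rotate_about (\<chi> i. 1/2) (transpose X) y \<in> cbox 0 (\<chi> i. 1)"
      using sub[OF integral_rotations_transpose[OF X]] y by blast
    then show "y \<in> rotate_about (\<chi> i. 1/2) X ` cbox 0 (\<chi> i. 1)" using inv[of y] by (metis imageI)
  qed
  then show "X \<in> cube_rotations" using sub[OF X] X by (auto simp: cube_rotations_def integral_rotations_def)
qed

definition array_rotation :: "nat \<Rightarrow> real^3^3 \<Rightarrow> real^3 \<Rightarrow> real^3" where
  "array_rotation n X = restrict (rotate_about (\<chi> i. (real n + 1) / 2) X) (discrete_torus n)"

lemma array_rotations_eq: "array_rotations n = array_rotation n ` integral_rotations"
  by (simp add: array_rotations_def array_rotation_def[abs_def] cube_rotations_eq)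

lemma array_rotation_component:
  assumes X: "X \<in> integral_rotations"
  obtains j where "(\<forall>p\<in>discrete_torus n. array_rotation n X p $ i = p $ j)
     \<or> (\<forall>p\<in>discrete_torus n. array_rotation n X p $ i = real n + 1 - p $ j)"
proof -
  obtain j s where js: "s = 1 \<or> s = -1" "\<And>x. (X *v x) $ i = s * x $ j" using rotation_component[OF X, of i] by metis
  have eq: "array_rotation n X p $ i = (real n + 1) / 2 + s * (p $ j - (real n + 1) / 2)" if "p \<in> discrete_torus n" for p
    using that js(2)[of "p - (\<chi> i. (real n + 1) / 2)"] by (simp add: array_rotation_def rotate_about_def)
  from js(1) show thesis
  proof
    assume "s = 1" then show thesis by (intro that[of j] disjI1 ballI) (simp add: eq)
  next
    assume "s = -1" then show thesis by (intro that[of j] disjI2 ballI) (simp add: eq field_simps)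
  qed
qed

lemma array_rotation_in_torus:
  assumes X: "X \<in> integral_rotations" and p: "p \<in> discrete_torus n"
  shows "array_rotation n X p \<in> discrete_torus n"
  unfolding discrete_torus_def
proof (intro CollectI allI)
  fix i
  obtain j where "(\<forall>p\<in>discrete_torus n. array_rotation n X p $ i = p $ j)
     \<or> (\<forall>p\<in>discrete_torus n. array_rotation n X p $ i = real n + 1 - p $ j)" using array_rotation_component[OF X] .
  then have j: "array_rotation n X p $ i = p $ j \<or> array_rotation n X p $ i = real n + 1 - p $ j" using p by blast
  obtain a where a: "1 \<le> a" "a \<le> n" "p $ j = real a" using discrete_torus_component[OF p] .
  from j show "array_rotation n X p $ i \<in> real ` {1..n}"
  proof
    assume "array_rotation n X p $ i = p $ j" then show ?thesis using a by auto
  next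
    assume "array_rotation n X p $ i = real n + 1 - p $ j"
    then have "array_rotation n X p $ i = real (n + 1 - a)" using a by (simp add: of_nat_diff)
    moreover have "n + 1 - a \<in> {1..n}" using a by auto
    ultimately show ?thesis by blast
  qed
qed

lemma array_rotation_Bij: assumes X: "X \<in> integral_rotations" shows "array_rotation n X \<in> Bij (discrete_torus n)"
proof (rule Bij_finiteI[OF finite_discrete_torus array_rotation_in_torus[OF X]])
  show "inj_on (array_rotation n X) (discrete_torus n)"
  proof (rule inj_onI)
    fix p q assume pq: "p \<in> discrete_torus n" "q \<in> discrete_torus n" "array_rotation n X p = array_rotation n X q"
    then have "X *v (p - (\<chi> i. (real n + 1) / 2)) = X *v (q - (\<chi> i. (real n + 1) / 2))"
      by (simp add: array_rotation_def rotate_about_def)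
    then have "p - (\<chi> i. (real n + 1) / 2) = q - (\<chi> i. (real n + 1) / 2)"
      using rotation_inj[OF X] by (rule injD[rotated])
    then show "p = q" by simp
  qed
qed (simp_all only: array_rotation_def restrict_extensional)

text \<open>The rotation of the array and the rotation of space about the origin differ by a translation,
  which is harmless for the cyclic orders.\<close>

lemma array_rotation_pattern:
  assumes X: "X \<in> integral_rotations" and T: "T \<in> patterns n" and n: "n \<ge> 1"
  shows "array_rotation n X ` T \<in> patterns n"
    "order_equiv ((*v) X ` pattern_config n T) (pattern_config n (array_rotation n X ` T))"
proof -
  have D: "p \<in> discrete_torus n" if "p \<in> T" for p using patternD(1)[OF T] that by blast
  show "array_rotation n X ` T \<in> patterns n"
  proof (rule image_pattern[OF T array_rotation_in_torus[OF X]])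
    fix p q i assume pq: "p \<in> T" "q \<in> T" "p \<noteq> q"
    obtain j where "(\<forall>p\<in>discrete_torus n. array_rotation n X p $ i = p $ j)
     \<or> (\<forall>p\<in>discrete_torus n. array_rotation n X p $ i = real n + 1 - p $ j)" using array_rotation_component[OF X] .
    then show "array_rotation n X p $ i \<noteq> array_rotation n X q $ i"
      using D[OF pq(1)] D[OF pq(2)] patternD(4)[OF T pq, of j] by auto
  qed
  let ?c = "(\<chi> i. (real n + 1) / 2) :: real^3"
  define w where "w = (1 / real n) *\<^sub>R (?c - X *v ?c)"
  have "X *v ((1 / real n) *\<^sub>R p) + w = (1 / real n) *\<^sub>R array_rotation n X p" if "p \<in> T" for p
    using D[OF that]
    by (simp add: w_def array_rotation_def rotate_about_def matrix_vector_mult_diff_distrib matrix_vector_mult_scaleR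
        scaleR_diff_right scaleR_add_right)
  then have "(\<lambda>y. y + w) ` (*v) X ` pattern_config n T = pattern_config n (array_rotation n X ` T)"
    by (simp add: pattern_config_def image_image)
  then show "order_equiv ((*v) X ` pattern_config n T) (pattern_config n (array_rotation n X ` T))"
    by (intro order_equiv_translate[of w]) simp
qed

lemma shift_orbit:
  assumes T: "T \<in> patterns n" and n: "n \<ge> 1"
  shows "(\<lambda>g. g ` T) ` cyclic_shifts n = {T' \<in> patterns n. order_equiv (pattern_config n T) (pattern_config n T')}"
  using shift_pattern[OF T n] order_equiv_imp_shift[OF T _ n] unfolding cyclic_shifts_eq by blast

abbreviation pattern_group :: "nat \<Rightarrow> (real^3 \<Rightarrow> real^3) set" where
  "pattern_group n \<equiv> generate (BijGroup (discrete_torus n)) (cyclic_shifts n \<union> array_rotations n)"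

lemma compose_image: "T \<subseteq> D \<Longrightarrow> compose D g h ` T = g ` h ` T"
  unfolding image_image by (intro image_cong) (auto simp: compose_def)

text \<open>For the inverse of a generator \<open>h\<close>, one uses that \<open>h\<close> permutes the
  finite set of patterns and that the equivalence is symmetric.\<close>

lemma pattern_group_acts:
  assumes g: "g \<in> pattern_group n" and n: "n \<ge> 1"
  shows "g \<in> Bij (discrete_torus n) \<and> (\<forall>T\<in>patterns n. g ` T \<in> patterns n \<and> rot_equiv (pattern_config n T) (pattern_config n (g ` T)))"
  using g
proof (induction rule: generate.induct)
  let ?D = "discrete_torus n" and ?c = "pattern_config n"
  have gen: "generic (?c T)" if "T \<in> patterns n" for T
    using pattern_config_in_configs[OF that n] by (simp add: configs_def)
  have generator: "h \<in> Bij ?D \<and> (\<forall>T\<in>patterns n. h ` T \<in> patterns n \<and> rot_equiv (?c T) (?c (h ` T)))"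
    if "h \<in> cyclic_shifts n \<union> array_rotations n" for h
    using that
  proof
    assume "h \<in> cyclic_shifts n"
    then obtain k where "h = shift n k" by (auto simp: cyclic_shifts_eq)
    then show ?thesis using shift_Bij shift_pattern[OF _ n] order_imp_rot_equiv by blast
  next
    assume "h \<in> array_rotations n"
    then obtain X where "X \<in> integral_rotations" "h = array_rotation n X" by (auto simp: array_rotations_eq)
    then show ?thesis using array_rotation_Bij array_rotation_pattern[OF _ _ n] unfolding rot_equiv_def by blast
  qed
  {
    case one
    have one: "\<one>\<^bsub>BijGroup ?D\<^esub> = (\<lambda>x\<in>?D. x)" by (simp add: BijGroup_def)
    have id: "(\<lambda>x\<in>?D. x) ` T = T" if "T \<in> patterns n" for T
    proof -
      have "(\<lambda>x\<in>?D. x) ` T = (\<lambda>x. x) ` T" using patternD(1)[OF that] by (intro image_cong) auto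
      then show ?thesis by simp
    qed
    show ?case unfolding one by (intro conjI ballI id_Bij) (simp_all only: id rot_equiv_refl)
  next
    case (incl h) then show ?case by (rule generator)
  next
    case (inv h)
    have h: "h \<in> Bij ?D" and act: "\<And>T. T \<in> patterns n \<Longrightarrow> h ` T \<in> patterns n \<and> rot_equiv (?c T) (?c (h ` T))"
      using generator[OF inv] by auto
    have inj: "inj_on h ?D" using h by (simp add: Bij_def bij_betw_def)
    let ?h = "\<lambda>x\<in>?D. inv_into ?D h x"
    have hinv: "?h ` h ` T = T" if "T \<in> patterns n" for T
    proof -
      have hh: "?h (h p) = p" if "p \<in> ?D" for p using that inj h by (auto simp: Bij_def bij_betw_def)
      have "?h ` h ` T = (\<lambda>p. p) ` T" unfolding image_image
      proof (rule image_cong[OF refl])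
        fix p assume "p \<in> T"
        then show "?h (h p) = p" using patternD(1)[OF that] by (intro hh) blast
      qed
      then show ?thesis by simp
    qed
    have "inj_on ((`) h) (patterns n)" using hinv by (metis inj_onI)
    then have onto: "(`) h ` patterns n = patterns n"
      using act by (intro endo_inj_surj[OF finite_patterns]) auto
    have "?h ` T \<in> patterns n \<and> rot_equiv (?c T) (?c (?h ` T))" if T: "T \<in> patterns n" for T
    proof -
      obtain T0 where T0: "T0 \<in> patterns n" "T = h ` T0" using onto T by blast
      then have "?h ` T = T0" using hinv by simp
      moreover have "rot_equiv (?c T) (?c T0)" using act[OF T0(1)] T0(2) rot_equiv_sym gen[OF T0(1)] by blast
      ultimately show ?thesis using T0(1) by simp
    qed
    then show ?case unfolding inv_BijGroup[OF h] using restrict_inv_into_Bij[OF h] by blast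
  next
    case (eng h1 h2)
    have mult: "h1 \<otimes>\<^bsub>BijGroup ?D\<^esub> h2 = compose ?D h1 h2" using eng.IH by (simp add: BijGroup_def)
    have comp: "compose ?D h1 h2 ` T = h1 ` h2 ` T" if "T \<in> patterns n" for T
      by (rule compose_image[OF patternD(1)[OF that]])
    show ?case unfolding mult
    proof (intro conjI ballI)
      show "compose ?D h1 h2 \<in> Bij ?D" using eng.IH by (intro compose_Bij) blast+
      fix T assume T: "T \<in> patterns n"
      have 2: "h2 ` T \<in> patterns n" "rot_equiv (?c T) (?c (h2 ` T))" using eng.IH T by blast+
      have 1: "h1 ` h2 ` T \<in> patterns n" "rot_equiv (?c (h2 ` T)) (?c (h1 ` h2 ` T))" using eng.IH 2(1) by blast+
      show "compose ?D h1 h2 ` T \<in> patterns n" unfolding comp[OF T] by (rule 1(1))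
      show "rot_equiv (?c T) (?c (compose ?D h1 h2 ` T))" unfolding comp[OF T]
        by (rule rot_equiv_trans[OF gen[OF T] gen[OF 2(1)] 2(2) 1(2)])
    qed
  }
qed

text \<open>An equivalence of patterns up to a rotation is realized by a rotation of the array, followed by a
  cyclic shift.\<close>

lemma pattern_group_orbit:
  assumes T: "T \<in> patterns n" and n: "n \<ge> 1"
  shows "(\<lambda>g. g ` T) ` pattern_group n = {T' \<in> patterns n. rot_equiv (pattern_config n T) (pattern_config n T')}"
proof (intro equalityI subsetI)
  fix T' assume "T' \<in> (\<lambda>g. g ` T) ` pattern_group n"
  then show "T' \<in> {T' \<in> patterns n. rot_equiv (pattern_config n T) (pattern_config n T')}"
    using pattern_group_acts[OF _ n] T by blast
next
  fix T' assume "T' \<in> {T' \<in> patterns n. rot_equiv (pattern_config n T) (pattern_config n T')}"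
  then obtain X where T': "T' \<in> patterns n" and X: "X \<in> integral_rotations"
    "order_equiv ((*v) X ` pattern_config n T) (pattern_config n T')" by (auto simp: rot_equiv_def)
  let ?D = "discrete_torus n" and ?r = "array_rotation n X"
  note r = array_rotation_pattern[OF X(1) T n]
  have "generic (pattern_config n T)" using pattern_config_in_configs[OF T n] by (simp add: configs_def)
  then have genX: "generic ((*v) X ` pattern_config n T)" by (rule generic_rotate[OF X(1)])
  have "order_equiv (pattern_config n (?r ` T)) (pattern_config n T')"
    using order_equiv_trans[OF genX order_equiv_sym[OF genX r(2)] X(2)] .
  then obtain k where k: "T' = shift n k ` ?r ` T" using order_equiv_imp_shift[OF r(1) T' n] by blast
  have "shift n k \<in> pattern_group n" "?r \<in> pattern_group n"
    using X(1) by (auto intro!: generate.incl simp: cyclic_shifts_eq array_rotations_eq)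
  then have "shift n k \<otimes>\<^bsub>BijGroup ?D\<^esub> ?r \<in> pattern_group n" by (rule generate.eng)
  moreover have "shift n k \<otimes>\<^bsub>BijGroup ?D\<^esub> ?r = compose ?D (shift n k) ?r"
    using shift_Bij array_rotation_Bij[OF X(1)] by (simp add: BijGroup_def)
  moreover have "compose ?D (shift n k) ?r ` T = T'"
    unfolding k by (rule compose_image[OF patternD(1)[OF T]])
  ultimately show "T' \<in> (\<lambda>g. g ` T) ` pattern_group n" by (metis imageI)
qed

lemma card_image_eq_card_image:
  assumes "\<And>x y. x \<in> S \<Longrightarrow> y \<in> S \<Longrightarrow> f x = f y \<longleftrightarrow> g x = g y" shows "card (f ` S) = card (g ` S)"
proof -
  define h where "h z = g (SOME x. x \<in> S \<and> f x = z)" for z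
  have h: "h (f x) = g x" if "x \<in> S" for x
  proof -
    have "(SOME y. y \<in> S \<and> f y = f x) \<in> S \<and> f (SOME y. y \<in> S \<and> f y = f x) = f x"
      by (rule someI[of "\<lambda>y. y \<in> S \<and> f y = f x" x]) (simp add: that)
    then show ?thesis using assms[of "SOME y. y \<in> S \<and> f y = f x" x] that unfolding h_def by blast
  qed
  then have "h ` f ` S = g ` S" by (simp add: image_image)
  moreover have "inj_on h (f ` S)" using h assms by (auto simp: inj_on_def)
  ultimately show ?thesis by (metis card_image)
qed

text \<open>The classes of objects \<open>K P\<close> and the orbits of patterns are both indexed by the
  patterns, and two patterns \<open>T\<close> and \<open>U\<close> give the same class exactly when
  they give the same orbit, namely when \<open>E (F T) (F U)\<close>.\<close>

lemma num_classes_eq_card_orbits: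
  assumes A: "A = K ` C" and R: "\<And>P Q. P \<in> C \<Longrightarrow> Q \<in> C \<Longrightarrow> R (K P) (K Q) \<longleftrightarrow> E P Q"
    and refl: "\<And>P. P \<in> C \<Longrightarrow> E P P" and sym: "\<And>P Q. P \<in> C \<Longrightarrow> Q \<in> C \<Longrightarrow> E P Q \<Longrightarrow> E Q P"
    and trans: "\<And>P Q S. P \<in> C \<Longrightarrow> Q \<in> C \<Longrightarrow> S \<in> C \<Longrightarrow> E P Q \<Longrightarrow> E Q S \<Longrightarrow> E P S"
    and F: "\<And>T. T \<in> \<T> \<Longrightarrow> F T \<in> C" and rep: "\<And>P. P \<in> C \<Longrightarrow> \<exists>T\<in>\<T>. E P (F T)"
    and orb: "\<And>T. T \<in> \<T> \<Longrightarrow> Orb T = {T' \<in> \<T>. E (F T) (F T')}"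
  shows "num_classes A R = card (Orb ` \<T>)"
proof -
  define r where "r = {(x, y). x \<in> A \<and> y \<in> A \<and> R x y}"
  have cls: "r `` {K P} = K ` {Q \<in> C. E P Q}" if "P \<in> C" for P
    using that R by (auto simp: r_def A)
  have cls_eq: "r `` {K P} = r `` {K Q} \<longleftrightarrow> E P Q" if P: "P \<in> C" and Q: "Q \<in> C" for P Q
  proof
    assume "r `` {K P} = r `` {K Q}"
    moreover have "K Q \<in> r `` {K Q}" using Q refl R by (auto simp: r_def A)
    ultimately have "K Q \<in> r `` {K P}" by simp
    then show "E P Q" using R[OF P Q] by (simp add: r_def)
  next
    assume E: "E P Q"
    have "{S \<in> C. E P S} = {S \<in> C. E Q S}" using sym trans P Q E by blast
    then show "r `` {K P} = r `` {K Q}" using cls P Q by simp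
  qed
  have "A // r = (\<lambda>P. r `` {K P}) ` C" by (auto simp: quotient_def A)
  also have "\<dots> = (\<lambda>T. r `` {K (F T)}) ` \<T>"
  proof (intro equalityI subsetI)
    fix c assume "c \<in> (\<lambda>P. r `` {K P}) ` C"
    then obtain P where P: "P \<in> C" "c = r `` {K P}" by blast
    obtain T where "T \<in> \<T>" "E P (F T)" using rep[OF P(1)] by blast
    then have "c = r `` {K (F T)}" using cls_eq[OF P(1) F] P(2) by blast
    then show "c \<in> (\<lambda>T. r `` {K (F T)}) ` \<T>" using \<open>T \<in> \<T>\<close> by blast
  qed (use F in blast)
  finally have "num_classes A R = card ((\<lambda>T. r `` {K (F T)}) ` \<T>)" by (simp add: num_classes_def r_def)
  also have "\<dots> = card (Orb ` \<T>)"
  proof (rule card_image_eq_card_image)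
    fix T U assume T: "T \<in> \<T>" and U: "U \<in> \<T>"
    have "Orb T = Orb U \<longleftrightarrow> E (F T) (F U)"
    proof
      assume "Orb T = Orb U"
      moreover have "U \<in> Orb U" using orb[OF U] U refl F by simp
      ultimately show "E (F T) (F U)" using orb[OF T] by blast
    next
      assume "E (F T) (F U)"
      then have "E (F T) (F S) \<longleftrightarrow> E (F U) (F S)" if "S \<in> \<T>" for S
        using sym trans F[OF T] F[OF U] F[OF that] by blast
      then show "Orb T = Orb U" using orb T U by auto
    qed
    then show "r `` {K (F T)} = r `` {K (F U)} \<longleftrightarrow> Orb T = Orb U" using cls_eq F T U by simp
  qed
  finally show ?thesis .
qed

lemma num_pattern_orbits_eq: "num_pattern_orbits n H = card ((\<lambda>T. (\<lambda>g. g ` T) ` H) ` patterns n)"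
proof -
  have "orbits ((BijGroup (discrete_torus n))\<lparr>carrier := H\<rparr>) (patterns n) (\<lambda>g P. g ` P) = (\<lambda>T. (\<lambda>g. g ` T) ` H) ` patterns n"
    by (simp add: orbits_def orbit_def setcompr_eq_image)
  then show ?thesis by (simp add: num_pattern_orbits_def)
qed

theorem theorem8p2:
  fixes n :: nat
  assumes "n \<ge> 1"
  shows "num_classes (grid_knots n) linearly_isotopic = alpha n
       \<and> num_classes (grid_knots n) rotationally_linearly_isotopic = beta n
       \<and> num_classes {G. n_grid n G} periodically_isotopic = beta n"
proof -
  have conf: "finite P" "generic P" "P \<noteq> {}" if "P \<in> configs n" for P
    using that assms by (auto simp: configs_def)
  have knots: "grid_knots n = grid_knot ` configs n" by (auto simp: grid_knots_def n_grid_iff)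
  have grids: "{G. n_grid n G} = grid ` configs n" by (auto simp: n_grid_iff)
  have LI: "linearly_isotopic (grid_knot P) (grid_knot Q) \<longleftrightarrow> order_equiv P Q" if "P \<in> configs n" for P Q
    using linearly_isotopic_if_order_equiv order_equiv_if_linearly_isotopic conf[OF that] by blast
  have RI: "rotationally_linearly_isotopic (grid_knot P) (grid_knot Q) \<longleftrightarrow> rot_equiv P Q"
    if P: "P \<in> configs n" and Q: "Q \<in> configs n" for P Q
  proof -
    have X: "X \<in> GL3Z_plus \<and> rotation_matrix X \<longleftrightarrow> X \<in> integral_rotations" for X
      by (auto simp: GL3Z_plus_def integral_rotations_def rotation_matrix_def)
    have "rotationally_linearly_isotopic (grid_knot P) (grid_knot Q)
        \<longleftrightarrow> (\<exists>X\<in>integral_rotations. linearly_isotopic (grid_knot Q) (grid_knot ((*v) X ` P)))"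
      unfolding rotationally_linearly_isotopic_def using X grid_knot_rotation[of _ P] by metis
    also have "\<dots> \<longleftrightarrow> (\<exists>X\<in>integral_rotations. order_equiv Q ((*v) X ` P))" using LI[OF Q] by simp
    also have "\<dots> \<longleftrightarrow> rot_equiv P Q"
      unfolding rot_equiv_def using order_equiv_sym conf(2)[OF Q] generic_rotate conf(2)[OF P] by blast
    finally show ?thesis .
  qed
  have PI: "periodically_isotopic (grid P) (grid Q) \<longleftrightarrow> rot_equiv P Q" if "P \<in> configs n" for P Q
    using periodically_isotopic_if_rot_equiv rot_equiv_if_periodically_isotopic conf[OF that] by blast
  note F = pattern_config_in_configs[OF _ assms]
  have rep: "\<exists>T\<in>patterns n. order_equiv P (pattern_config n T)" if "P \<in> configs n" for P
    by (rule config_order_equiv_pattern[OF that assms])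
  then have rep': "\<exists>T\<in>patterns n. rot_equiv P (pattern_config n T)" if "P \<in> configs n" for P
    using that order_imp_rot_equiv by blast
  have "num_classes (grid_knots n) linearly_isotopic = alpha n"
    unfolding alpha_def num_pattern_orbits_eq
    by (rule num_classes_eq_card_orbits[OF knots LI order_equiv_refl _ _ F rep shift_orbit[OF _ assms]])
       (use order_equiv_sym order_equiv_trans conf(2) in \<open>blast+\<close>)
  moreover have "num_classes (grid_knots n) rotationally_linearly_isotopic = beta n"
    unfolding beta_def num_pattern_orbits_eq
    by (rule num_classes_eq_card_orbits[OF knots RI rot_equiv_refl _ _ F rep' pattern_group_orbit[OF _ assms]])
       (use rot_equiv_sym rot_equiv_trans conf(2) in \<open>blast+\<close>)
  moreover have "num_classes {G. n_grid n G} periodically_isotopic = beta n"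
    unfolding beta_def num_pattern_orbits_eq
    by (rule num_classes_eq_card_orbits[OF grids PI rot_equiv_refl _ _ F rep' pattern_group_orbit[OF _ assms]])
       (use rot_equiv_sym rot_equiv_trans conf(2) in \<open>blast+\<close>)
  ultimately show ?thesis by blast
qed

end
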